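(* Let $n\ge2$ and $1\le\ell\le n-1$. Let $\mathbf{P}^{n,\ell}$ be the unique Gibbs probability measure on bead configurations on $\mathbb{R}\times\mathbb{Z}_n$ with occupation number $\ell$ and density $\frac1n\frac{\sin(\pi\ell/n)}{\sin(\pi/n)}$ of beads per string, and let $(X_t)_{t\in\mathbb{R}}$ be the associated occupation process. For an $\ell$-element subset $E=\{h_1,\ldots,h_\ell\}$ of $\mathbb{Z}_n$ let $$\Delta(E):=\prod_{1\le j<k\le\ell}\left|e^{2\pi\iota h_k/n}-e^{2\pi\iota h_j/n}\right| .$$ Then the transition rates of $(X_t)_{t\in\mathbb{R}}$ under $\mathbf{P}^{n,\ell}$ are $$\lim_{t\downarrow0}\frac1t\,\mathbf{P}^{n,\ell}(X_t=E'\mid X_0=E)=\frac{\Delta(E')}{\Delta(E)}\qquad\text{whenever }E'=(E\setminus\{h\})\cup\{h+1\}\text{ with }h\in E,\ h+1\notin E,$$ and the stationary distribution is given by $$\mathbf{P}^{n,\ell}(X_0=E)=\Delta(E)^2/n^\ell$$ for every $\ell$-element subset $E$ of $\mathbb{Z}_n$.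
   Context: $\iota=\sqrt{-1}$; $\mathbb{Z}_n=\mathbb{Z}/n\mathbb{Z}=\{0,\ldots,n-1\}$; string labels are mod $n$. Bead configurations with occupation number $\ell$ on $\mathbb{R}\times\mathbb{Z}_n$ are described by occupation processes $(X_t)_{t\in\mathbb{R}}$: right-continuous, piecewise constant maps into the $\ell$-element subsets of $\mathbb{Z}_n$, with finitely many discontinuities on bounded intervals, each discontinuity being of the form $X_t=(X_{t-}\setminus\{h\})\cup\{h+1\}$ with $h\in X_{t-}$, $h+1\notin X_{t-}$; then $(t,h)$ is called a bead. Gibbs measure: a probability measure such that for all $a<b$, conditionally on $(X_s)_{s\notin(a,b)}$ and on the number $m$ of beads in $(a,b)\times\mathbb{Z}_n$, the beads in $(a,b)\times\mathbb{Z}_n$ are distributed according to normalised Lebesgue measure on the set of $m$-bead configurations compatible with the process outside $(a,b)$. It has density $d$ of beads per string if for each $h$, almost surely $\frac{1}{2L}\#\{\text{beads in }[-L,L]\times\{h\}\}\to d$ as $L\to\infty$. By a theorem of Gordenko, for each $1\le\ell\le n-1$ and each given density there is a unique Gibbs probability measure with occupation number $\ell$, and under it $(X_t)_{t\in\mathbb{R}}$ is a continuous-time Markov chain having the law of $\ell$ independent Poisson walkers on the ring $\mathbb{Z}_n$ conditioned never to collide. *)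

theory Defs
  imports "HOL-Probability.Probability"
begin

text \<open>The ring of strings is represented by \<open>{..<n}\<close>, with string \<open>h + 1\<close> being
  \<open>Suc h mod n\<close>.\<close>

definition occupied_sets :: "nat \<Rightarrow> nat \<Rightarrow> nat set set" where
  "occupied_sets n l = {E. E \<subseteq> {..<n} \<and> card E = l}"

definition hop :: "nat \<Rightarrow> nat set \<Rightarrow> nat \<Rightarrow> nat set \<Rightarrow> bool" where
  "hop n E h E' \<longleftrightarrow> h \<in> E \<and> Suc h mod n \<notin> E \<and> E' = insert (Suc h mod n) (E - {h})"

text \<open>Limits of paths are taken in the discrete topology on subsets, so that having a one-sided limit
  means being eventually constant. \<open>left_lim X t\<close> is only meaningful if the left limit exists;
  it always does for the members of \<open>bead_paths\<close>.\<close>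

definition left_lim :: "(real \<Rightarrow> 'a) \<Rightarrow> real \<Rightarrow> 'a" where
  "left_lim X t = (THE E. \<forall>\<^sub>F s in at_left t. X s = E)"

text \<open>Occupation processes. For a right-continuous path the discontinuities are the times \<open>t\<close> at
  which \<open>left_lim X t\<close> differs from \<open>X t\<close>.\<close>

definition bead_paths :: "nat \<Rightarrow> nat \<Rightarrow> (real \<Rightarrow> nat set) set" where
  "bead_paths n l = {X.
     (\<forall>t. X t \<in> occupied_sets n l) \<and>
     (\<forall>t. \<forall>\<^sub>F s in at_right t. X s = X t) \<and>
     (\<forall>t. \<exists>E. \<forall>\<^sub>F s in at_left t. X s = E) \<and>
     (\<forall>a b. finite {t \<in> {a..b}. left_lim X t \<noteq> X t}) \<and>
     (\<forall>t. left_lim X t \<noteq> X t \<longrightarrow> (\<exists>h. hop n (left_lim X t) h (X t)))}"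

definition beads :: "nat \<Rightarrow> (real \<Rightarrow> nat set) \<Rightarrow> (real \<times> nat) set" where
  "beads n X = {(t, h). hop n (left_lim X t) h (X t)}"

definition beads_in :: "nat \<Rightarrow> real \<Rightarrow> real \<Rightarrow> (real \<Rightarrow> nat set) \<Rightarrow> (real \<times> nat) set" where
  "beads_in n a b X = beads n X \<inter> ({a<..<b} \<times> {..<n})"

definition bead_space :: "nat \<Rightarrow> nat \<Rightarrow> (real \<Rightarrow> nat set) measure" where
  "bead_space n l = sigma (bead_paths n l) {{X \<in> bead_paths n l. X t = E} | t E. True}"

text \<open>The \<open>\<sigma>\<close>-algebra generated by the process outside \<open>(a, b)\<close> and by the number of beads inside.\<close>

definition outside_algebra :: "nat \<Rightarrow> nat \<Rightarrow> real \<Rightarrow> real \<Rightarrow> (real \<Rightarrow> nat set) measure" where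
  "outside_algebra n l a b = sigma (bead_paths n l)
     ({{X \<in> bead_paths n l. X s = E} | s E. s \<notin> {a<..<b}} \<union>
      {{X \<in> bead_paths n l. card (beads_in n a b X) = m} | m. True})"

text \<open>An \<open>m\<close>-bead configuration is represented by any of the \<open>m!\<close> injective tuples
  \<open>c :: nat \<Rightarrow> real \<times> nat\<close> on \<open>{..<m}\<close> enumerating it; the reference measure on tuples is the
  \<open>m\<close>-fold product of Lebesgue measure on the line times counting measure on the strings.
  Since all enumerations are weighted equally, normalising on tuples is the same as normalising
  on configurations. The set \<open>configs n l a b X m A\<close> consists of the configurations in
  \<open>(a, b)\<close> for which splicing with \<open>X\<close> outside \<open>(a, b)\<close> gives an occupation process
  belonging to \<open>A\<close>; that process is unique, as it is determined by \<open>X a\<close> and its beads.\<close>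

definition tuple_measure :: "nat \<Rightarrow> nat \<Rightarrow> (nat \<Rightarrow> real \<times> nat) measure" where
  "tuple_measure n m = PiM {..<m} (\<lambda>_. lborel \<Otimes>\<^sub>M count_space {..<n})"

definition configs ::
  "nat \<Rightarrow> nat \<Rightarrow> real \<Rightarrow> real \<Rightarrow> (real \<Rightarrow> nat set) \<Rightarrow> nat \<Rightarrow> (real \<Rightarrow> nat set) set
    \<Rightarrow> (nat \<Rightarrow> real \<times> nat) set" where
  "configs n l a b X m A =
     {c \<in> space (tuple_measure n m). inj_on c {..<m} \<and>
        (\<exists>Y \<in> bead_paths n l \<inter> A.
           (\<forall>s. s \<notin> {a<..<b} \<longrightarrow> Y s = X s) \<and> beads_in n a b Y = c ` {..<m})}"

definition uniform_beads ::
  "nat \<Rightarrow> nat \<Rightarrow> real \<Rightarrow> real \<Rightarrow> (real \<Rightarrow> nat set) \<Rightarrow> nat \<Rightarrow> (nat \<Rightarrow> real \<times> nat) measure" where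
  "uniform_beads n l a b X m = uniform_measure (tuple_measure n m) (configs n l a b X m UNIV)"

definition gibbs_measure :: "nat \<Rightarrow> nat \<Rightarrow> (real \<Rightarrow> nat set) measure \<Rightarrow> bool" where
  "gibbs_measure n l P \<longleftrightarrow>
     prob_space P \<and> space P = bead_paths n l \<and> sets P = sets (bead_space n l) \<and>
     (\<forall>a b. a < b \<longrightarrow> (\<forall>A \<in> sets P. AE X in P.
        real_cond_exp P (outside_algebra n l a b) (indicator A) X =
          (let m = card (beads_in n a b X)
           in measure (uniform_beads n l a b X m) (configs n l a b X m A))))"

definition has_bead_density :: "nat \<Rightarrow> (real \<Rightarrow> nat set) measure \<Rightarrow> real \<Rightarrow> bool" where
  "has_bead_density n P d \<longleftrightarrow>
     (\<forall>h<n. AE X in P.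
        ((\<lambda>L. real (card (beads n X \<inter> ({- L..L} \<times> {h}))) / (2 * L)) \<longlongrightarrow> d) at_top)"

definition vdm :: "nat \<Rightarrow> nat set \<Rightarrow> real" where
  "vdm n E = (\<Prod>(j, k) \<in> {(j, k). j \<in> E \<and> k \<in> E \<and> j < k}.
     norm (exp (2 * of_real pi * \<i> * of_nat k / of_nat n) -
           exp (2 * of_real pi * \<i> * of_nat j / of_nat n)))"

end

theory Submission
  imports Defs "HOL-Combinatorics.Permutations"
begin

text \<open>Let \<open>A\<close> be the adjacency matrix of hops between \<open>l\<close>-element subsets of the ring. Partial fractions
  show that \<open>vdm\<close> is both a right and a left eigenvector of \<open>A\<close>, with eigenvalue
  \<open>lam = sin (pi l / n) / sin (pi / n)\<close>; this is \<open>n\<close> times the given density. Hence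
  \<open>ker k E F = (A^k)(E, F) vdm F / (lam^k vdm E)\<close> are the transition probabilities of a Markov chain with
  stationary law proportional to \<open>vdm\<^sup>2\<close>, and orthogonality of characters gives the normalisation
  \<open>n^l\<close>. The sum of the positions modulo \<open>n\<close> grows by one with every hop, and this is the only
  periodicity of the chain.

  Conditionally on the process outside \<open>(-L, L)\<close> and on the number \<open>m\<close> of beads inside, the bead
  times are independent and uniform, and the sequence of strings is uniform among the walks of length \<open>m\<close>
  with the given ends. The conditional probability of \<open>X s = G\<close> and \<open>X t = H\<close> is therefore an
  average of \<open>ker i E G * ker j G H * ker k H F / ker m E F\<close> over multinomial \<open>(i, j, k)\<close>. As
  \<open>L\<close> grows, \<open>m / (2 L)\<close> tends to \<open>lam\<close>, the chain mixes geometrically within its cyclic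
  classes, and \<open>i\<close> becomes equidistributed modulo \<open>n\<close>. This yields the one-time laws exactly and the
  two-time laws up to an error of order \<open>(t - s)\<^sup>2\<close>, uniformly in the boundary condition.\<close>

section \<open>Hops, walks and their counts\<close>

text \<open>Three obstacles shape the argument. Periodicity: \<open>ker k E F\<close> does not
  converge as \<open>k\<close> grows, so every limit has to follow residues modulo \<open>n\<close>.
  The residue of the split point becomes uniform because the number of beads before a given time is
  binomial, and this law damps every nontrivial character.

  Boundary: the states at \<open>- L\<close> and \<open>L\<close> and the bead count vary with
  \<open>L\<close> without control. Limits are therefore taken along subsequences on which the
  finitely many end states are frozen. All conditional probabilities have the same mean and are
  bounded, so dominated convergence turns pointwise asymptotics into a statement about the
  probability itself.

  Window ends: conditioning on the outside of an open window fixes the state at its right end but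
  not the left limit there. Almost surely the path has no bead at that time, and the phase modulo
  \<open>n\<close> rules one out for every competing configuration with the same bead count.

  The rates need only the two-time laws: over a short time span one bead gives the linear term, and
  two or more beads are of quadratic order.\<close>

lemma Suc_mod_self_neq: "2 \<le> n \<Longrightarrow> Suc h mod n \<noteq> h"
  using mod_less_divisor[of n "Suc h"] by (cases "h < n") (auto simp: mod_Suc)

definition hops :: "nat \<Rightarrow> nat set \<Rightarrow> nat set set" where
  "hops n E = {E'. \<exists>h. hop n E h E'}"

definition phase :: "nat \<Rightarrow> nat set \<Rightarrow> nat" where
  "phase n E = \<Sum>E mod n"

text \<open>A walk is recorded by the strings of its hops, which are exactly the labels carried by
  beads. The states in between are recovered from the start, because \<open>hop\<close> is
  deterministic once the string is known.\<close>

primrec hop_walk :: "nat \<Rightarrow> nat set \<Rightarrow> nat list \<Rightarrow> nat set \<Rightarrow> bool" where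
  "hop_walk n E [] F \<longleftrightarrow> E = F"
| "hop_walk n E (h # hs) F \<longleftrightarrow> (\<exists>E'. hop n E h E' \<and> hop_walk n E' hs F)"

definition walks :: "nat \<Rightarrow> nat \<Rightarrow> nat set \<Rightarrow> nat set \<Rightarrow> nat" where
  "walks n k E F = card {hs. length hs = k \<and> hop_walk n E hs F}"

lemma finite_occupied_sets: "finite (occupied_sets n l)"
  unfolding occupied_sets_def by (rule finite_subset[of _ "Pow {..<n}"]) auto

lemma hop_walk_append: "hop_walk n E (xs @ ys) F \<longleftrightarrow> (\<exists>G. hop_walk n E xs G \<and> hop_walk n G ys F)"
  by (induction xs arbitrary: E) auto

lemma hop_walk_take_drop:
  "hop_walk n E hs F \<longleftrightarrow> (\<exists>G. hop_walk n E (take j hs) G \<and> hop_walk n G (drop j hs) F)"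
  using hop_walk_append[of n E "take j hs" "drop j hs" F] by simp

lemma hop_det: "hop n E h E' \<Longrightarrow> hop n E h E'' \<Longrightarrow> E' = E''"
  by (simp add: hop_def)

lemma hop_walk_det: "hop_walk n E hs F \<Longrightarrow> hop_walk n E hs F' \<Longrightarrow> F = F'"
  by (induction hs arbitrary: E) (auto dest: hop_det)

lemma hop_neq: "hop n E h E' \<Longrightarrow> E' \<noteq> E"
  by (auto simp: hop_def)

text \<open>\<open>E - E'\<close> is the singleton of the departed string. Hence a time carries at
  most one bead, and one-step walk counts are 0 or 1.\<close>

lemma hop_string_unique: "hop n E h E' \<Longrightarrow> hop n E h' E' \<Longrightarrow> h = h'"
proof -
  have "E - E' = {h}" if "hop n E h E'" for h using that by (auto simp: hop_def)
  then show "hop n E h E' \<Longrightarrow> hop n E h' E' \<Longrightarrow> h = h'" by (metis the_elem_eq)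
qed

lemma hop_occupied:
  assumes "hop n E h E'" "E \<in> occupied_sets n l"
  shows "E' \<in> occupied_sets n l" "h < n"
proof -
  have "finite E" using assms finite_subset by (auto simp: occupied_sets_def)
  moreover from this have "card E > 0" using assms by (auto simp: hop_def card_gt_0_iff)
  ultimately show "E' \<in> occupied_sets n l" "h < n"
    using assms by (auto simp: hop_def occupied_sets_def card_insert_if)
qed

lemma hop_walk_occupied:
  "hop_walk n E hs F \<Longrightarrow> E \<in> occupied_sets n l \<Longrightarrow> F \<in> occupied_sets n l \<and> set hs \<subseteq> {..<n}"
  by (induction hs arbitrary: E) (auto dest: hop_occupied)

lemma hop_phase:
  assumes "hop n E h E'" "finite E"
  shows "phase n E' = Suc (phase n E) mod n"
proof -
  have "\<Sum>E' = Suc h mod n + \<Sum>(E - {h})" using assms by (auto simp: hop_def)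
  moreover have "\<Sum>E = h + \<Sum>(E - {h})" using assms sum.remove[of E h "\<lambda>x. x"] by (simp add: hop_def)
  ultimately show ?thesis by (simp add: phase_def) (metis add_Suc mod_add_left_eq mod_Suc_eq)
qed

lemma hop_walk_phase:
  assumes "hop_walk n E hs F" "E \<in> occupied_sets n l"
  shows "phase n F = (phase n E + length hs) mod n"
  using assms
proof (induction hs arbitrary: E)
  case Nil
  then show ?case by (simp add: phase_def)
next
  case (Cons h hs)
  then obtain E' where E': "hop n E h E'" "hop_walk n E' hs F" by auto
  have "finite E" using Cons.prems by (auto simp: occupied_sets_def intro: finite_subset)
  then have "phase n E' = Suc (phase n E) mod n" using E' by (intro hop_phase)
  then show ?case using Cons.IH[OF E'(2)] hop_occupied[OF E'(1) Cons.prems(2)]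
    by (simp add: mod_simps)
qed

lemma finite_walk_lists:
  assumes "E \<in> occupied_sets n l"
  shows "finite {hs. length hs = k \<and> hop_walk n E hs F}"
proof (rule finite_subset)
  show "finite {hs. set hs \<subseteq> {..<n} \<and> length hs = k}" by (intro finite_lists_length_eq) simp
qed (use hop_walk_occupied[OF _ assms] in blast)

lemma walks_0: "walks n 0 E F = (if E = F then 1 else 0)"
proof -
  have "{hs. length hs = 0 \<and> hop_walk n E hs F} = (if E = F then {[]} else {})" by auto
  then show ?thesis by (simp add: walks_def)
qed

lemma walks_1: "walks n (Suc 0) E F = (if F \<in> hops n E then 1 else 0)"
proof (cases "F \<in> hops n E")
  case True
  then obtain h where h: "hop n E h F" by (auto simp: hops_def)
  then have "{hs. length hs = Suc 0 \<and> hop_walk n E hs F} = {[h]}"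
    by (auto simp: length_Suc_conv dest: hop_string_unique)
  then show ?thesis using True by (simp add: walks_def)
next
  case False
  then have "{hs. length hs = Suc 0 \<and> hop_walk n E hs F} = {}"
    by (auto simp: length_Suc_conv hops_def)
  then show ?thesis using False by (simp only: walks_def) simp
qed

text \<open>Concatenation is a bijection. The condition \<open>Q\<close> on the tail is left free so
  that the same cut serves the Chapman-Kolmogorov identity and walks with two prescribed
  intermediate states.\<close>

lemma walks_card_split:
  assumes E: "E \<in> occupied_sets n l" and G: "G \<in> occupied_sets n l"
  shows "card {hs. length hs = j + k \<and> hop_walk n E (take j hs) G \<and> Q (drop j hs)}
      = walks n j E G * card {hs. length hs = k \<and> Q hs}"
proof -
  have "{hs. length hs = j + k \<and> hop_walk n E (take j hs) G \<and> Q (drop j hs)}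
      = (\<lambda>(xs, ys). xs @ ys) ` ({hs. length hs = j \<and> hop_walk n E hs G} \<times> {hs. length hs = k \<and> Q hs})"
    (is "?L = ?f ` ?R")
  proof (intro equalityI subsetI)
    fix hs assume "hs \<in> ?L"
    then have "(take j hs, drop j hs) \<in> ?R" by auto
    then show "hs \<in> ?f ` ?R" by (metis (no_types, lifting) append_take_drop_id case_prod_conv image_eqI)
  qed auto
  moreover have "inj_on ?f ?R" by (auto simp: inj_on_def)
  ultimately show ?thesis by (simp add: card_image card_cartesian_product walks_def)
qed

lemma walks_add:
  assumes E: "E \<in> occupied_sets n l"
  shows "walks n (j + k) E F = (\<Sum>G\<in>occupied_sets n l. walks n j E G * walks n k G F)"
proof -
  have "{hs. length hs = j + k \<and> hop_walk n E hs F}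
      = (\<Union>G\<in>occupied_sets n l. {hs. length hs = j + k \<and> hop_walk n E (take j hs) G \<and> hop_walk n G (drop j hs) F})"
    (is "?L = (\<Union>G\<in>_. ?R G)")
  proof (intro equalityI subsetI)
    fix hs assume hs: "hs \<in> ?L"
    then obtain G where "hop_walk n E (take j hs) G" "hop_walk n G (drop j hs) F"
      using hop_walk_take_drop by blast
    then show "hs \<in> (\<Union>G\<in>occupied_sets n l. ?R G)" using hs hop_walk_occupied[OF _ E] by blast
  next
    fix hs assume "hs \<in> (\<Union>G\<in>occupied_sets n l. ?R G)"
    then show "hs \<in> ?L" using hop_walk_take_drop by blast
  qed
  then have "walks n (j + k) E F = card (\<Union>G\<in>occupied_sets n l. ?R G)" by (simp add: walks_def)
  also have "\<dots> = (\<Sum>G\<in>occupied_sets n l. card (?R G))"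
  proof (rule card_UN_disjoint)
    show "\<forall>G\<in>occupied_sets n l. finite (?R G)"
      using hop_walk_take_drop by (intro ballI finite_subset[OF _ finite_walk_lists[OF E, of "j + k" F]]) blast
  qed (auto simp: finite_occupied_sets dest: hop_walk_det)
  also have "\<dots> = (\<Sum>G\<in>occupied_sets n l. walks n j E G * walks n k G F)"
    using walks_card_split[OF E, of _ j k "\<lambda>hs. hop_walk n _ hs F"] by (intro sum.cong refl) (simp add: walks_def)
  finally show ?thesis .
qed

section \<open>The Vandermonde weight as a Perron eigenvector\<close>

text \<open>Partial fractions in polynomial form. \<open>q\<close> cancels the leading coefficient
  of \<open>p\<close>, so \<open>p - q\<close> has degree below \<open>card S\<close> and equals its
  Lagrange interpolant \<open>r\<close> at the nodes \<open>z j\<close>; there \<open>q\<close>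
  vanishes and \<open>p\<close> has the factor \<open>(w - 1) * z j\<close>. Comparing values at 0
  gives the sum.\<close>

lemma lagrange_sum:
  fixes z :: "'a \<Rightarrow> 'b::field" and w :: 'b
  assumes S: "finite S" and inj: "inj_on z S" and nz: "\<And>j. j \<in> S \<Longrightarrow> z j \<noteq> 0" and w: "w \<noteq> 1"
  shows "(\<Sum>j\<in>S. \<Prod>k\<in>S - {j}. (w * z j - z k) / (z j - z k)) = (w ^ card S - 1) / (w - 1)"
proof -
  define c where "c j = (\<Prod>k\<in>S - {j}. (w * z j - z k) / (z j - z k))" for j
  define p where "p = (\<Prod>k\<in>S. [:- z k, w:])"
  define q where "q = smult (w ^ card S) (\<Prod>k\<in>S. [:- z k, 1:])"
  define r where "r = (\<Sum>j\<in>S. smult ((w - 1) * z j * c j) (\<Prod>k\<in>S - {j}. [:- z k, 1:]))"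
  have deg_prod: "degree (\<Prod>k\<in>A. [:- z k, v:]) \<le> card A" if "finite A" for A v
    using that
  proof (induction A)
    case (insert x A)
    have "degree [:- z x, v:] \<le> 1" by simp
    with insert show ?case using degree_mult_le[of "[:- z x, v:]" "\<Prod>k\<in>A. [:- z k, v:]"] by simp
  qed simp
  have coeff_prod: "coeff (\<Prod>k\<in>A. [:- z k, v:]) (card A) = v ^ card A" if "finite A" for A v
    using that
  proof (induction A)
    case (insert x A)
    have "coeff (\<Prod>k\<in>A. [:- z k, v:]) (Suc (card A)) = 0"
      using deg_prod[OF insert(1), of v] by (intro coeff_eq_0) simp
    then show ?case using insert by simp
  qed simp
  have pv: "poly p (z i) = poly (q + r) (z i)" if i: "i \<in> S" for i
  proof -
    have "poly p (z i) = (\<Prod>k\<in>S. w * z i - z k)"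
      by (simp add: p_def poly_prod algebra_simps)
    also have "\<dots> = (w - 1) * z i * (\<Prod>k\<in>S - {i}. w * z i - z k)"
      by (subst prod.remove[OF S i]) (simp add: algebra_simps)
    also have "(\<Prod>k\<in>S - {i}. w * z i - z k) = c i * (\<Prod>k\<in>S - {i}. z i - z k)"
      unfolding c_def prod.distrib[symmetric]
      using inj i by (intro prod.cong) (auto dest: inj_onD)
    finally have 1: "poly p (z i) = (w - 1) * z i * c i * (\<Prod>k\<in>S - {i}. z i - z k)" by simp
    have "poly r (z i) = (\<Sum>j\<in>S. (w - 1) * z j * c j * (\<Prod>k\<in>S - {j}. z i - z k))"
      by (simp add: r_def poly_sum poly_prod)
    also have "\<dots> = (\<Sum>j\<in>S. if j = i then (w - 1) * z i * c i * (\<Prod>k\<in>S - {i}. z i - z k) else 0)"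
    proof (intro sum.cong refl)
      fix j assume "j \<in> S"
      have "(\<Prod>k\<in>S - {j}. z i - z k) = 0" if "j \<noteq> i"
        using S i that by (intro prod_zero) auto
      then show "(w - 1) * z j * c j * (\<Prod>k\<in>S - {j}. z i - z k)
          = (if j = i then (w - 1) * z i * c i * (\<Prod>k\<in>S - {i}. z i - z k) else 0)" by auto
    qed
    also have "\<dots> = poly p (z i)" using S i 1 by simp
    finally have "poly r (z i) = poly p (z i)" .
    moreover have "poly q (z i) = 0"
      using S i by (auto simp: q_def poly_prod intro!: prod_zero)
    ultimately show ?thesis by simp
  qed
  have "p - q - r = 0"
  proof (rule ccontr)
    assume ne: "p - q - r \<noteq> 0"
    have "S \<noteq> {}" using ne by (auto simp: p_def q_def r_def)
    then have cS: "card S > 0" using S by (simp add: card_gt_0_iff)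
    have dr: "degree r \<le> card S - 1" unfolding r_def
    proof (intro degree_sum_le S)
      fix j assume "j \<in> S"
      then show "degree (smult ((w - 1) * z j * c j) (\<Prod>k\<in>S - {j}. [:- z k, 1:])) \<le> card S - 1"
        using deg_prod[of "S - {j}" 1] S by (intro order_trans[OF degree_smult_le]) simp
    qed
    have dpq: "degree (p - q) \<le> card S"
      unfolding p_def q_def using deg_prod[OF S, of w] deg_prod[OF S, of 1]
      by (intro degree_diff_le order_trans[OF degree_smult_le])
    have "coeff (p - q - r) (card S) = 0"
      using coeff_prod[OF S, of w] coeff_prod[OF S, of 1] dr cS
      by (simp add: p_def q_def coeff_eq_0)
    moreover have "degree (p - q - r) \<le> card S"
      by (rule degree_diff_le[OF dpq]) (use dr in simp)
    ultimately have "degree (p - q - r) < card S"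
      using ne cS by (metis le_neq_implies_less leading_coeff_0_iff)
    moreover have "card S \<le> card {x. poly (p - q - r) x = 0}"
    proof -
      have "card S = card (z ` S)" using inj by (simp add: card_image)
      also have "\<dots> \<le> card {x. poly (p - q - r) x = 0}"
        using pv poly_roots_finite[OF ne] by (intro card_mono) auto
      finally show ?thesis .
    qed
    moreover have "card {x. poly (p - q - r) x = 0} \<le> degree (p - q - r)"
      using ne by (rule card_poly_roots_bound)
    ultimately show False by simp
  qed
  then have "poly p 0 = poly q 0 + poly r 0"
    by (metis diff_diff_eq2 diff_zero eq_iff_diff_eq_0 poly_add add.commute diff_add_cancel)
  moreover have "poly p 0 = (\<Prod>k\<in>S. - z k)" by (simp add: p_def poly_prod)
  moreover have "poly q 0 = w ^ card S * (\<Prod>k\<in>S. - z k)" by (simp add: q_def poly_prod)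
  moreover have "poly r 0 = - (w - 1) * (\<Sum>j\<in>S. c j) * (\<Prod>k\<in>S. - z k)"
    unfolding r_def poly_sum sum_distrib_right sum_distrib_left
  proof (intro sum.cong refl)
    fix j assume "j \<in> S"
    then show "poly (smult ((w - 1) * z j * c j) (\<Prod>k\<in>S - {j}. [:- z k, 1:])) 0
        = - (w - 1) * c j * (\<Prod>k\<in>S. - z k)"
      by (subst prod.remove[OF S \<open>j \<in> S\<close>]) (simp add: poly_prod algebra_simps)
  qed
  ultimately have "(\<Prod>k\<in>S. - z k) * (1 - w ^ card S + (w - 1) * (\<Sum>j\<in>S. c j)) = 0"
    by (simp add: algebra_simps)
  moreover have "(\<Prod>k\<in>S. - z k) \<noteq> 0" using S nz by simp
  ultimately have "1 - w ^ card S + (w - 1) * (\<Sum>j\<in>S. c j) = 0" by (simp only: mult_eq_0_iff) simp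
  then have "(w - 1) * (\<Sum>j\<in>S. c j) = w ^ card S - 1" by (simp add: algebra_simps)
  then show ?thesis using w by (simp add: c_def[symmetric] field_simps)
qed

text \<open>Half angles turn a chord of the unit circle into a sine times a unimodular
  factor.\<close>

lemma cis_double_diff: "cis (2 * u) - cis (2 * v) = 2 * \<i> * cis (u + v) * complex_of_real (sin (u - v))"
proof -
  have "cis (2 * u) - cis (2 * v) = cis (u + v) * (cis (u - v) - cis (v - u))"
    by (simp add: right_diff_distrib cis_mult)
  also have "cis (u - v) - cis (v - u) = 2 * \<i> * sin (u - v)"
    using sin_minus[of "u - v"] cos_minus[of "u - v"] by (simp add: complex_eq_iff)
  finally show ?thesis by simp
qed

text \<open>This is \<open>lagrange_sum\<close> at the nodes \<open>cis (2 * x j)\<close> with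
  \<open>w = cis (2 * \<alpha>)\<close>. Both sides carry the unimodular factor
  \<open>cis \<alpha> ^ (card S - 1)\<close>, whose removal leaves real sines.\<close>

lemma sin_ratio_sum:
  fixes x :: "'a \<Rightarrow> real" and \<alpha> :: real
  assumes S: "finite S" and "S \<noteq> {}" and ne: "\<And>j k. j \<in> S \<Longrightarrow> k \<in> S \<Longrightarrow> j \<noteq> k \<Longrightarrow> sin (x j - x k) \<noteq> 0"
    and a: "sin \<alpha> \<noteq> 0"
  shows "(\<Sum>j\<in>S. \<Prod>k\<in>S - {j}. sin (x j - x k + \<alpha>) / sin (x j - x k)) = sin (card S * \<alpha>) / sin \<alpha>"
proof -
  have c0: "cis u \<noteq> 0" for u by simp
  have ratio: "(cis (2 * \<alpha>) * cis (2 * x j) - cis (2 * x k)) / (cis (2 * x j) - cis (2 * x k))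
      = cis \<alpha> * complex_of_real (sin (x j - x k + \<alpha>) / sin (x j - x k))" for j k
  proof -
    have "cis (2 * \<alpha>) * cis (2 * x j) = cis (2 * (x j + \<alpha>))" by (simp add: cis_mult algebra_simps)
    moreover have "cis (x j + \<alpha> + x k) = cis \<alpha> * cis (x j + x k)" by (simp add: cis_mult algebra_simps)
    moreover have "x j + \<alpha> - x k = x j - x k + \<alpha>" by simp
    ultimately show ?thesis by (simp only: cis_double_diff) simp
  qed
  have inj: "inj_on (\<lambda>j. cis (2 * x j)) S"
  proof (rule inj_onI, rule ccontr)
    fix j k assume "j \<in> S" "k \<in> S" "cis (2 * x j) = cis (2 * x k)" "j \<noteq> k"
    then show False using cis_double_diff[of "x j" "x k"] ne[of j k] by simp
  qed
  have one: "cis (2 * u) - 1 = 2 * \<i> * cis u * sin u" for u using cis_double_diff[of u 0] by simp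
  have w1: "cis (2 * \<alpha>) \<noteq> 1" using one[of \<alpha>] a by auto
  \<comment> \<open>The exponent \<open>card S - 1\<close> is the number of factors in each product;
    \<open>S \<noteq> {}\<close> keeps the subtraction exact.\<close>
  have cS: "cis (card S * \<alpha>) / cis \<alpha> = cis \<alpha> ^ (card S - 1)"
  proof -
    have "card S \<noteq> 0" using S \<open>S \<noteq> {}\<close> by auto
    then have "cis \<alpha> ^ card S = cis \<alpha> * cis \<alpha> ^ (card S - 1)" by (metis power_eq_if)
    then show ?thesis using Complex.DeMoivre[of \<alpha> "card S"] c0[of \<alpha>] by (simp add: field_simps)
  qed
  have quot: "(cis (2 * (card S * \<alpha>)) - 1) / (cis (2 * \<alpha>) - 1)
      = cis (card S * \<alpha>) / cis \<alpha> * complex_of_real (sin (card S * \<alpha>) / sin \<alpha>)"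
    by (simp add: one)
  have pow: "cis (2 * \<alpha>) ^ card S = cis (2 * (card S * \<alpha>))"
    using Complex.DeMoivre[of "2 * \<alpha>" "card S"] by (simp add: mult.left_commute)
  have total: "(\<Sum>j\<in>S. \<Prod>k\<in>S - {j}. cis \<alpha> * complex_of_real (sin (x j - x k + \<alpha>) / sin (x j - x k)))
      = cis \<alpha> ^ (card S - 1) * complex_of_real (sin (card S * \<alpha>) / sin \<alpha>)"
    unfolding ratio[symmetric] cS[symmetric] quot[symmetric] pow[symmetric]
    using S inj w1 by (intro lagrange_sum) auto
  have fac0: "(\<Prod>k\<in>S - {j}. cis \<alpha> * complex_of_real (sin (x j - x k + \<alpha>) / sin (x j - x k)))
      = cis \<alpha> ^ (card S - 1) * complex_of_real (\<Prod>k\<in>S - {j}. sin (x j - x k + \<alpha>) / sin (x j - x k))"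
    if "j \<in> S" for j
    using that S by (subst prod.distrib) simp
  have fac: "(\<Sum>j\<in>S. \<Prod>k\<in>S - {j}. cis \<alpha> * complex_of_real (sin (x j - x k + \<alpha>) / sin (x j - x k)))
      = cis \<alpha> ^ (card S - 1) * complex_of_real (\<Sum>j\<in>S. \<Prod>k\<in>S - {j}. sin (x j - x k + \<alpha>) / sin (x j - x k))"
    unfolding of_real_sum sum_distrib_left by (rule sum.cong[OF refl fac0])
  have "cis \<alpha> ^ (card S - 1) * complex_of_real (\<Sum>j\<in>S. \<Prod>k\<in>S - {j}. sin (x j - x k + \<alpha>) / sin (x j - x k))
      = cis \<alpha> ^ (card S - 1) * complex_of_real (sin (card S * \<alpha>) / sin \<alpha>)"
    by (rule trans[OF fac[symmetric] total])
  then have "complex_of_real (\<Sum>j\<in>S. \<Prod>k\<in>S - {j}. sin (x j - x k + \<alpha>) / sin (x j - x k))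
      = complex_of_real (sin (card S * \<alpha>) / sin \<alpha>)"
    using c0 mult_left_cancel power_not_zero by blast
  then show ?thesis by (rule of_real_eq_iff[THEN iffD1])
qed

section \<open>One-step shifts of the Vandermonde weight\<close>

lemma vdm_eq_sin:
  "vdm n E = (\<Prod>(j, k) \<in> {(j, k). j \<in> E \<and> k \<in> E \<and> j < k}. 2 * \<bar>sin (pi * real k / real n - pi * real j / real n)\<bar>)"
  unfolding vdm_def
proof (intro prod.cong refl, clarify)
  fix j k :: nat
  have e: "exp (2 * of_real pi * \<i> * of_nat i / of_nat n) = cis (2 * (pi * real i / real n))" for i
    by (simp add: cis_conv_exp mult_ac)
  show "norm (exp (2 * of_real pi * \<i> * of_nat k / of_nat n) - exp (2 * of_real pi * \<i> * of_nat j / of_nat n))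
      = 2 * \<bar>sin (pi * real k / real n - pi * real j / real n)\<bar>"
    unfolding e cis_double_diff by (simp add: norm_mult)
qed

text \<open>A hop moves one point, so comparing the weights before and after it amounts to comparing
  the chords of that point. \<open>min\<close> and \<open>max\<close> only restore the increasing
  order in which \<open>vdm\<close> lists its pairs.\<close>

lemma vdm_insert:
  assumes "finite S" "h \<notin> S"
  shows "vdm n (insert h S) = (\<Prod>k\<in>S. 2 * \<bar>sin (pi * real h / real n - pi * real k / real n)\<bar>) * vdm n S"
proof -
  let ?d = "\<lambda>j k. 2 * \<bar>sin (pi * real k / real n - pi * real j / real n)\<bar>"
  have sym: "?d j k = ?d k j" for j k
    using sin_minus[of "pi * real k / real n - pi * real j / real n"] by simp
  have split: "{(j, k). j \<in> insert h S \<and> k \<in> insert h S \<and> j < k}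
      = (\<lambda>k. (min h k, max h k)) ` S \<union> {(j, k). j \<in> S \<and> k \<in> S \<and> j < k}" (is "_ = ?A \<union> ?B")
  proof (intro equalityI subsetI)
    fix p assume "p \<in> {(j, k). j \<in> insert h S \<and> k \<in> insert h S \<and> j < k}"
    then obtain j k where p: "p = (j, k)" "j \<in> insert h S" "k \<in> insert h S" "j < k" by blast
    consider "j = h" "k \<in> S" | "k = h" "j \<in> S" | "j \<in> S" "k \<in> S" using p by auto
    then show "p \<in> ?A \<union> ?B"
    proof cases
      case 1
      then have "p = (min h k, max h k)" using p by simp
      then show ?thesis using 1 by blast
    next
      case 2
      then have "p = (min h j, max h j)" using p by simp
      then show ?thesis using 2 by blast
    qed (use p in simp)
  next
    fix p assume "p \<in> ?A \<union> ?B"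
    then show "p \<in> {(j, k). j \<in> insert h S \<and> k \<in> insert h S \<and> j < k}"
    proof
      assume "p \<in> ?A"
      then obtain k where "p = (min h k, max h k)" "k \<in> S" by blast
      moreover from this have "k \<noteq> h" using assms by auto
      ultimately show ?thesis by (cases "k < h") auto
    qed auto
  qed
  have fB: "finite ?B" by (rule finite_subset[of _ "S \<times> S"]) (use assms in auto)
  have "vdm n (insert h S) = (\<Prod>(j, k)\<in>?A. ?d j k) * (\<Prod>(j, k)\<in>?B. ?d j k)"
    unfolding vdm_eq_sin split using assms fB
    by (intro prod.union_disjoint) (auto simp: min_def max_def split: if_splits)
  also have "(\<Prod>(j, k)\<in>?A. ?d j k) = (\<Prod>k\<in>S. ?d (min h k) (max h k))"
    using assms by (subst prod.reindex) (auto simp: inj_on_def min_def max_def split: if_splits)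
  also have "\<dots> = (\<Prod>k\<in>S. ?d k h)"
    by (intro prod.cong refl) (metis max_def min_def sym)
  finally show ?thesis by (simp add: vdm_eq_sin)
qed

lemma sin_strings_nonzero:
  assumes "j < n" "k < n" "j \<noteq> k"
  shows "sin (pi * real j / real n - pi * real k / real n) \<noteq> 0"
proof
  assume "sin (pi * real j / real n - pi * real k / real n) = 0"
  then obtain i where "pi * real j / real n - pi * real k / real n = of_int i * pi"
    by (auto simp: sin_zero_iff_int2)
  then have "pi * (real j - real k) = pi * (of_int i * real n)" using assms by (simp add: field_simps)
  then have "of_int (int j - int k) = (of_int (i * int n) :: real)" by simp
  then have "int j - int k = i * int n" by (simp only: of_int_eq_iff)
  then have "int n dvd int j - int k" by simp
  then show False using assms by (metis mod_eq_dvd_iff of_nat_eq_iff of_nat_mod mod_less)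
qed

lemma vdm_pos:
  assumes "E \<subseteq> {..<n}"
  shows "vdm n E > 0"
proof -
  have "finite E" using assms finite_subset by blast
  then show ?thesis using assms
  proof (induction E)
    case (insert h S)
    have "(\<Prod>k\<in>S. 2 * \<bar>sin (pi * real h / real n - pi * real k / real n)\<bar>) > 0"
    proof (intro prod_pos ballI)
      fix k assume "k \<in> S"
      then have "sin (pi * real h / real n - pi * real k / real n) \<noteq> 0"
        using insert by (intro sin_strings_nonzero) auto
      then show "0 < 2 * \<bar>sin (pi * real h / real n - pi * real k / real n)\<bar>" by simp
    qed
    with insert show ?case by (simp add: vdm_insert)
  qed (simp add: vdm_def)
qed

text \<open>Distinct strings are at least one step apart, so an angle difference in the open
  interval from 0 to \<open>pi\<close> stays in the closed one when moved by \<open>pi / n\<close>,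
  and its sine does not change sign. This lets the absolute values in \<open>vdm\<close> be dropped,
  so that the signed identity \<open>sin_ratio_sum\<close> applies.\<close>

lemma sin_ratio_nonneg:
  assumes "j < n" "k < n" "j \<noteq> k" "\<epsilon> \<in> {1, -1}"
  shows "sin (pi * real j / real n - pi * real k / real n + \<epsilon> * (pi / real n))
      / sin (pi * real j / real n - pi * real k / real n) \<ge> 0"
proof -
  have n: "real n > 0" using assms by simp
  have *: "sin (pi * real a / real n - pi * real b / real n + \<delta> * (pi / real n)) \<ge> 0
      \<and> sin (pi * real a / real n - pi * real b / real n) \<ge> 0"
    if "a < n" "b < a" "\<delta> \<in> {1, -1}" for a b \<delta>
  proof -
    have 1: "pi * real a / real n - pi * real b / real n + d * (pi / real n) = pi * ((real a - real b + d) / real n)" for d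
      by (simp add: add_divide_distrib diff_divide_distrib algebra_simps)
    have d: "0 \<le> (real a - real b + d) / real n \<and> (real a - real b + d) / real n \<le> 1" if "d \<in> {0, 1, -1}" for d
      using that \<open>a < n\<close> \<open>b < a\<close> n by (auto simp: field_simps)
    have "sin (pi * ((real a - real b + d) / real n)) \<ge> 0" if "d \<in> {0, 1, -1}" for d
    proof -
      have "pi * ((real a - real b + d) / real n) \<le> pi * 1" using d[OF that] by (intro mult_left_mono) auto
      then show ?thesis using d[OF that] by (intro sin_ge_zero mult_nonneg_nonneg) auto
    qed
    from this[of \<delta>] this[of 0] that(3) show ?thesis unfolding 1[symmetric] by auto
  qed
  show ?thesis
  proof (cases "k < j")
    case True
    then show ?thesis using *[of j k \<epsilon>] assms by (intro divide_nonneg_nonneg) auto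
  next
    case False
    then have kj: "j < k" using assms by simp
    have "- (pi * real j / real n - pi * real k / real n + \<epsilon> * (pi / real n))
        = pi * real k / real n - pi * real j / real n + (- \<epsilon>) * (pi / real n)" by simp
    then have "- sin (pi * real j / real n - pi * real k / real n + \<epsilon> * (pi / real n)) \<ge> 0"
      using *[of k j "- \<epsilon>"] kj assms by (metis sin_minus insert_iff minus_minus singletonD)
    moreover have "- sin (pi * real j / real n - pi * real k / real n) \<ge> 0"
      using *[of k j 1] kj assms by (simp flip: sin_minus)
    ultimately show ?thesis by (simp add: divide_nonpos_nonpos)
  qed
qed

text \<open>One computation for both eigenvector equations: \<open>sh\<close> is the forward step
  for \<open>\<epsilon> = 1\<close> and the backward step for \<open>\<epsilon> = - 1\<close>, and
  the eigenvalue is even in \<open>\<epsilon>\<close>. A shift onto an occupied string makes one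
  sine vanish, so the sum over permitted shifts is the full sum of \<open>sin_ratio_sum\<close>. The
  absolute values in the last assumption absorb the wrap-around of the ring.\<close>

lemma vdm_shift_sum:
  assumes n: "2 \<le> n" and E: "E \<subseteq> {..<n}" "E \<noteq> {}" and e: "\<epsilon> \<in> {1, -1::real}"
    and sh: "\<And>h. h < n \<Longrightarrow> sh h < n \<and> sh h \<noteq> h"
    and sin_sh: "\<And>h x. h < n \<Longrightarrow>
        \<bar>sin (pi * real (sh h) / real n - x)\<bar> = \<bar>sin (pi * real h / real n - x + \<epsilon> * (pi / real n))\<bar>"
  shows "(\<Sum>h\<in>{h\<in>E. sh h \<notin> E}. vdm n (insert (sh h) (E - {h})))
      = sin (pi * real (card E) / real n) / sin (pi / real n) * vdm n E"
proof -
  have fin: "finite E" using E finite_subset by blast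
  let ?x = "\<lambda>h. pi * real h / real n"
  let ?r = "\<lambda>h k. sin (?x h - ?x k + \<epsilon> * (pi / real n)) / sin (?x h - ?x k)"
  have hop_term: "(if sh h \<notin> E then vdm n (insert (sh h) (E - {h})) else 0) = (\<Prod>k\<in>E - {h}. ?r h k) * vdm n E"
    if h: "h \<in> E" for h
  proof -
    have hn: "h < n" using h E by auto
    have prod_eq: "(\<Prod>k\<in>E - {h}. ?r h k) * (\<Prod>k\<in>E - {h}. 2 * \<bar>sin (?x h - ?x k)\<bar>)
        = (\<Prod>k\<in>E - {h}. 2 * \<bar>sin (?x (sh h) - ?x k)\<bar>)"
      unfolding prod.distrib[symmetric]
    proof (intro prod.cong refl)
      fix k assume k: "k \<in> E - {h}"
      then have kn: "k < n" "h \<noteq> k" using E by auto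
      have "?r h k = \<bar>?r h k\<bar>" by (rule abs_of_nonneg[OF sin_ratio_nonneg[OF hn kn e], symmetric])
      also have "\<dots> = \<bar>sin (?x (sh h) - ?x k)\<bar> / \<bar>sin (?x h - ?x k)\<bar>"
        unfolding sin_sh[OF hn] by (rule abs_divide)
      finally show "?r h k * (2 * \<bar>sin (?x h - ?x k)\<bar>) = 2 * \<bar>sin (?x (sh h) - ?x k)\<bar>"
        using sin_strings_nonzero[OF hn kn] by simp
    qed
    have vE: "vdm n E = (\<Prod>k\<in>E - {h}. 2 * \<bar>sin (?x h - ?x k)\<bar>) * vdm n (E - {h})"
      using vdm_insert[of "E - {h}" h n] fin h by (simp add: insert_absorb)
    have rhs: "(\<Prod>k\<in>E - {h}. ?r h k) * vdm n E = (\<Prod>k\<in>E - {h}. 2 * \<bar>sin (?x (sh h) - ?x k)\<bar>) * vdm n (E - {h})"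
      unfolding vE mult.assoc[symmetric] prod_eq ..
    show ?thesis
    proof (cases "sh h \<in> E")
      case True
      then have "sh h \<in> E - {h}" using sh[OF hn] by simp
      then have "(\<Prod>k\<in>E - {h}. 2 * \<bar>sin (?x (sh h) - ?x k)\<bar>) = 0"
        using fin by (intro prod_zero bexI[of _ "sh h"]) auto
      then show ?thesis using True rhs by simp
    next
      case False
      then show ?thesis using rhs vdm_insert[of "E - {h}" "sh h" n] fin by simp
    qed
  qed
  have s0: "sin (\<epsilon> * (pi / real n)) = \<epsilon> * sin (pi / real n)"
    "sin (real (card E) * (\<epsilon> * (pi / real n))) = \<epsilon> * sin (pi * real (card E) / real n)" using e by (auto simp: mult.commute)
  have sp: "sin (pi / real n) > 0" using n by (intro sin_gt_zero) (auto simp: field_simps)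
  have "(\<Sum>h\<in>{h\<in>E. sh h \<notin> E}. vdm n (insert (sh h) (E - {h})))
      = (\<Sum>h\<in>E. if sh h \<notin> E then vdm n (insert (sh h) (E - {h})) else 0)"
    using fin by (simp add: sum.inter_filter)
  also have "\<dots> = (\<Sum>h\<in>E. \<Prod>k\<in>E - {h}. ?r h k) * vdm n E"
    by (simp add: hop_term sum_distrib_right)
  also have "(\<Sum>h\<in>E. \<Prod>k\<in>E - {h}. ?r h k) = sin (real (card E) * (\<epsilon> * (pi / real n))) / sin (\<epsilon> * (pi / real n))"
  proof (intro sin_ratio_sum fin E)
    fix j k assume "j \<in> E" "k \<in> E" "j \<noteq> k"
    then show "sin (?x j - ?x k) \<noteq> 0" using E by (intro sin_strings_nonzero) auto
  qed (use sp e in auto)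
  also have "\<dots> = sin (pi * real (card E) / real n) / sin (pi / real n)"
    unfolding s0 using e by auto
  finally show ?thesis .
qed

text \<open>The determinant of the matrix with entries \<open>x j ^ k\<close>, in Leibniz form: the
  expanded sum is what orthogonality of characters acts on.\<close>

definition alternant :: "nat \<Rightarrow> (nat \<Rightarrow> 'a::comm_ring_1) \<Rightarrow> 'a" where
  "alternant l x = (\<Sum>\<sigma> | \<sigma> permutes {..<l}. of_int (sign \<sigma>) * (\<Prod>j<l. x j ^ \<sigma> j))"

lemma alternant_eq_0:
  fixes x :: "nat \<Rightarrow> 'a::field_char_0"
  assumes "a < l" "b < l" "a \<noteq> b" "x a = x b"
  shows "alternant l x = 0"
proof -
  let ?t = "Transposition.transpose a b"
  have t: "?t permutes {..<l}" using assms by (simp add: permutes_swap_id)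
  have xt: "x (?t j) = x j" for j using assms by (auto simp: Transposition.transpose_def)
  have "alternant l x = (\<Sum>\<sigma> | \<sigma> permutes {..<l}. of_int (sign (\<sigma> \<circ> ?t)) * (\<Prod>j<l. x j ^ (\<sigma> \<circ> ?t) j))"
    unfolding alternant_def by (rule sum_permutations_compose_right[OF t])
  also have "\<dots> = (\<Sum>\<sigma> | \<sigma> permutes {..<l}. - (of_int (sign \<sigma>) * (\<Prod>j<l. x j ^ \<sigma> j)))"
  proof (intro sum.cong refl)
    fix \<sigma> assume "\<sigma> \<in> {\<sigma>. \<sigma> permutes {..<l}}"
    then have "permutation \<sigma>" using permutation_permutes by blast
    then have "sign (\<sigma> \<circ> ?t) = - sign \<sigma>"
      using assms by (subst sign_compose) (auto simp: permutation_swap_id sign_swap_id)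
    moreover have "(\<Prod>j<l. x j ^ (\<sigma> \<circ> ?t) j) = (\<Prod>j<l. x j ^ \<sigma> j)"
      using prod.permute[OF t, of "\<lambda>j. x j ^ \<sigma> j"] by (simp add: o_def xt)
    ultimately show "of_int (sign (\<sigma> \<circ> ?t)) * (\<Prod>j<l. x j ^ (\<sigma> \<circ> ?t) j) = - (of_int (sign \<sigma>) * (\<Prod>j<l. x j ^ \<sigma> j))"
      by simp
  qed
  also have "\<dots> = - alternant l x" by (simp add: alternant_def sum_negf)
  finally show ?thesis by simp
qed

text \<open>As a polynomial \<open>P\<close> in the last variable, the alternant has degree at most
  \<open>l\<close>, vanishes at the \<open>l\<close> earlier points, and gets its coefficient of
  degree \<open>l\<close> from the permutations fixing \<open>l\<close>. This forces it to be the
  multiple \<open>Q\<close> of the product of linear factors.\<close>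

lemma alternant_Suc:
  fixes x :: "nat \<Rightarrow> 'a::field_char_0"
  assumes inj: "inj_on x {..<l}"
  shows "alternant (Suc l) x = alternant l x * (\<Prod>k<l. x l - x k)"
proof -
  define P where "P = (\<Sum>\<sigma> | \<sigma> permutes {..<Suc l}. monom (of_int (sign \<sigma>) * (\<Prod>j<l. x j ^ \<sigma> j)) (\<sigma> l))"
  define Q where "Q = smult (alternant l x) (\<Prod>k<l. [:- x k, 1:])"
  have fin: "finite {\<sigma>. \<sigma> permutes {..<Suc l}}" by (simp add: finite_permutations)
  have evP: "poly P y = alternant (Suc l) (x(l := y))" for y
    by (simp add: P_def alternant_def poly_sum poly_monom mult.assoc)
  have bound: "\<sigma> l \<le> l" if "\<sigma> permutes {..<Suc l}" for \<sigma>
    using permutes_in_image[OF that, of l] by simp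
  have degP: "degree P \<le> l"
    unfolding P_def
  proof (intro degree_sum_le fin)
    fix \<sigma> assume "\<sigma> \<in> {\<sigma>. \<sigma> permutes {..<Suc l}}"
    then show "degree (monom (of_int (sign \<sigma>) * (\<Prod>j<l. x j ^ \<sigma> j)) (\<sigma> l)) \<le> l"
      using bound by (intro order_trans[OF degree_monom_le]) simp
  qed
  have set_eq: "{\<sigma> \<in> {\<sigma>. \<sigma> permutes {..<Suc l}}. \<sigma> l = l} = {\<sigma>. \<sigma> permutes {..<l}}"
    (is "?A = ?B")
  proof (intro equalityI subsetI)
    fix \<sigma> assume \<sigma>: "\<sigma> \<in> ?A"
    have "\<sigma> permutes {..<Suc l} - {l}"
      by (rule permutes_superset[of _ "{..<Suc l}"]) (use \<sigma> in auto)
    moreover have "{..<Suc l} - {l} = {..<l}" by auto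
    ultimately show "\<sigma> \<in> ?B" by simp
  next
    fix \<sigma> assume "\<sigma> \<in> ?B"
    then have "\<sigma> permutes {..<l}" by simp
    then have "\<sigma> permutes {..<Suc l}" "\<sigma> l = l"
      using permutes_subset[of \<sigma> "{..<l}" "{..<Suc l}"] permutes_not_in[of \<sigma> "{..<l}" l] by simp_all
    then show "\<sigma> \<in> ?A" by simp
  qed
  have coeffP: "coeff P l = alternant l x"
  proof -
    have "coeff P l = (\<Sum>\<sigma> | \<sigma> permutes {..<Suc l}. if \<sigma> l = l then of_int (sign \<sigma>) * (\<Prod>j<l. x j ^ \<sigma> j) else 0)"
      unfolding P_def coeff_sum by (intro sum.cong) auto
    also have "\<dots> = alternant l x"
      unfolding alternant_def set_eq[symmetric] by (rule sum.inter_filter[OF fin, symmetric])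
    finally show ?thesis .
  qed
  have prodQ: "degree (\<Prod>k<i. [:- x k, 1:]) = i \<and> coeff (\<Prod>k<i. [:- x k, 1:]) i = 1" for i
  proof -
    have "degree (\<Prod>k<i. [:- x k, 1:]) = i" by (simp add: degree_prod_sum_eq)
    moreover have "lead_coeff (\<Prod>k<i. [:- x k, 1:]) = 1" by (simp add: lead_coeff_prod)
    ultimately show ?thesis by simp
  qed
  have "P - Q = 0"
  proof (rule ccontr)
    assume ne: "P - Q \<noteq> 0"
    have "degree (P - Q) \<le> l"
      using degP prodQ[of l] unfolding Q_def by (intro degree_diff_le order_trans[OF degree_smult_le]) auto
    moreover have "coeff (P - Q) l = 0" using coeffP prodQ[of l] by (simp add: Q_def)
    ultimately have lt: "degree (P - Q) < l"
      using ne by (metis le_neq_implies_less leading_coeff_0_iff)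
    have "l = card (x ` {..<l})" using inj by (simp add: card_image)
    also have "\<dots> \<le> card {y. poly (P - Q) y = 0}"
    proof (intro card_mono poly_roots_finite ne subsetI)
      fix y assume "y \<in> x ` {..<l}"
      then obtain k where k: "k < l" "y = x k" by auto
      then have "alternant (Suc l) (x(l := y)) = 0" by (intro alternant_eq_0[of k _ l]) auto
      moreover have "poly Q y = 0" using k by (auto simp: Q_def poly_prod intro!: prod_zero)
      ultimately show "y \<in> {y. poly (P - Q) y = 0}" by (simp add: evP)
    qed
    also have "\<dots> \<le> degree (P - Q)" using ne by (rule card_poly_roots_bound)
    finally show False using lt by simp
  qed
  then have "poly P (x l) = poly Q (x l)" by simp
  then show ?thesis by (simp add: evP Q_def poly_prod)
qed

lemma alternant_eq_prod:
  fixes x :: "nat \<Rightarrow> 'a::field_char_0"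
  assumes "inj_on x {..<l}"
  shows "alternant l x = (\<Prod>j<l. \<Prod>k<j. x j - x k)"
  using assms
proof (induction l)
  case (Suc l)
  then show ?case using inj_on_subset[OF Suc.prems, of "{..<l}"] by (simp add: alternant_Suc lessThan_Suc)
qed (simp add: alternant_def)

lemma card_inj_extensional_funcset:
  assumes "finite E" "card E = l"
  shows "card {x \<in> PiE {..<l} (\<lambda>_. E). inj_on x {..<l}} = fact l"
proof -
  have "bij_betw (\<lambda>x. map x [0..<l]) {x \<in> PiE {..<l} (\<lambda>_. E). inj_on x {..<l}}
      {xs. length xs = l \<and> distinct xs \<and> set xs \<subseteq> E}"
  proof (rule bij_betw_byWitness[where f' = "\<lambda>xs. \<lambda>i\<in>{..<l}. xs ! i"])
    show "\<forall>x\<in>{x \<in> PiE {..<l} (\<lambda>_. E). inj_on x {..<l}}. (\<lambda>i\<in>{..<l}. map x [0..<l] ! i) = x"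
    proof
      fix x assume "x \<in> {x \<in> PiE {..<l} (\<lambda>_. E). inj_on x {..<l}}"
      then have x: "x \<in> PiE {..<l} (\<lambda>_. E)" by blast
      show "(\<lambda>i\<in>{..<l}. map x [0..<l] ! i) = x"
        using PiE_arb[OF x] by (intro ext) simp
    qed
    show "\<forall>xs\<in>{xs. length xs = l \<and> distinct xs \<and> set xs \<subseteq> E}. map (\<lambda>i\<in>{..<l}. xs ! i) [0..<l] = xs"
      by (auto intro!: nth_equalityI)
    show "(\<lambda>x. map x [0..<l]) ` {x \<in> PiE {..<l} (\<lambda>_. E). inj_on x {..<l}}
        \<subseteq> {xs. length xs = l \<and> distinct xs \<and> set xs \<subseteq> E}"
    proof (intro image_subsetI)
      fix x assume x: "x \<in> {x \<in> PiE {..<l} (\<lambda>_. E). inj_on x {..<l}}"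
      have "set (map x [0..<l]) \<subseteq> E" using x by force
      moreover have "distinct (map x [0..<l])" using x by (simp add: distinct_map lessThan_atLeast0)
      ultimately show "map x [0..<l] \<in> {xs. length xs = l \<and> distinct xs \<and> set xs \<subseteq> E}" by simp
    qed
    show "(\<lambda>xs. \<lambda>i\<in>{..<l}. xs ! i) ` {xs. length xs = l \<and> distinct xs \<and> set xs \<subseteq> E}
        \<subseteq> {x \<in> PiE {..<l} (\<lambda>_. E). inj_on x {..<l}}"
    proof (intro image_subsetI)
      fix xs assume xs: "xs \<in> {xs. length xs = l \<and> distinct xs \<and> set xs \<subseteq> E}"
      have "(\<lambda>i\<in>{..<l}. xs ! i) \<in> PiE {..<l} (\<lambda>_. E)" using xs nth_mem by force
      moreover have "inj_on (\<lambda>i\<in>{..<l}. xs ! i) {..<l}"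
        using xs by (intro inj_onI) (simp add: nth_eq_iff_index_eq)
      ultimately show "(\<lambda>i\<in>{..<l}. xs ! i) \<in> {x \<in> PiE {..<l} (\<lambda>_. E). inj_on x {..<l}}" by simp
    qed
  qed
  then have "card {x \<in> PiE {..<l} (\<lambda>_. E). inj_on x {..<l}}
      = card {xs. length xs = l \<and> distinct xs \<and> set xs \<subseteq> E}"
    by (rule bij_betw_same_card)
  also have "\<dots> = fact l"
    using card_lists_distinct_length_eq[of E l] assms by (simp add: fact_prod)
  finally show ?thesis .
qed

text \<open>The squared weight of \<open>E\<close> is the squared modulus of an alternant in roots
  of unity. The sum over all tuples in \<open>T\<close> meets each \<open>E\<close> in its
  \<open>fact l\<close> orders, and tuples with repeated entries contribute zero. Expanding the
  alternant and its conjugate gives a double sum over permutations in which only the diagonal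
  survives.\<close>

lemma vdm_sum_squares:
  fixes n l :: nat
  assumes "l \<le> n" "1 \<le> n"
  shows "(\<Sum>E\<in>occupied_sets n l. (vdm n E)\<^sup>2) = real n ^ l"
proof -
  define z where "z i = cis (2 * (pi * real i / real n))" for i
  have zinj: "z i \<noteq> z j" if "i < n" "j < n" "i \<noteq> j" for i j
  proof
    assume "z i = z j"
    then have "cis (2 * (pi * real i / real n)) - cis (2 * (pi * real j / real n)) = 0"
      unfolding z_def by (rule right_minus_eq[THEN iffD2])
    then show False using sin_strings_nonzero[OF that] by (simp only: cis_double_diff) simp
  qed
  define T where "T = PiE {..<l} (\<lambda>_. {..<n})"
  have finT: "finite T" by (simp add: T_def finite_PiE)
  define D where "D x = alternant l (\<lambda>j. z (x j))" for x
  have Dnorm: "(norm (D x))\<^sup>2 = (if inj_on x {..<l} then (vdm n (x ` {..<l}))\<^sup>2 else 0)" if x: "x \<in> T" for x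
  proof (cases "inj_on x {..<l}")
    case True
    have xn: "x i < n" if "i < l" for i using x that by (auto simp: T_def)
    have "inj_on (\<lambda>j. z (x j)) {..<l}"
    proof (rule inj_onI)
      fix i j assume ij: "i \<in> {..<l}" "j \<in> {..<l}" "z (x i) = z (x j)"
      then have "x i = x j" using zinj[of "x i" "x j"] xn by auto
      then show "i = j" using True ij by (auto dest: inj_onD)
    qed
    then have "norm (D x) = (\<Prod>j<l. \<Prod>k<j. norm (z (x j) - z (x k)))"
      by (simp add: D_def alternant_eq_prod prod_norm[symmetric])
    also have "\<dots> = vdm n (x ` {..<l})"
      using True
    proof (induction l)
      case (Suc l)
      have "vdm n (x ` {..<Suc l}) = vdm n (insert (x l) (x ` {..<l}))" by (simp add: lessThan_Suc)
      also have "\<dots> = (\<Prod>k\<in>x ` {..<l}. 2 * \<bar>sin (pi * real (x l) / real n - pi * real k / real n)\<bar>) * vdm n (x ` {..<l})"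
      proof (intro vdm_insert)
        show "x l \<notin> x ` {..<l}"
        proof
          assume "x l \<in> x ` {..<l}"
          then obtain k where "k < l" "x l = x k" by auto
          then show False using inj_onD[OF Suc.prems, of l k] by simp
        qed
      qed simp
      also have "(\<Prod>k\<in>x ` {..<l}. 2 * \<bar>sin (pi * real (x l) / real n - pi * real k / real n)\<bar>)
          = (\<Prod>k<l. norm (z (x l) - z (x k)))"
      proof -
        have "norm (z i - z k) = 2 * \<bar>sin (pi * real i / real n - pi * real k / real n)\<bar>" for i k
          unfolding z_def cis_double_diff by (simp add: norm_mult)
        moreover have "inj_on x {..<l}" using Suc.prems by (rule inj_on_subset) auto
        ultimately show ?thesis by (simp add: prod.reindex)
      qed
      finally show ?case using Suc inj_on_subset[of x "{..<Suc l}" "{..<l}"] by (simp add: lessThan_Suc)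
    qed (simp add: vdm_def)
    finally show ?thesis using True by simp
  next
    case False
    then obtain a b where "a < l" "b < l" "a \<noteq> b" "x a = x b" by (auto simp: inj_on_def)
    then have "D x = 0" unfolding D_def by (intro alternant_eq_0[of a _ b]) auto
    then show ?thesis using False by simp
  qed
  have "(\<Sum>x\<in>T. (norm (D x))\<^sup>2) = fact l * (\<Sum>E\<in>occupied_sets n l. (vdm n E)\<^sup>2)"
  proof -
    let ?I = "{x \<in> T. inj_on x {..<l}}"
    have "(\<Sum>x\<in>T. (norm (D x))\<^sup>2) = (\<Sum>x\<in>?I. (vdm n (x ` {..<l}))\<^sup>2)"
      using finT by (simp add: Dnorm sum.inter_filter)
    also have "\<dots> = (\<Sum>E\<in>occupied_sets n l. \<Sum>x\<in>{x \<in> ?I. x ` {..<l} = E}. (vdm n (x ` {..<l}))\<^sup>2)"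
    proof (rule sum.group[symmetric])
      show "finite (occupied_sets n l)" unfolding occupied_sets_def
        by (rule finite_subset[of _ "Pow {..<n}"]) auto
      show "(\<lambda>x. x ` {..<l}) ` ?I \<subseteq> occupied_sets n l"
      proof (intro image_subsetI)
        fix x assume x: "x \<in> ?I"
        then have "x ` {..<l} \<subseteq> {..<n}" by (force simp: T_def)
        moreover have "card (x ` {..<l}) = l" using x by (simp add: card_image)
        ultimately show "x ` {..<l} \<in> occupied_sets n l" unfolding occupied_sets_def by blast
      qed
    qed (use finT in simp)
    also have "\<dots> = (\<Sum>E\<in>occupied_sets n l. fact l * (vdm n E)\<^sup>2)"
    proof (intro sum.cong refl)
      fix E assume E: "E \<in> occupied_sets n l"
      then have fE: "finite E" "card E = l" by (auto simp: occupied_sets_def intro: finite_subset)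
      have "{x \<in> ?I. x ` {..<l} = E} = {x \<in> PiE {..<l} (\<lambda>_. E). inj_on x {..<l}}"
      proof (intro equalityI subsetI)
        fix x assume x: "x \<in> {x \<in> PiE {..<l} (\<lambda>_. E). inj_on x {..<l}}"
        then have "x ` {..<l} \<subseteq> E" by auto
        moreover have "card (x ` {..<l}) = card E" using x fE by (simp add: card_image)
        ultimately have "x ` {..<l} = E" using fE by (simp add: card_subset_eq)
        then show "x \<in> {x \<in> ?I. x ` {..<l} = E}" using x E by (auto simp: T_def occupied_sets_def)
      qed (auto simp: T_def)
      moreover have "card {x \<in> PiE {..<l} (\<lambda>_. E). inj_on x {..<l}} = fact l"
        by (rule card_inj_extensional_funcset[OF fE])
      ultimately have "card {x \<in> ?I. x ` {..<l} = E} = fact l" by (simp only:)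
      moreover have "(\<Sum>x\<in>{x \<in> ?I. x ` {..<l} = E}. (vdm n (x ` {..<l}))\<^sup>2)
          = (\<Sum>x\<in>{x \<in> ?I. x ` {..<l} = E}. (vdm n E)\<^sup>2)"
        by (rule sum.cong) auto
      ultimately show "(\<Sum>x\<in>{x \<in> ?I. x ` {..<l} = E}. (vdm n (x ` {..<l}))\<^sup>2) = fact l * (vdm n E)\<^sup>2"
        by (simp only: sum_constant) simp
    qed
    finally show ?thesis by (simp add: sum_distrib_left)
  qed
  moreover have "complex_of_real (\<Sum>x\<in>T. (norm (D x))\<^sup>2) = fact l * of_nat n ^ l"
  proof -
    let ?S = "{\<sigma>. \<sigma> permutes {..<l}}"
    have fS: "finite ?S" by (simp add: finite_permutations)
    \<comment> \<open>The exponents lie below \<open>l \<le> n\<close>, so different ones also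
      differ modulo \<open>n\<close> and make \<open>w\<close> a nontrivial root of unity.\<close>
    have orth: "(\<Sum>i<n. z i ^ a * cnj (z i) ^ b) = (if a = b then of_nat n else 0)" if "a < l" "b < l" for a b
    proof -
      define w where "w = cis (2 * (pi * real a / real n - pi * real b / real n))"
      have "z i ^ a * cnj (z i) ^ b = w ^ i" for i
      proof -
        have "cnj (z i) = cis (- (2 * (pi * real i / real n)))" by (simp add: z_def cis_cnj)
        then show ?thesis
          by (simp add: w_def z_def Complex.DeMoivre cis_mult algebra_simps)
      qed
      then have s: "(\<Sum>i<n. z i ^ a * cnj (z i) ^ b) = (\<Sum>i<n. w ^ i)" by simp
      show ?thesis
      proof (cases "a = b")
        case True
        then show ?thesis unfolding s by (simp add: w_def)
      next
        case False
        have "w \<noteq> 1"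
          using cis_double_diff[of "pi * real a / real n - pi * real b / real n" 0] sin_strings_nonzero[of a n b] that assms False
          by (auto simp: w_def)
        moreover have "w ^ n = 1"
        proof -
          have "w ^ n = cis (2 * pi * of_int (int a - int b))"
            using assms by (simp add: w_def Complex.DeMoivre right_diff_distrib mult.assoc)
          then show ?thesis by (metis cis_multiple_2pi Ints_of_int)
        qed
        ultimately show ?thesis unfolding s using False by (simp add: geometric_sum)
      qed
    qed
    have "complex_of_real (\<Sum>x\<in>T. (norm (D x))\<^sup>2) = (\<Sum>x\<in>T. D x * cnj (D x))"
      unfolding of_real_sum complex_norm_square ..
    also have "\<dots> = (\<Sum>x\<in>T. \<Sum>\<sigma>\<in>?S. \<Sum>\<tau>\<in>?S. of_int (sign \<sigma>) * of_int (sign \<tau>) * (\<Prod>j<l. z (x j) ^ \<sigma> j * cnj (z (x j)) ^ \<tau> j))"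
    proof (intro sum.cong refl)
      fix x
      have "cnj (D x) = (\<Sum>\<tau>\<in>?S. of_int (sign \<tau>) * (\<Prod>j<l. cnj (z (x j)) ^ \<tau> j))"
        by (simp add: D_def alternant_def)
      then show "D x * cnj (D x) = (\<Sum>\<sigma>\<in>?S. \<Sum>\<tau>\<in>?S. of_int (sign \<sigma>) * of_int (sign \<tau>) * (\<Prod>j<l. z (x j) ^ \<sigma> j * cnj (z (x j)) ^ \<tau> j))"
        unfolding D_def alternant_def prod.distrib by (simp only: sum_product) (simp only: mult_ac)
    qed
    also have "\<dots> = (\<Sum>\<sigma>\<in>?S. \<Sum>\<tau>\<in>?S. of_int (sign \<sigma>) * of_int (sign \<tau>) * (\<Sum>x\<in>T. \<Prod>j<l. z (x j) ^ \<sigma> j * cnj (z (x j)) ^ \<tau> j))"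
      unfolding sum_distrib_left by (subst sum.swap, intro sum.cong refl sum.swap)
    also have "\<dots> = (\<Sum>\<sigma>\<in>?S. \<Sum>\<tau>\<in>?S. of_int (sign \<sigma>) * of_int (sign \<tau>) * (\<Prod>j<l. \<Sum>i<n. z i ^ \<sigma> j * cnj (z i) ^ \<tau> j))"
      unfolding T_def by (simp add: prod_sum_PiE)
    also have "\<dots> = (\<Sum>\<sigma>\<in>?S. \<Sum>\<tau>\<in>?S. if \<tau> = \<sigma> then of_nat n ^ l else 0)"
    proof (intro sum.cong refl)
      fix \<sigma> \<tau> assume st: "\<sigma> \<in> ?S" "\<tau> \<in> ?S"
      have lt: "\<sigma> j < l" "\<tau> j < l" if "j < l" for j
        using permutes_in_image[of \<sigma> "{..<l}" j] permutes_in_image[of \<tau> "{..<l}" j] st that by auto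
      have "(\<Prod>j<l. \<Sum>i<n. z i ^ \<sigma> j * cnj (z i) ^ \<tau> j) = (\<Prod>j<l. if \<sigma> j = \<tau> j then of_nat n else 0)"
        using lt by (intro prod.cong) (auto simp: orth)
      also have "\<dots> = (if \<tau> = \<sigma> then of_nat n ^ l else 0)"
      proof (cases "\<tau> = \<sigma>")
        case False
        then obtain j where j: "\<sigma> j \<noteq> \<tau> j" by (metis ext)
        then have "j < l" using st by (metis lessThan_iff mem_Collect_eq permutes_not_in)
        then have "(\<Prod>j<l. if \<sigma> j = \<tau> j then of_nat n else (0::complex)) = 0"
          using j by (intro prod_zero bexI[of _ j]) auto
        then show ?thesis using False by simp
      qed simp
      finally show "of_int (sign \<sigma>) * of_int (sign \<tau>) * (\<Prod>j<l. \<Sum>i<n. z i ^ \<sigma> j * cnj (z i) ^ \<tau> j)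
          = (if \<tau> = \<sigma> then of_nat n ^ l else (0::complex))"
        by (simp add: sign_def)
    qed
    also have "\<dots> = fact l * of_nat n ^ l"
      using fS by (simp add: card_permutations)
    finally show ?thesis .
  qed
  ultimately have "complex_of_real (fact l * (\<Sum>E\<in>occupied_sets n l. (vdm n E)\<^sup>2)) = complex_of_real (fact l * real n ^ l)"
    by simp
  then show ?thesis by (simp only: of_real_eq_iff mult_cancel_left) simp
qed

section \<open>The periodic Markov chain\<close>

locale bead_ring =
  fixes n l :: nat
  assumes n2: "2 \<le> n" and l1: "1 \<le> l" and ln: "l \<le> n - 1"
begin

abbreviation occ :: "nat set set" where "occ \<equiv> occupied_sets n l"

definition lam :: real where "lam = sin (pi * real l / real n) / sin (pi / real n)"

text \<open>The Doob transform of the hop matrix by its positive eigenvector \<open>vdm\<close>. In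
  a bridge the transforming factors cancel, so that conditioning on both ends makes all walks of a
  given length equally likely.\<close>

definition ker :: "nat \<Rightarrow> nat set \<Rightarrow> nat set \<Rightarrow> real" where
  "ker k E F = real (walks n k E F) * vdm n F / (lam ^ k * vdm n E)"

definition stat :: "nat set \<Rightarrow> real" where "stat E = (vdm n E)\<^sup>2 / real n ^ l"

lemma lam_pos: "lam > 0"
proof -
  have "sin (pi / real n) > 0" using n2 by (intro sin_gt_zero) (auto simp: field_simps)
  moreover have "sin (pi * real l / real n) > 0" using n2 l1 ln by (intro sin_gt_zero) (auto simp: field_simps)
  ultimately show ?thesis by (simp add: lam_def)
qed

lemma occ_facts:
  assumes "E \<in> occ"
  shows "E \<subseteq> {..<n}" "E \<noteq> {}" "finite E" "card E = l" "vdm n E > 0" "phase n E < n"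
  using assms n2 l1 vdm_pos[of E n] by (auto simp: occupied_sets_def phase_def intro: finite_subset)

lemma sum_vdm_succ:
  assumes E: "E \<in> occ"
  shows "(\<Sum>F\<in>hops n E. vdm n F) = lam * vdm n E"
proof -
  let ?S = "{h\<in>E. Suc h mod n \<notin> E}" and ?f = "\<lambda>h. insert (Suc h mod n) (E - {h})"
  have hops: "hops n E = ?f ` ?S" by (auto simp: hops_def hop_def)
  have "inj_on ?f ?S"
    by (intro inj_onI hop_string_unique[of n E _ "?f _"]) (auto simp: hop_def)
  then have "(\<Sum>F\<in>hops n E. vdm n F) = (\<Sum>h\<in>?S. vdm n (?f h))"
    unfolding hops by (simp add: sum.reindex)
  also have "\<dots> = sin (pi * real (card E) / real n) / sin (pi / real n) * vdm n E"
  proof (intro vdm_shift_sum[where \<epsilon> = 1] n2 occ_facts[OF E])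
    fix h x assume h: "h < n"
    show "Suc h mod n < n \<and> Suc h mod n \<noteq> h" using n2 Suc_mod_self_neq[OF n2] by simp
    show "\<bar>sin (pi * real (Suc h mod n) / real n - x)\<bar> = \<bar>sin (pi * real h / real n - x + 1 * (pi / real n))\<bar>"
    \<comment> \<open>Across the seam the angle falls by \<open>pi - pi / n\<close> instead of
      rising by \<open>pi / n\<close>. The two results differ by \<open>pi\<close>, which only
      changes the sign of the sine.\<close>
    proof (cases "Suc h = n")
      case True
      then have "real h = real n - 1" by linarith
      then have "pi * real h / real n - x + 1 * (pi / real n) = pi - x"
        using n2 by (simp add: diff_divide_distrib right_diff_distrib)
      then show ?thesis using True by (simp only: mod_self) simp
    next
      case False
      then have "Suc h mod n = Suc h" using h by simp
      then show ?thesis by (simp add: add_divide_distrib distrib_left algebra_simps)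
    qed
  qed simp
  finally show ?thesis by (simp add: lam_def occ_facts(4)[OF E])
qed

text \<open>Predecessors of \<open>F\<close> arise by moving a point one string back, so this is the
  shift identity with \<open>\<epsilon> = - 1\<close>. Going back is written as adding
  \<open>n - 1\<close> modulo \<open>n\<close>, which avoids truncated subtraction at 0.\<close>

lemma sum_vdm_pred:
  assumes F: "F \<in> occ"
  shows "(\<Sum>E | E \<in> occ \<and> F \<in> hops n E. vdm n E) = lam * vdm n F"
proof -
  let ?p = "\<lambda>h. (h + (n - 1)) mod n"
  let ?S = "{h\<in>F. ?p h \<notin> F}" and ?f = "\<lambda>h. insert (?p h) (F - {h})"
  have p_if: "?p h = (if h = 0 then n - 1 else h - 1)" if "h < n" for h
    using that n2 by (auto simp: mod_if)
  have Fn: "h < n" if "h \<in> F" for h using occ_facts(1)[OF F] that by auto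
  have Sp: "Suc (?p h) mod n = h" if "h < n" for h
    unfolding p_if[OF that] using that n2 by auto
  have pS: "?p (Suc h mod n) = h" if "h < n" for h
  proof (cases "Suc h = n")
    case True
    then have "Suc h mod n = 0" by simp
    then show ?thesis using p_if[of 0] n2 True by simp
  next
    case False
    then have "Suc h mod n = Suc h" using that by simp
    then show ?thesis using p_if[of "Suc h"] that False by simp
  qed
  have hf: "hop n (?f h) (?p h) F" if "h \<in> ?S" for h
    using that Fn Sp[of h] by (auto simp: hop_def)
  have "{E. E \<in> occ \<and> F \<in> hops n E} = ?f ` ?S"
  proof (intro equalityI subsetI)
    fix E assume "E \<in> {E. E \<in> occ \<and> F \<in> hops n E}"
    then obtain h where E: "E \<in> occ" and h: "hop n E h F" by (auto simp: hops_def)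
    have hn: "h < n" using hop_occupied(2)[OF h E] .
    have "Suc h mod n \<in> ?S" "E = ?f (Suc h mod n)"
      using h hn pS[OF hn] Suc_mod_self_neq[OF n2, of h] by (auto simp: hop_def)
    then show "E \<in> ?f ` ?S" by blast
  next
    fix E assume "E \<in> ?f ` ?S"
    then obtain h where h: "h \<in> ?S" "E = ?f h" by auto
    then have "F \<in> hops n E" using hf by (auto simp: hops_def)
    moreover have "E \<in> occ"
      using h F n2 occ_facts[OF F] l1 by (auto simp: occupied_sets_def card_insert_if)
    ultimately show "E \<in> {E. E \<in> occ \<and> F \<in> hops n E}" by simp
  qed
  moreover have "inj_on ?f ?S"
  proof (intro inj_onI)
    fix h h' assume "h \<in> ?S" "h' \<in> ?S" "?f h = ?f h'"
    then show "h = h'" using hf[of h] hf[of h'] Sp Fn hop_string_unique by (metis (no_types, lifting) mem_Collect_eq)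
  qed
  ultimately have "(\<Sum>E | E \<in> occ \<and> F \<in> hops n E. vdm n E) = (\<Sum>h\<in>?S. vdm n (?f h))"
    by (simp add: sum.reindex)
  also have "\<dots> = sin (pi * real (card F) / real n) / sin (pi / real n) * vdm n F"
  proof (intro vdm_shift_sum[where \<epsilon> = "- 1"] n2 occ_facts[OF F])
    fix h x assume h: "h < n"
    show "?p h < n \<and> ?p h \<noteq> h" using h n2 p_if[OF h] by auto
    show "\<bar>sin (pi * real (?p h) / real n - x)\<bar> = \<bar>sin (pi * real h / real n - x + - 1 * (pi / real n))\<bar>"
    proof (cases "h = 0")
      case True
      have "real (?p h) = real n - 1" using True p_if[OF h] n2 by (simp add: of_nat_diff)
      then have "pi * real (?p h) / real n - x = (- x - pi / real n) + pi"
        using n2 by (simp add: diff_divide_distrib right_diff_distrib)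
      then show ?thesis using True by (simp only: sin_periodic_pi) simp
    next
      case False
      then have "real (?p h) = real h - 1" using h p_if[OF h] by simp
      then have "pi * real (?p h) / real n - x = pi * real h / real n - x + - 1 * (pi / real n)"
        by (simp only: right_diff_distrib diff_divide_distrib)
      then show ?thesis by (simp only:)
    qed
  qed simp
  finally show ?thesis by (simp add: lam_def occ_facts(4)[OF F])
qed

lemma ker_0: "E \<in> occ \<Longrightarrow> ker 0 E F = (if E = F then 1 else 0)"
  using occ_facts(5)[of E] by (auto simp: ker_def walks_0)

lemma ker_nonneg: "E \<in> occ \<Longrightarrow> F \<in> occ \<Longrightarrow> ker k E F \<ge> 0"
  using occ_facts(5) lam_pos by (simp add: ker_def less_imp_le)

lemma ker_add:
  assumes "E \<in> occ" "F \<in> occ"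
  shows "ker (j + k) E F = (\<Sum>G\<in>occ. ker j E G * ker k G F)"
proof -
  have "ker j E G * ker k G F = real (walks n j E G * walks n k G F) * (vdm n F / (lam ^ (j + k) * vdm n E))"
    if "G \<in> occ" for G
    using occ_facts(5)[OF that] by (simp add: ker_def power_add field_simps)
  then have "(\<Sum>G\<in>occ. ker j E G * ker k G F)
      = (\<Sum>G\<in>occ. real (walks n j E G * walks n k G F) * (vdm n F / (lam ^ (j + k) * vdm n E)))"
    by (rule sum.cong[OF refl])
  also have "\<dots> = real (walks n (j + k) E F) * (vdm n F / (lam ^ (j + k) * vdm n E))"
    unfolding walks_add[OF assms(1), of j k F] of_nat_sum sum_distrib_right ..
  finally show ?thesis by (simp add: ker_def)
qed

lemma ker_sum: "E \<in> occ \<Longrightarrow> (\<Sum>F\<in>occ. ker k E F) = 1"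
proof (induction k arbitrary: E)
  case 0
  then show ?case by (simp add: ker_0 finite_occupied_sets)
next
  case (Suc k)
  have hop_sub: "hops n E \<subseteq> occ" using Suc.prems hop_occupied(1) by (auto simp: hops_def)
  have "(\<Sum>G\<in>occ. ker 1 E G) = (\<Sum>G\<in>occ. if G \<in> hops n E then vdm n G / (lam * vdm n E) else 0)"
    by (intro sum.cong) (auto simp: ker_def walks_1)
  also have "\<dots> = (\<Sum>G\<in>hops n E. vdm n G / (lam * vdm n E))"
    using hop_sub by (simp add: sum.If_cases finite_occupied_sets Int_absorb1)
  also have "\<dots> = 1"
    using sum_vdm_succ[OF Suc.prems] lam_pos occ_facts(5)[OF Suc.prems] by (simp flip: sum_divide_distrib)
  finally have 1: "(\<Sum>G\<in>occ. ker 1 E G) = 1" .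
  have "(\<Sum>F\<in>occ. ker (1 + k) E F) = (\<Sum>F\<in>occ. \<Sum>G\<in>occ. ker 1 E G * ker k G F)"
    using Suc.prems by (intro sum.cong refl ker_add)
  also have "\<dots> = (\<Sum>G\<in>occ. ker 1 E G * (\<Sum>F\<in>occ. ker k G F))"
    unfolding sum_distrib_left by (rule sum.swap)
  also have "\<dots> = 1" using Suc.IH 1 by simp
  finally show ?case by simp
qed

lemma ker_le_1: "E \<in> occ \<Longrightarrow> F \<in> occ \<Longrightarrow> ker k E F \<le> 1"
  using member_le_sum[of F occ "ker k E"] ker_sum[of E k] ker_nonneg finite_occupied_sets by auto

lemma stat_pos: "E \<in> occ \<Longrightarrow> stat E > 0"
  using occ_facts(5)[of E] n2 by (simp add: stat_def)

lemma stat_sum: "(\<Sum>E\<in>occ. stat E) = 1"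
  using vdm_sum_squares[of l n] n2 ln by (simp add: stat_def flip: sum_divide_distrib)

lemma stat_ker: "F \<in> occ \<Longrightarrow> (\<Sum>E\<in>occ. stat E * ker k E F) = stat F"
proof (induction k arbitrary: F)
  case 0
  then show ?case by (simp add: ker_0 finite_occupied_sets if_distrib cong: if_cong sum.cong)
next
  case (Suc k)
  have step: "(\<Sum>E\<in>occ. stat E * ker 1 E F) = stat F"
  proof -
    have "(\<Sum>E\<in>occ. stat E * ker 1 E F) = (\<Sum>E\<in>occ. if F \<in> hops n E then vdm n E * (vdm n F / (lam * real n ^ l)) else 0)"
      using occ_facts(5) by (intro sum.cong) (auto simp: ker_def walks_1 stat_def power2_eq_square field_simps)
    also have "\<dots> = (\<Sum>E | E \<in> occ \<and> F \<in> hops n E. vdm n E * (vdm n F / (lam * real n ^ l)))"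
      by (rule sum.inter_filter[OF finite_occupied_sets, symmetric])
    also have "\<dots> = stat F"
      unfolding sum_distrib_right[symmetric] sum_vdm_pred[OF Suc.prems]
      using lam_pos by (simp add: stat_def power2_eq_square)
    finally show ?thesis .
  qed
  have "(\<Sum>E\<in>occ. stat E * ker (k + 1) E F) = (\<Sum>E\<in>occ. \<Sum>G\<in>occ. stat E * ker k E G * ker 1 G F)"
    using Suc.prems by (intro sum.cong refl) (simp only: ker_add sum_distrib_left mult.assoc)
  also have "\<dots> = (\<Sum>G\<in>occ. (\<Sum>E\<in>occ. stat E * ker k E G) * ker 1 G F)"
    unfolding sum_distrib_right by (rule sum.swap)
  also have "\<dots> = stat F" using Suc.IH step by simp
  finally show ?case by simp
qed

lemma ker_phase:
  assumes "E \<in> occ" "ker k E F \<noteq> 0"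
  shows "phase n F = (phase n E + k) mod n"
proof -
  have "walks n k E F \<noteq> 0" using assms by (auto simp: ker_def)
  then have "{hs. length hs = k \<and> hop_walk n E hs F} \<noteq> {}" unfolding walks_def by (metis card.empty)
  then obtain hs where "length hs = k" "hop_walk n E hs F" by auto
  then show ?thesis using hop_walk_phase assms by metis
qed

text \<open>One step carries the whole stationary mass of a cyclic class to the next class, so the
  \<open>n\<close> classes weigh the same. Conditioned on a class, the stationary law has weights
  \<open>real n * stat\<close>; hence the factor \<open>real n\<close> in the later limits.\<close>

lemma stat_phase: "r < n \<Longrightarrow> (\<Sum>E | E \<in> occ \<and> phase n E = r. stat E) = 1 / real n"
proof -
  let ?c = "\<lambda>r. \<Sum>E | E \<in> occ \<and> phase n E = r. stat E"
  have c_Suc: "?c (Suc r mod n) = ?c r" if r: "r < n" for r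
  proof -
    let ?R = "{F. F \<in> occ \<and> phase n F = Suc r mod n}"
    have "?c (Suc r mod n) = (\<Sum>F\<in>?R. \<Sum>E\<in>occ. stat E * ker 1 E F)"
      by (intro sum.cong refl) (simp add: stat_ker)
    also have "\<dots> = (\<Sum>E\<in>occ. stat E * (\<Sum>F\<in>?R. ker 1 E F))"
      unfolding sum_distrib_left by (rule sum.swap)
    also have "\<dots> = (\<Sum>E\<in>occ. if phase n E = r then stat E else 0)"
    proof (intro sum.cong refl)
      fix E assume E: "E \<in> occ"
      show "stat E * (\<Sum>F\<in>?R. ker 1 E F) = (if phase n E = r then stat E else 0)"
      proof (cases "phase n E = r")
        case True
        have "(\<Sum>F\<in>?R. ker 1 E F) = (\<Sum>F\<in>occ. ker 1 E F)"
        proof (intro sum.mono_neutral_left finite_occupied_sets ballI, force, rule ccontr)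
          fix F assume F: "F \<in> occ - ?R" "ker 1 E F \<noteq> 0"
          then show False using ker_phase[OF E F(2)] True by simp
        qed
        then show ?thesis using True ker_sum[OF E] by simp
      next
        case False
        have "Suc (phase n E) mod n \<noteq> Suc r mod n"
          using False r occ_facts(6)[OF E] by (auto simp: mod_Suc split: if_splits)
        have "(\<Sum>F\<in>?R. ker 1 E F) = 0"
        proof (intro sum.neutral ballI, rule ccontr)
          fix F assume F: "F \<in> ?R" "ker 1 E F \<noteq> 0"
          then show False using ker_phase[OF E F(2)] \<open>Suc (phase n E) mod n \<noteq> Suc r mod n\<close> by simp
        qed
        then show ?thesis using False by simp
      qed
    qed
    also have "\<dots> = ?c r" by (rule sum.inter_filter[OF finite_occupied_sets, symmetric])
    finally show ?thesis .
  qed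
  have c0: "?c r = ?c 0" if "r < n" for r
    using that
  proof (induction r)
    case (Suc r)
    then show ?case using c_Suc[of r] by simp
  qed simp
  have "1 = (\<Sum>r<n. ?c r)"
    using sum.group[of occ "{..<n}" "phase n" stat] occ_facts(6) stat_sum finite_occupied_sets
    by (auto simp: image_subset_iff)
  also have "\<dots> = (\<Sum>r<n. ?c 0)" by (rule sum.cong[OF refl c0]) simp
  also have "\<dots> = real n * ?c 0" by simp
  finally have "?c 0 = 1 / real n" using n2 by (simp add: field_simps)
  then show "?c r = 1 / real n" if "r < n" by (rule trans[OF c0[OF that]])
qed

end

section \<open>Irreducibility, period and mixing of the chain\<close>

lemma hop_walk_up:
  assumes "a \<le> b" "b < n" "a \<notin> S" "\<And>x. a < x \<Longrightarrow> x \<le> b \<Longrightarrow> x \<notin> S"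
  shows "hop_walk n (insert a S) [a..<b] (insert b S)"
  using assms
proof (induction "b - a" arbitrary: a)
  case 0
  then show ?case by simp
next
  case (Suc d)
  then have ab: "a < b" by simp
  then have m: "Suc a mod n = Suc a" using Suc.prems by simp
  have S: "Suc a \<notin> S" using Suc.prems ab by simp
  have del: "insert a S - {a} = S" using Suc.prems by auto
  have "hop n (insert a S) a (insert (Suc a) S)"
    using S by (simp add: hop_def m del)
  moreover have "hop_walk n (insert (Suc a) S) [Suc a..<b] (insert b S)"
    using Suc.hyps(2) Suc.prems ab S by (intro Suc.hyps(1)) auto
  ultimately show ?case using ab upt_conv_Cons[OF ab] by auto
qed

text \<open>The topmost point of the block moves before the others, which keeps each target vacant;
  hence the reversed list.\<close>

lemma hop_walk_shift:
  assumes "k < n" "\<And>x. x \<in> S \<Longrightarrow> k < x"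
  shows "hop_walk n ({..<k} \<union> S) (rev [0..<k]) ({1..k} \<union> S)"
  using assms
proof (induction k arbitrary: S)
  case 0
  then show ?case by simp
next
  case (Suc k)
  have notS: "k \<notin> S" "Suc k \<notin> S" using Suc.prems(2)[of k] Suc.prems(2)[of "Suc k"] by auto
  have "Suc k mod n = Suc k" using Suc.prems by simp
  moreover have "{..<Suc k} \<union> S - {k} = {..<k} \<union> S" using notS by auto
  ultimately have "hop n ({..<Suc k} \<union> S) k ({..<k} \<union> insert (Suc k) S)"
    using notS by (simp add: hop_def)
  moreover have "hop_walk n ({..<k} \<union> insert (Suc k) S) (rev [0..<k]) ({1..k} \<union> insert (Suc k) S)"
  proof (rule Suc.IH)
    fix x assume "x \<in> insert (Suc k) S"
    then show "k < x" using Suc.prems(2)[of x] by auto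
  qed (use Suc.prems in simp)
  moreover have "{1..k} \<union> insert (Suc k) S = {1..Suc k} \<union> S" by auto
  ultimately show ?case by auto
qed

lemma mod_add_right_inj:
  fixes x y n i :: nat
  assumes "x < n" "y < n" "(x + i) mod n = (y + i) mod n"
  shows "x = y"
proof -
  have le: "x = y" if "x \<le> y" "y < n" "(y + i) mod n = (x + i) mod n" for x y
  proof -
    have "n dvd y - x" using that by (subst (asm) mod_eq_dvd_iff_nat) auto
    then show ?thesis using that by (auto dest!: dvd_imp_le)
  qed
  then show ?thesis using assms by (metis nat_le_linear)
qed

context bead_ring
begin

definition reach :: "nat set \<Rightarrow> nat set \<Rightarrow> bool" where
  "reach E F \<longleftrightarrow> (\<exists>k. walks n k E F > 0)"

lemma walks_pos_iff: "E \<in> occ \<Longrightarrow> walks n k E F > 0 \<longleftrightarrow> (\<exists>hs. length hs = k \<and> hop_walk n E hs F)"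
  unfolding walks_def using finite_walk_lists[of E n l k F] by (auto simp: card_gt_0_iff)

lemma walks_pos_add:
  assumes "E \<in> occ" "walks n j E G > 0" "walks n k G F > 0"
  shows "walks n (j + k) E F > 0"
proof -
  obtain xs where xs: "length xs = j" "hop_walk n E xs G" using assms walks_pos_iff by blast
  then have "G \<in> occ" using assms hop_walk_occupied by blast
  then obtain ys where ys: "length ys = k" "hop_walk n G ys F" using assms walks_pos_iff by blast
  have "hop_walk n E (xs @ ys) F" using xs ys by (auto simp: hop_walk_append)
  then show ?thesis using xs ys walks_pos_iff[OF assms(1)] by (metis length_append)
qed

lemma reach_occ: "E \<in> occ \<Longrightarrow> reach E F \<Longrightarrow> F \<in> occ"
  unfolding reach_def using walks_pos_iff hop_walk_occupied by blast

lemma reach_refl: "reach E E"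
  unfolding reach_def by (rule exI[of _ 0]) (simp add: walks_0)

lemma reach_trans: "E \<in> occ \<Longrightarrow> reach E F \<Longrightarrow> reach F G \<Longrightarrow> reach E G"
  unfolding reach_def using walks_pos_add by blast

lemma reach_hop: "F \<in> hops n E \<Longrightarrow> reach E F"
  unfolding reach_def by (rule exI[of _ "Suc 0"]) (simp add: walks_1)

text \<open>A closed set of states has no incoming transitions, because the stationary weights are positive.\<close>

lemma reach_sym:
  assumes E: "E \<in> occ" and EF: "reach E F"
  shows "reach F E"
proof -
  have F: "F \<in> occ" using reach_occ[OF E EF] .
  define C where "C = {G \<in> occ. reach F G}"
  have C: "C \<subseteq> occ" "finite C" using finite_occupied_sets[of n l] by (auto simp: C_def)
  have inner: "(\<Sum>G\<in>C. ker 1 H G) = 1" if "H \<in> C" for H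
  proof -
    have "(\<Sum>G\<in>C. ker 1 H G) = (\<Sum>G\<in>occ. ker 1 H G)"
    proof (intro sum.mono_neutral_left finite_occupied_sets C ballI)
      fix G assume G: "G \<in> occ - C"
      have "G \<notin> hops n H"
        using G that reach_hop[of G H] reach_trans[OF F, of H G] by (auto simp: C_def)
      then show "ker 1 H G = 0" by (simp add: ker_def walks_1)
    qed
    then show ?thesis using ker_sum[of H 1] that C by auto
  qed
  have "(\<Sum>G\<in>C. stat G) = (\<Sum>G\<in>C. \<Sum>H\<in>occ. stat H * ker 1 H G)"
    using stat_ker[of _ 1] C by (intro sum.cong) auto
  also have "\<dots> = (\<Sum>H\<in>occ. stat H * (\<Sum>G\<in>C. ker 1 H G))"
    unfolding sum_distrib_left by (rule sum.swap)
  also have "\<dots> = (\<Sum>H\<in>occ - C. stat H * (\<Sum>G\<in>C. ker 1 H G)) + (\<Sum>H\<in>C. stat H * (\<Sum>G\<in>C. ker 1 H G))"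
    by (rule sum.subset_diff[OF C(1) finite_occupied_sets])
  also have "(\<Sum>H\<in>C. stat H * (\<Sum>G\<in>C. ker 1 H G)) = (\<Sum>H\<in>C. stat H)"
    using inner by simp
  finally have "(\<Sum>H\<in>occ - C. stat H * (\<Sum>G\<in>C. ker 1 H G)) = 0" by simp
  then have z: "\<forall>H\<in>occ - C. stat H * (\<Sum>G\<in>C. ker 1 H G) = 0"
  proof (subst (asm) sum_nonneg_eq_0_iff)
    show "finite (occ - C)" using finite_occupied_sets[of n l] by simp
    show "0 \<le> stat H * (\<Sum>G\<in>C. ker 1 H G)" if "H \<in> occ - C" for H
      using that C ker_nonneg[of H] stat_pos[of H] by (intro mult_nonneg_nonneg sum_nonneg) auto
  qed
  have no_in: "G \<notin> hops n H" if "H \<in> occ - C" "G \<in> C" for G H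
  proof
    assume "G \<in> hops n H"
    have "stat H * (\<Sum>G\<in>C. ker 1 H G) = 0" using z that(1) by blast
    then have "(\<Sum>G\<in>C. ker 1 H G) = 0" using that stat_pos[of H] by (simp only: mult_eq_0_iff) auto
    then have "ker 1 H G = 0"
      using that C ker_nonneg[of H] by (subst (asm) sum_nonneg_eq_0_iff) auto
    moreover have "ker 1 H G > 0"
      using \<open>G \<in> hops n H\<close> that C occ_facts(5)[of H] occ_facts(5)[of G] lam_pos by (auto simp: ker_def walks_1)
    ultimately show False by simp
  qed
  have "H \<in> C" if "hop_walk n H hs F" "H \<in> occ" for H hs
    using that
  proof (induction hs arbitrary: H)
    case Nil
    then show ?case using reach_refl by (simp add: C_def)
  next
    case (Cons h hs)
    then obtain H' where H': "hop n H h H'" "hop_walk n H' hs F" by auto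
    then have "H' \<in> C" using Cons hop_occupied(1)[OF H'(1)] by blast
    moreover have "H' \<in> hops n H" using H' by (auto simp: hops_def)
    ultimately show ?case using no_in[of H H'] Cons.prems by blast
  qed
  then have "E \<in> C" using EF E walks_pos_iff unfolding reach_def by blast
  then show ?thesis by (simp add: C_def)
qed

text \<open>Hops that do not cross the seam from \<open>n - 1\<close> to 0 lower the potential
  \<open>\<Sum>i\<in>E. n - i\<close>, and a set allowing none of them is closed upwards, hence the
  top interval. So all states reach one common state, and \<open>reach_sym\<close> supplies the way
  back.\<close>

lemma reach_top: "E \<in> occ \<Longrightarrow> reach E {n - l..<n}"
proof (induction "\<Sum>i\<in>E. n - i" arbitrary: E rule: less_induct)
  case less
  note E = occ_facts[OF less.prems]
  show ?case
  proof (cases "\<exists>h\<in>E. Suc h < n \<and> Suc h \<notin> E")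
    case True
    then obtain h where h: "h \<in> E" "Suc h < n" "Suc h \<notin> E" by auto
    define E' where "E' = insert (Suc h) (E - {h})"
    have hop: "hop n E h E'" using h by (simp add: hop_def E'_def)
    have E': "E' \<in> occ" using hop_occupied(1)[OF hop less.prems] .
    have "(\<Sum>i\<in>E. n - i) = (n - h) + (\<Sum>i\<in>E - {h}. n - i)" using h E(3) by (simp add: sum.remove)
    moreover have "(\<Sum>i\<in>E'. n - i) = (n - Suc h) + (\<Sum>i\<in>E - {h}. n - i)"
      using h E(3) by (simp add: E'_def)
    ultimately have "(\<Sum>i\<in>E'. n - i) < (\<Sum>i\<in>E. n - i)" using h(2) by simp
    then have "reach E' {n - l..<n}" using less.hyps E' by blast
    moreover have "reach E E'" using hop by (intro reach_hop) (auto simp: hops_def)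
    ultimately show ?thesis using reach_trans less.prems by blast
  next
    case False
    have up: "h + d \<in> E" if "h \<in> E" "h + d < n" for h d
      using that
    proof (induction d)
      case (Suc d)
      then show ?case using False by (metis Suc_lessD add_Suc_right)
    qed simp
    define m where "m = Min E"
    have m: "m \<in> E" "\<And>x. x \<in> E \<Longrightarrow> m \<le> x" using E(2,3) by (auto simp: m_def)
    have "E = {m..<n}"
    proof (intro equalityI subsetI)
      fix x assume "x \<in> E" then show "x \<in> {m..<n}" using m E(1) by auto
    next
      fix x assume "x \<in> {m..<n}" then show "x \<in> E" using up[OF m(1), of "x - m"] by simp
    qed
    moreover from this have "n - m = l" using E(4) by simp
    moreover have "m < n" using m E(1) by auto
    ultimately have "E = {n - l..<n}" by auto
    then show ?thesis using reach_refl by simp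
  qed
qed

lemma reach_all:
  assumes "E \<in> occ" "F \<in> occ"
  shows "reach E F"
proof -
  have "reach {n - l..<n} F" using reach_sym[OF assms(2) reach_top[OF assms(2)]] .
  then show ?thesis using reach_trans[OF assms(1) reach_top[OF assms(1)]] by blast
qed

text \<open>A rotation of the block \<open>{..<l}\<close>: its top point runs up to
  \<open>n - 1\<close>, the others move up by one, and the leading point crosses to 0. The hops
  number \<open>(n - l) + (l - 1) + 1 = n\<close>, the least positive length that
  \<open>phase\<close> allows for a return.\<close>

lemma cycle: "\<exists>E\<in>occ. walks n n E E > 0"
proof
  let ?E = "{..<l}" and ?k = "l - 1"
  show occ: "?E \<in> occ" using ln by (auto simp: occupied_sets_def)
  have k: "?k < n" "l < n" "Suc ?k = l" using ln l1 n2 by auto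
  have w1: "hop_walk n (insert ?k {..<?k}) [?k..<n - 1] (insert (n - 1) {..<?k})"
    using k by (intro hop_walk_up) auto
  have w2: "hop_walk n ({..<?k} \<union> {n - 1}) (rev [0..<?k]) ({1..?k} \<union> {n - 1})"
    using k by (intro hop_walk_shift) auto
  have w3: "hop n ({1..?k} \<union> {n - 1}) (n - 1) {..<l}"
    using k by (auto simp: hop_def)
  have e1: "insert ?k {..<?k} = {..<l}" using k by auto
  have e2: "insert (n - 1) {..<?k} = {..<?k} \<union> {n - 1}" by auto
  have "hop_walk n ?E ([?k..<n - 1] @ rev [0..<?k] @ [n - 1]) ?E"
    unfolding hop_walk_append using w1 w2 w3 unfolding e1 e2 by auto
  moreover have "length ([?k..<n - 1] @ rev [0..<?k] @ [n - 1]) = n" using k by simp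
  ultimately show "walks n n ?E ?E > 0" using walks_pos_iff[OF occ] by blast
qed

text \<open>The walk makes a detour to a state lying on an \<open>n\<close>-cycle and runs through
  that cycle \<open>k\<close> times, so the offset \<open>d\<close> does not depend on
  \<open>k\<close>.\<close>

lemma walks_multiple:
  assumes "E \<in> occ" "F \<in> occ"
  shows "\<exists>d. \<forall>k. walks n (d + k * n) E F > 0"
proof -
  obtain G where G: "G \<in> occ" "walks n n G G > 0" using cycle by auto
  obtain a where a: "walks n a E G > 0" using reach_all[OF assms(1) G(1)] by (auto simp: reach_def)
  obtain b where b: "walks n b G F > 0" using reach_all[OF G(1) assms(2)] by (auto simp: reach_def)
  have cyc: "walks n (k * n) G G > 0" for k
  proof (induction k)
    case (Suc k)
    then show ?case using walks_pos_add[OF G(1) G(2) Suc.IH] by simp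
  qed (simp add: walks_0)
  have "walks n (a + b + k * n) E F > 0" for k
    using walks_pos_add[OF assms(1) a walks_pos_add[OF G(1) cyc[of k] b]] by (simp add: ac_simps)
  then show ?thesis by blast
qed

lemma walks_phase:
  assumes "E \<in> occ" "walks n k E F > 0"
  shows "phase n F = (phase n E + k) mod n"
proof -
  obtain hs where "length hs = k" "hop_walk n E hs F" using assms walks_pos_iff by blast
  then show ?thesis using hop_walk_phase[of n E hs F l] assms(1) by simp
qed

lemma uniform_positivity:
  "\<exists>D>0. n dvd D \<and> (\<forall>E\<in>occ. \<forall>F\<in>occ. phase n E = phase n F \<longrightarrow> ker D E F > 0)"
proof -
  obtain d where d: "\<And>E F k. E \<in> occ \<Longrightarrow> F \<in> occ \<Longrightarrow> walks n (d E F + k * n) E F > 0"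
    using walks_multiple by metis
  define A where "A = {(E, F). E \<in> occ \<and> F \<in> occ \<and> phase n E = phase n F}"
  have finA: "finite A"
    by (rule finite_subset[of _ "occ \<times> occ"]) (auto simp: A_def finite_occupied_sets)
  have dvd: "n dvd d E F" if "(E, F) \<in> A" for E F
  proof -
    have "phase n F = (phase n E + d E F) mod n"
      using d[of E F 0] that by (intro walks_phase) (auto simp: A_def)
    moreover have "phase n F = phase n E" "phase n E < n" using that occ_facts(6) by (auto simp: A_def)
    ultimately have "(phase n E + d E F) mod n = phase n E mod n" by simp
    then show ?thesis by (subst (asm) mod_eq_dvd_iff_nat) auto
  qed
  \<comment> \<open>One number of steps for all pairs: each \<open>d E F\<close> is a multiple of
    \<open>n\<close> and at most the sum, so \<open>D\<close> exceeds it by a multiple of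
    \<open>n\<close>, to be spent on cycles. The extra \<open>n\<close> makes \<open>D\<close>
    positive even if all offsets vanish.\<close>
  define D where "D = n + (\<Sum>(E, F)\<in>A. d E F)"
  have "n dvd D" unfolding D_def using dvd by (intro dvd_add dvd_sum) auto
  moreover have "D > 0" using n2 by (simp add: D_def)
  moreover have "ker D E F > 0" if "E \<in> occ" "F \<in> occ" "phase n E = phase n F" for E F
  proof -
    have EF: "(E, F) \<in> A" using that by (simp add: A_def)
    have le: "d E F \<le> D"
      using member_le_sum[OF EF _ finA, of "\<lambda>(E, F). d E F"] by (simp add: D_def)
    have "n dvd D - d E F" using dvd[OF EF] \<open>n dvd D\<close> by (rule dvd_diff_nat[rotated])
    then obtain k where "D - d E F = k * n" by (metis dvd_def mult.commute)
    then have "D = d E F + k * n" using le by simp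
    then have "walks n D E F > 0" using d that by simp
    then show ?thesis using that occ_facts(5) lam_pos by (simp add: ker_def)
  qed
  ultimately show ?thesis by blast
qed

text \<open>Two copies of the chain started in the same cyclic class and run independently for \<open>D\<close> steps
  coincide with probability at least \<open>\<delta>\<close>, so the oscillation of \<open>ker i \<cdot> G\<close> on a class contracts.\<close>

lemma oscillation:
  "\<exists>D>0. \<exists>\<delta>. 0 < \<delta> \<and> \<delta> < 1 \<and> (\<forall>i E E' G. E \<in> occ \<longrightarrow> E' \<in> occ \<longrightarrow> G \<in> occ \<longrightarrow> phase n E = phase n E' \<longrightarrow>
     \<bar>ker i E G - ker i E' G\<bar> \<le> (1 - \<delta>) ^ (i div D))"
proof -
  obtain D where D: "D > 0" "n dvd D"
    and pos: "\<And>E F. E \<in> occ \<Longrightarrow> F \<in> occ \<Longrightarrow> phase n E = phase n F \<Longrightarrow> ker D E F > 0"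
    using uniform_positivity by metis
  define A where "A = {(E, F). E \<in> occ \<and> F \<in> occ \<and> phase n E = phase n F}"
  have finA: "finite A"
    by (rule finite_subset[of _ "occ \<times> occ"]) (auto simp: A_def finite_occupied_sets)
  \<comment> \<open>The entry \<open>1/2\<close> keeps the minimum below 1, so that
    \<open>1 - \<delta>\<close> stays positive.\<close>
  define \<epsilon> where "\<epsilon> = Min (insert (1/2) ((\<lambda>(E, F). ker D E F) ` A))"
  have fin: "finite (insert (1/2) ((\<lambda>(E, F). ker D E F) ` A))" using finA by simp
  have "\<epsilon> \<in> insert (1/2) ((\<lambda>(E, F). ker D E F) ` A)"
    unfolding \<epsilon>_def using fin by (rule Min_in) simp
  then have e0: "\<epsilon> > 0" using pos by (auto simp: A_def)
  have e1: "\<epsilon> \<le> 1/2" unfolding \<epsilon>_def using fin by (rule Min_le) simp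
  have ek: "\<epsilon> \<le> ker D E F" if "E \<in> occ" "F \<in> occ" "phase n E = phase n F" for E F
    unfolding \<epsilon>_def using fin by (rule Min_le) (use that in \<open>auto simp: A_def\<close>)
  \<comment> \<open>A lower bound for the chance that both copies stand at \<open>E\<close> itself
    after \<open>D\<close> steps; one common state is enough.\<close>
  define \<delta> where "\<delta> = \<epsilon>\<^sup>2"
  have d0: "0 < \<delta>" using e0 by (simp add: \<delta>_def)
  have "\<epsilon>\<^sup>2 \<le> (1/2)\<^sup>2" using e0 e1 by (intro power_mono) auto
  then have d1: "\<delta> < 1" unfolding \<delta>_def by (simp add: power2_eq_square)
  have osc: "\<bar>ker i E G - ker i E' G\<bar> \<le> (1 - \<delta>) ^ (i div D)"
    if "E \<in> occ" "E' \<in> occ" "G \<in> occ" "phase n E = phase n E'" for i E E' G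
    using that
  proof (induction i arbitrary: E E' rule: less_induct)
    case (less i)
    show ?case
    proof (cases "i < D")
      case True
      have "\<bar>ker i E G - ker i E' G\<bar> \<le> 1"
        using ker_nonneg[of E G i] ker_nonneg[of E' G i] ker_le_1[of E G i] ker_le_1[of E' G i] less.prems
        by (auto simp: abs_le_iff)
      then show ?thesis using True by simp
    next
      case False
      define j where "j = i - D"
      have ij: "i = D + j" "j < i" using False D by (auto simp: j_def)
      then have idiv: "i div D = Suc (j div D)" using D by simp
      define b where "b = (1 - \<delta>) ^ (j div D)"
      have b0: "b \<ge> 0" using d1 by (simp add: b_def)
      let ?p = "\<lambda>x y. ker D E x * ker D E' y"
      have p0: "?p x y \<ge> 0" if "x \<in> occ" "y \<in> occ" for x y
        using that less.prems ker_nonneg by simp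
      have sum1: "(\<Sum>x\<in>occ. \<Sum>y\<in>occ. ?p x y) = 1"
        using ker_sum less.prems by (simp flip: sum_distrib_left)
      \<comment> \<open>A nonzero product puts \<open>x\<close> and \<open>y\<close> into the same
        cyclic class, so the induction hypothesis applies to them; on the diagonal the difference is
        zero.\<close>
      have bound: "?p x y * (ker j x G - ker j y G) \<le> ?p x y * (if x = y then 0 else b)
          \<and> - (?p x y * (ker j x G - ker j y G)) \<le> ?p x y * (if x = y then 0 else b)"
        if xy: "x \<in> occ" "y \<in> occ" for x y
      proof (cases "?p x y = 0")
        case True
        then show ?thesis by (simp only: mult_zero_left) simp
      next
        case False
        then have "phase n x = (phase n E + D) mod n" "phase n y = (phase n E' + D) mod n"
          using ker_phase less.prems by auto
        then have "\<bar>ker j x G - ker j y G\<bar> \<le> b"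
          using less.IH[OF ij(2) xy less.prems(3)] less.prems(4) by (simp add: b_def)
        then have "ker j x G - ker j y G \<le> (if x = y then 0 else b)" "- (ker j x G - ker j y G) \<le> (if x = y then 0 else b)"
          by (auto simp: abs_le_iff)
        then show ?thesis using p0[OF xy] by (metis mult_left_mono mult_minus_right)
      qed
      have expand: "ker i E G - ker i E' G = (\<Sum>x\<in>occ. \<Sum>y\<in>occ. ?p x y * (ker j x G - ker j y G))"
      proof -
        have "(\<Sum>x\<in>occ. \<Sum>y\<in>occ. ?p x y * (ker j x G - ker j y G))
            = (\<Sum>x\<in>occ. \<Sum>y\<in>occ. ker D E x * ker j x G * ker D E' y) - (\<Sum>x\<in>occ. \<Sum>y\<in>occ. ker D E x * (ker D E' y * ker j y G))"
          by (simp add: algebra_simps sum_subtractf)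
        also have "(\<Sum>x\<in>occ. \<Sum>y\<in>occ. ker D E x * ker j x G * ker D E' y) = ker i E G"
          using ker_sum less.prems unfolding ij(1) by (simp add: ker_add flip: sum_distrib_left)
        also have "(\<Sum>x\<in>occ. \<Sum>y\<in>occ. ker D E x * (ker D E' y * ker j y G)) = ker i E' G"
          using ker_sum less.prems unfolding ij(1) by (simp add: ker_add flip: sum_distrib_left sum_distrib_right)
        finally show ?thesis ..
      qed
      have diag: "(\<Sum>x\<in>occ. ?p x x) \<ge> \<delta>"
      proof -
        have "\<delta> \<le> ?p E E"
          unfolding \<delta>_def power2_eq_square using e0 ek[of E E] ek[of E' E] less.prems by (intro mult_mono) auto
        also have "\<dots> \<le> (\<Sum>x\<in>occ. ?p x x)"
          using p0 less.prems by (intro member_le_sum finite_occupied_sets) auto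
        finally show ?thesis .
      qed
      have tot: "(\<Sum>x\<in>occ. \<Sum>y\<in>occ. ?p x y * (if x = y then 0 else b)) \<le> (1 - \<delta>) * b"
      proof -
        have "(\<Sum>x\<in>occ. \<Sum>y\<in>occ. ?p x y * (if x = y then 0 else b))
            = (\<Sum>x\<in>occ. \<Sum>y\<in>occ. b * ?p x y - (if x = y then b * ?p x y else 0))"
          by (intro sum.cong refl) auto
        also have "\<dots> = b * (\<Sum>x\<in>occ. \<Sum>y\<in>occ. ?p x y) - b * (\<Sum>x\<in>occ. ?p x x)"
          by (simp add: finite_occupied_sets sum_subtractf sum_distrib_left)
        also have "\<dots> = b * 1 - b * (\<Sum>x\<in>occ. ?p x x)" by (simp only: sum1)
        also have "\<dots> \<le> (1 - \<delta>) * b"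
          using mult_left_mono[OF diag b0] by (simp add: algebra_simps)
        finally show ?thesis .
      qed
      have "ker i E G - ker i E' G \<le> (1 - \<delta>) * b"
        unfolding expand by (rule order_trans[OF sum_mono[OF sum_mono] tot]) (use bound in blast)
      moreover have "- (ker i E G - ker i E' G) \<le> (1 - \<delta>) * b"
        unfolding expand sum_negf[symmetric] by (rule order_trans[OF sum_mono[OF sum_mono] tot]) (use bound in blast)
      ultimately show ?thesis by (simp add: idiv b_def abs_le_iff)
    qed
  qed
  show ?thesis using D(1) d0 d1 osc by blast
qed

text \<open>Averaging \<open>ker i x G\<close> over the cyclic class of \<open>E\<close> with its
  stationary weights gives \<open>real n * stat G\<close>, because no other class can reach
  \<open>G\<close> in \<open>i\<close> steps. The distance is thus an average of the differences
  controlled by \<open>oscillation\<close>.\<close>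

lemma mixing:
  "\<exists>C \<rho>. 0 < C \<and> 0 < \<rho> \<and> \<rho> < 1 \<and> (\<forall>i E G. E \<in> occ \<longrightarrow> G \<in> occ \<longrightarrow> phase n G = (phase n E + i) mod n \<longrightarrow>
     \<bar>ker i E G - real n * stat G\<bar> \<le> C * \<rho> ^ i)"
proof -
  obtain D \<delta> where D: "D > 0" and d: "0 < \<delta>" "\<delta> < 1"
    and osc: "\<And>i E E' G. E \<in> occ \<Longrightarrow> E' \<in> occ \<Longrightarrow> G \<in> occ \<Longrightarrow> phase n E = phase n E' \<Longrightarrow>
     \<bar>ker i E G - ker i E' G\<bar> \<le> (1 - \<delta>) ^ (i div D)"
    using oscillation by metis
  \<comment> \<open>The contraction per \<open>D\<close> steps becomes a rate per step; the constant
    \<open>1 / (1 - \<delta>)\<close> below pays for the rounding in \<open>i div D\<close>.\<close>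
  define \<rho> where "\<rho> = root D (1 - \<delta>)"
  have rD: "\<rho> ^ D = 1 - \<delta>" using D d by (simp add: \<rho>_def)
  have r: "0 < \<rho>" "\<rho> < 1" using D d by (auto simp: \<rho>_def)
  have geo: "(1 - \<delta>) ^ (i div D) \<le> 1 / (1 - \<delta>) * \<rho> ^ i" for i
  proof -
    have "i \<le> D * (i div D) + D"
      using mult_div_mod_eq[of D i] mod_less_divisor[OF D, of i] by linarith
    then have "\<rho> ^ (D * (i div D) + D) \<le> \<rho> ^ i" using r by (intro power_decreasing) auto
    then have "(1 - \<delta>) ^ (i div D) * (1 - \<delta>) \<le> \<rho> ^ i" by (simp only: power_add power_mult rD)
    then show ?thesis using d by (simp add: field_simps)
  qed
  have main: "\<bar>ker i E G - real n * stat G\<bar> \<le> 1 / (1 - \<delta>) * \<rho> ^ i"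
    if E: "E \<in> occ" and G: "G \<in> occ" and ph: "phase n G = (phase n E + i) mod n" for i E G
  proof -
    let ?R = "{x. x \<in> occ \<and> phase n x = phase n E}"
    have R1: "(\<Sum>x\<in>?R. stat x) = 1 / real n" using stat_phase occ_facts(6)[OF E] by simp
    have "(\<Sum>x\<in>?R. stat x * ker i x G) = (\<Sum>x\<in>occ. stat x * ker i x G)"
    proof (intro sum.mono_neutral_left finite_occupied_sets ballI, force)
      fix x assume x: "x \<in> occ - ?R"
      have "ker i x G = 0"
      proof (rule ccontr)
        assume "ker i x G \<noteq> 0"
        then have "(phase n x + i) mod n = (phase n E + i) mod n" using ker_phase[of x i G] x ph by simp
        then have "phase n x = phase n E"
          using mod_add_right_inj[of "phase n x" n "phase n E" i] x occ_facts(6)[of x] occ_facts(6)[OF E] by simp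
        then show False using x by simp
      qed
      then show "stat x * ker i x G = 0" by simp
    qed
    then have R2: "(\<Sum>x\<in>?R. stat x * ker i x G) = stat G" using stat_ker[OF G] by simp
    have "ker i E G - real n * stat G = real n * (\<Sum>x\<in>?R. stat x * (ker i E G - ker i x G))"
    proof -
      have "(\<Sum>x\<in>?R. stat x * (ker i E G - ker i x G)) = (\<Sum>x\<in>?R. stat x) * ker i E G - (\<Sum>x\<in>?R. stat x * ker i x G)"
        by (simp only: right_diff_distrib sum_subtractf sum_distrib_right)
      then show ?thesis unfolding R1 R2 using n2 by (simp add: field_simps)
    qed
    then have eq: "\<bar>ker i E G - real n * stat G\<bar> = real n * \<bar>\<Sum>x\<in>?R. stat x * (ker i E G - ker i x G)\<bar>"
      by (simp only: abs_mult abs_of_nat)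
    have "\<bar>\<Sum>x\<in>?R. stat x * (ker i E G - ker i x G)\<bar> \<le> (\<Sum>x\<in>?R. stat x * (1 - \<delta>) ^ (i div D))"
    proof (rule order_trans[OF sum_abs], rule sum_mono)
      fix x assume x: "x \<in> ?R"
      have "\<bar>ker i E G - ker i x G\<bar> \<le> (1 - \<delta>) ^ (i div D)" using osc[OF E _ G] x by auto
      moreover have "0 \<le> stat x" using stat_pos[of x] x by auto
      ultimately show "\<bar>stat x * (ker i E G - ker i x G)\<bar> \<le> stat x * (1 - \<delta>) ^ (i div D)"
        unfolding abs_mult by (simp add: mult_left_mono)
    qed
    then have "\<bar>\<Sum>x\<in>?R. stat x * (ker i E G - ker i x G)\<bar> \<le> 1 / real n * (1 - \<delta>) ^ (i div D)"
      by (simp only: R1[symmetric] sum_distrib_right)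
    then have "\<bar>ker i E G - real n * stat G\<bar> \<le> real n * (1 / real n * (1 - \<delta>) ^ (i div D))"
      unfolding eq by (rule mult_left_mono) simp
    then have "\<bar>ker i E G - real n * stat G\<bar> \<le> (1 - \<delta>) ^ (i div D)" using n2 by simp
    also note geo[of i]
    finally show ?thesis .
  qed
  have "0 < 1 / (1 - \<delta>)" using d by simp
  with main r show ?thesis by blast
qed

end

section \<open>Bead paths as walks\<close>

lemma left_lim_eqI:
  assumes "\<forall>\<^sub>F s in at_left t. X s = E"
  shows "left_lim X t = E"
  unfolding left_lim_def
proof (rule the_equality)
  fix E' assume "\<forall>\<^sub>F s in at_left t. X s = E'"
  with assms have "\<forall>\<^sub>F s in at_left t. E = E'" by eventually_elim simp
  then show "E' = E" by simp
qed fact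

lemma eventually_left_lim:
  assumes "X \<in> bead_paths n l"
  shows "\<forall>\<^sub>F s in at_left t. X s = left_lim X t"
proof -
  obtain E where E: "\<forall>\<^sub>F s in at_left t. X s = E" using assms unfolding bead_paths_def by blast
  then show ?thesis using left_lim_eqI[OF E] by simp
qed

lemma bead_paths_D:
  assumes "X \<in> bead_paths n l"
  shows "X t \<in> occupied_sets n l" "\<forall>\<^sub>F s in at_right t. X s = X t"
    "finite {t \<in> {a..b}. left_lim X t \<noteq> X t}"
    "left_lim X t \<noteq> X t \<Longrightarrow> \<exists>h. hop n (left_lim X t) h (X t)"
    "left_lim X t \<in> occupied_sets n l"
proof -
  show X: "X t \<in> occupied_sets n l" for t using assms by (auto simp: bead_paths_def)
  show "\<forall>\<^sub>F s in at_right t. X s = X t" "finite {t \<in> {a..b}. left_lim X t \<noteq> X t}"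
    "left_lim X t \<noteq> X t \<Longrightarrow> \<exists>h. hop n (left_lim X t) h (X t)"
    using assms unfolding bead_paths_def by blast+
  have "\<forall>\<^sub>F s in at_left t. left_lim X t \<in> occupied_sets n l"
    using eventually_left_lim[OF assms, of t] by eventually_elim (metis X)
  then show "left_lim X t \<in> occupied_sets n l" by simp
qed

lemma beads_iff_jump:
  assumes "X \<in> bead_paths n l"
  shows "(\<exists>h. (t, h) \<in> beads n X) \<longleftrightarrow> left_lim X t \<noteq> X t"
  proof
  assume "\<exists>h. (t, h) \<in> beads n X"
  then obtain h where "hop n (left_lim X t) h (X t)" by (auto simp: beads_def)
  then show "left_lim X t \<noteq> X t" using hop_neq by metis
next
  assume "left_lim X t \<noteq> X t"
  then show "\<exists>h. (t, h) \<in> beads n X" using bead_paths_D(4)[OF assms, of t] by (simp add: beads_def)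
qed

lemma beads_string_less:
  assumes "X \<in> bead_paths n l" "(t, h) \<in> beads n X"
  shows "h < n"
  using hop_occupied(2)[OF _ bead_paths_D(5)[OF assms(1)]] assms(2) by (auto simp: beads_def)

text \<open>A locally constant function on a connected interval is constant. A jump at
  \<open>r\<close> itself is allowed, since only the right neighbourhood of \<open>r\<close> lies in
  the interval.\<close>

lemma bead_path_const:
  assumes X: "X \<in> bead_paths n l" and le: "r \<le> r'"
    and nojump: "\<And>t. r < t \<Longrightarrow> t \<le> r' \<Longrightarrow> left_lim X t = X t"
  shows "X r' = X r"
proof -
  have "X r = X r'"
  proof (rule connected_local_const[of "{r..r'}" r r' X])
    show "\<forall>a\<in>{r..r'}. \<forall>\<^sub>F b in at a within {r..r'}. X a = X b"
    proof
      fix a assume a: "a \<in> {r..r'}"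
      have R: "\<forall>\<^sub>F b in at_right a. X a = X b"
        using bead_paths_D(2)[OF X, of a] by eventually_elim simp
      show "\<forall>\<^sub>F b in at a within {r..r'}. X a = X b"
      proof (cases "a = r")
        case True
        have "at a within {r..r'} = at a within ({r..r'} - {a})" by (simp add: at_within_def)
        also have "\<dots> \<le> at_right a" using True by (intro at_le) auto
        finally show ?thesis using R by (rule filter_leD)
      next
        case False
        then have eq: "left_lim X a = X a" using a nojump by auto
        have "\<forall>\<^sub>F b in at_left a. X a = X b"
          using eventually_left_lim[OF X, of a] by eventually_elim (simp add: eq)
        then have "\<forall>\<^sub>F b in at a. X a = X b" using R by (simp add: eventually_at_split)
        moreover have "at a within {r..r'} \<le> at a" by (intro at_le) auto
        ultimately show ?thesis by (rule filter_leD[rotated])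
      qed
    qed
  qed (use le in auto)
  then show ?thesis by simp
qed

text \<open>Right-continuity dictates the half-open window: \<open>X r\<close> already includes a
  bead at \<open>r\<close>, and \<open>X r'\<close> includes one at \<open>r'\<close>.\<close>

lemma hop_walk_beads:
  assumes X: "X \<in> bead_paths n l" and "r \<le> r'"
    and "sorted_wrt (\<lambda>p q. fst p < fst q) B" and "set B = {p \<in> beads n X. r < fst p \<and> fst p \<le> r'}"
  shows "hop_walk n (X r) (map snd B) (X r')"
  using assms(2-)
proof (induction B arbitrary: r)
  case Nil
  have "X r' = X r"
  proof (rule bead_path_const[OF X Nil(1)])
    fix t assume "r < t" "t \<le> r'"
    then have "\<not> (\<exists>h. (t, h) \<in> beads n X)" using Nil(3) by auto
    then show "left_lim X t = X t" using beads_iff_jump[OF X] by blast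
  qed
  then show ?case by simp
next
  case (Cons p B)
  obtain t h where p: "p = (t, h)" by (cases p)
  have "p \<in> {p \<in> beads n X. r < fst p \<and> fst p \<le> r'}" unfolding Cons.prems(3)[symmetric] by simp
  then have pX: "(t, h) \<in> beads n X" "r < t" "t \<le> r'" using p by auto
  have later: "t < fst q" if "q \<in> set B" for q using Cons.prems(2) that p by auto
  have const: "X x = X r" if x: "r \<le> x" "x < t" for x
  proof (rule bead_path_const[OF X x(1)])
    fix s assume s: "r < s" "s \<le> x"
    have "(s, k) \<notin> beads n X" for k
    proof
      assume "(s, k) \<in> beads n X"
      then have "(s, k) \<in> set (p # B)" using s x pX unfolding Cons.prems(3) by auto
      then show False using later[of "(s, k)"] s x p by auto
    qed
    then show "left_lim X s = X s" using beads_iff_jump[OF X] by blast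
  qed
  have "\<forall>\<^sub>F s in at_left t. X s = X r"
    unfolding eventually_at_left_field using pX(2) const by (metis less_imp_le)
  then have "left_lim X t = X r" by (rule left_lim_eqI)
  \<comment> \<open>No bead precedes \<open>t\<close> in the window, so the left limit at
    \<open>t\<close> is still the starting state.\<close>
  then have hop: "hop n (X r) h (X t)" using pX by (simp add: beads_def)
  have "set B = {p \<in> beads n X. t < fst p \<and> fst p \<le> r'}"
  proof (intro equalityI subsetI)
    fix q assume q: "q \<in> set B"
    then have "q \<in> {p \<in> beads n X. r < fst p \<and> fst p \<le> r'}" using Cons.prems(3) by auto
    then show "q \<in> {p \<in> beads n X. t < fst p \<and> fst p \<le> r'}" using later[OF q] by auto
  next
    fix q assume q: "q \<in> {p \<in> beads n X. t < fst p \<and> fst p \<le> r'}"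
    then have "q \<in> set (p # B)" using pX unfolding Cons.prems(3) by auto
    moreover have "q \<noteq> p" using q p by auto
    ultimately show "q \<in> set B" by simp
  qed
  then have "hop_walk n (X t) (map snd B) (X r')" using Cons.IH[of t] pX Cons.prems(2) by simp
  then show ?case using hop p by auto
qed

text \<open>An enumeration of the indices that sorts the tuple by time. Strictness makes
  \<open>p\<close> unique and expresses that no two times coincide.\<close>

definition time_order :: "nat \<Rightarrow> (nat \<Rightarrow> real) \<Rightarrow> nat list \<Rightarrow> bool" where
  "time_order m u p \<longleftrightarrow> distinct p \<and> set p = {..<m} \<and> sorted_wrt (\<lambda>i j. u i < u j) p"

lemma ex_time_order:
  assumes "inj_on u {..<m}"
  shows "\<exists>p. time_order m u p"
proof -
  define p where "p = sort_key u [0..<m]"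
  have "distinct (map u p)" using assms by (simp add: p_def distinct_map lessThan_atLeast0)
  moreover have "sorted (map u p)" by (simp add: p_def)
  ultimately have "sorted_wrt (<) (map u p)" by (simp add: strict_sorted_iff)
  then have "time_order m u p" by (simp add: time_order_def p_def sorted_wrt_map lessThan_atLeast0)
  then show ?thesis ..
qed

lemma time_order_inj: "time_order m u p \<Longrightarrow> inj_on u {..<m}"
proof -
  assume *: "time_order m u p"
  then have "sorted_wrt (<) (map u p)" by (simp add: time_order_def sorted_wrt_map)
  then have "distinct (map u p)" by (simp add: strict_sorted_iff)
  then show ?thesis using * by (simp add: time_order_def distinct_map)
qed

lemma time_order_length: "time_order m u p \<Longrightarrow> length p = m"
  by (metis card_lessThan distinct_card time_order_def)

lemma filter_split_sorted:
  assumes "sorted_wrt (\<lambda>i j. u i < u j) p" and "\<And>x y. P y \<Longrightarrow> x < y \<Longrightarrow> P x"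
  shows "filter (\<lambda>i. P (u i)) p @ filter (\<lambda>i. \<not> P (u i)) p = p"
  using assms(1)
proof (induction p)
  case (Cons x p)
  show ?case
  proof (cases "P (u x)")
    case False
    then have "\<forall>y\<in>set p. \<not> P (u y)" using Cons.prems assms(2) by auto
    then show ?thesis using False by (simp add: filter_empty_conv filter_id_conv)
  qed (use Cons in simp)
qed simp

text \<open>A total version of \<open>hop_walk\<close> that does not test whether the hops are
  permitted. A path can thus be written down from its beads before the hops are known to be
  legal.\<close>

definition hop_run :: "nat \<Rightarrow> nat set \<Rightarrow> nat list \<Rightarrow> nat set" where
  "hop_run n E hs = foldl (\<lambda>E h. insert (Suc h mod n) (E - {h})) E hs"

text \<open>A predicate on times, rather than an interval, covers bounded windows and half-lines
  with strict or weak ends alike.\<close>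

definition strings_at :: "(nat \<Rightarrow> real \<times> nat) \<Rightarrow> nat list \<Rightarrow> (real \<Rightarrow> bool) \<Rightarrow> nat list" where
  "strings_at c p P = map (snd \<circ> c) (filter (\<lambda>i. P (fst (c i))) p)"

lemma hop_walk_run: "hop_walk n E hs F \<Longrightarrow> hop_run n E hs = F"
  by (induction hs arbitrary: E) (auto simp: hop_run_def hop_def)

lemma strings_at_append:
  assumes "time_order m (fst \<circ> c) p" and "\<And>x y. P y \<Longrightarrow> x < y \<Longrightarrow> P x" and "\<And>x. P x \<Longrightarrow> Q x"
  shows "strings_at c p Q = strings_at c p P @ strings_at c p (\<lambda>x. Q x \<and> \<not> P x)"
proof -
  let ?q = "filter (\<lambda>i. Q ((fst \<circ> c) i)) p"
  have "sorted_wrt (\<lambda>i j. (fst \<circ> c) i < (fst \<circ> c) j) ?q"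
    using assms(1) by (intro sorted_wrt_filter) (simp add: time_order_def)
  then have "filter (\<lambda>i. P ((fst \<circ> c) i)) ?q @ filter (\<lambda>i. \<not> P ((fst \<circ> c) i)) ?q = ?q"
    using assms(2) by (rule filter_split_sorted)
  moreover have "filter (\<lambda>i. P ((fst \<circ> c) i)) ?q = filter (\<lambda>i. P (fst (c i))) p"
    unfolding filter_filter using assms(3) by (intro filter_cong) auto
  moreover have "filter (\<lambda>i. \<not> P ((fst \<circ> c) i)) ?q = filter (\<lambda>i. Q (fst (c i)) \<and> \<not> P (fst (c i))) p"
    unfolding filter_filter by (intro filter_cong) auto
  ultimately show ?thesis by (simp add: strings_at_def flip: map_append)
qed

lemma strings_at_cong:
  assumes "time_order m u p" "\<And>i. i < m \<Longrightarrow> P (fst (c i)) = Q (fst (c i))"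
  shows "strings_at c p P = strings_at c p Q"
proof -
  have "filter (\<lambda>i. P (fst (c i))) p = filter (\<lambda>i. Q (fst (c i))) p"
    using assms by (intro filter_cong) (auto simp: time_order_def)
  then show ?thesis by (simp add: strings_at_def)
qed

lemma strings_at_True:
  assumes "time_order m u p" "\<And>i. i < m \<Longrightarrow> P (fst (c i))"
  shows "strings_at c p P = map (snd \<circ> c) p"
proof -
  have "filter (\<lambda>i. P (fst (c i))) p = p"
    using assms by (intro filter_True) (auto simp: time_order_def)
  then show ?thesis by (simp add: strings_at_def)
qed

lemma eventually_times_left:
  fixes u :: "nat \<Rightarrow> real"
  shows "\<forall>\<^sub>F s in at_left \<tau>. \<forall>i\<in>{..<m}. (u i \<le> s) = (u i < \<tau>)"
proof (intro eventually_ball_finite ballI finite_lessThan)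
  fix i
  show "\<forall>\<^sub>F s in at_left \<tau>. (u i \<le> s) = (u i < \<tau>)"
  proof (cases "u i < \<tau>")
    case True
    then show ?thesis unfolding eventually_at_left_field by (intro exI[of _ "u i"]) auto
  next
    case False
    then show ?thesis unfolding eventually_at_left_field by (intro exI[of _ "\<tau> - 1"]) auto
  qed
qed

lemma eventually_times_right:
  fixes u :: "nat \<Rightarrow> real"
  shows "\<forall>\<^sub>F s in at_right \<tau>. \<forall>i\<in>{..<m}. (u i \<le> s) = (u i \<le> \<tau>)"
proof (intro eventually_ball_finite ballI finite_lessThan)
  fix i
  show "\<forall>\<^sub>F s in at_right \<tau>. (u i \<le> s) = (u i \<le> \<tau>)"
  proof (cases "u i \<le> \<tau>")
    case True
    then show ?thesis unfolding eventually_at_right_field by (intro exI[of _ "\<tau> + 1"]) auto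
  next
    case False
    then show ?thesis unfolding eventually_at_right_field by (intro exI[of _ "u i"]) auto
  qed
qed

section \<open>Beads of a path in a window, and replacing them\<close>

lemma finite_beads_in:
  assumes X: "X \<in> bead_paths n l"
  shows "finite (beads_in n a b X)"
proof (rule finite_imageD)
  show "inj_on fst (beads_in n a b X)"
  proof (rule inj_onI)
    fix x y assume *: "x \<in> beads_in n a b X" "y \<in> beads_in n a b X" "fst x = fst y"
    then have "hop n (left_lim X (fst x)) (snd x) (X (fst x))" "hop n (left_lim X (fst x)) (snd y) (X (fst x))"
      by (auto simp: beads_in_def beads_def)
    then show "x = y" using * hop_string_unique by (metis prod_eq_iff)
  qed
  have "fst ` beads_in n a b X \<subseteq> {t \<in> {a..b}. left_lim X t \<noteq> X t}"
    using beads_iff_jump[OF X] by (force simp: beads_in_def)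
  then show "finite (fst ` beads_in n a b X)" using bead_paths_D(3)[OF X] by (rule finite_subset)
qed

text \<open>From path to walk, with one order \<open>p\<close> for all subwindows. The last clause
  ends in the left limit at \<open>b\<close>, since the open window does not see a bead at
  \<open>b\<close>.\<close>

lemma config_walk:
  assumes Y: "Y \<in> bead_paths n l" and bs: "beads_in n a b Y = c ` {..<m}" and inj: "inj_on c {..<m}" and ab: "a < b"
  shows "\<forall>i<m. a < fst (c i) \<and> fst (c i) < b"
    and "\<exists>p. time_order m (fst \<circ> c) p \<and>
      (\<forall>r r'. a \<le> r \<longrightarrow> r \<le> r' \<longrightarrow> r' < b \<longrightarrow> hop_walk n (Y r) (strings_at c p (\<lambda>t. r < t \<and> t \<le> r')) (Y r')) \<and>
      (\<forall>r. a \<le> r \<longrightarrow> r < b \<longrightarrow> hop_walk n (Y r) (strings_at c p (\<lambda>t. r < t)) (left_lim Y b))"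
proof -
  have cb: "c i \<in> beads n Y" "a < fst (c i)" "fst (c i) < b" if "i < m" for i
  proof -
    have "c i \<in> beads_in n a b Y" using bs that by auto
    then show "c i \<in> beads n Y" "a < fst (c i)" "fst (c i) < b" by (auto simp: beads_in_def)
  qed
  then show times: "\<forall>i<m. a < fst (c i) \<and> fst (c i) < b" by simp
  have "inj_on (fst \<circ> c) {..<m}"
  proof (rule inj_onI)
    fix i j assume *: "i \<in> {..<m}" "j \<in> {..<m}" "(fst \<circ> c) i = (fst \<circ> c) j"
    then have "hop n (left_lim Y (fst (c i))) (snd (c i)) (Y (fst (c i)))" "hop n (left_lim Y (fst (c i))) (snd (c j)) (Y (fst (c i)))"
      using cb(1)[of i] cb(1)[of j] by (auto simp: beads_def)
    then have "snd (c i) = snd (c j)" by (rule hop_string_unique)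
    then have "c i = c j" using * by (simp add: prod_eq_iff)
    then show "i = j" using inj * by (auto dest: inj_onD)
  qed
  then obtain p where p: "time_order m (fst \<circ> c) p" using ex_time_order by blast
  have walk: "hop_walk n (Y r) (strings_at c p (\<lambda>t. r < t \<and> t \<le> r')) (Y r')" if r: "a \<le> r" "r \<le> r'" "r' < b" for r r'
  proof -
    let ?q = "filter (\<lambda>i. r < fst (c i) \<and> fst (c i) \<le> r') p"
    have "sorted_wrt (\<lambda>i j. (fst \<circ> c) i < (fst \<circ> c) j) ?q"
      using p by (intro sorted_wrt_filter) (simp add: time_order_def)
    then have 1: "sorted_wrt (\<lambda>x y. fst x < fst y) (map c ?q)" by (simp add: sorted_wrt_map)
    have 2: "set (map c ?q) = {x \<in> beads n Y. r < fst x \<and> fst x \<le> r'}"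
    proof (intro equalityI subsetI)
      fix x assume "x \<in> set (map c ?q)"
      then obtain i where "i \<in> set p" "x = c i" "r < fst (c i)" "fst (c i) \<le> r'" by auto
      moreover from this have "i < m" using p by (auto simp: time_order_def)
      ultimately show "x \<in> {x \<in> beads n Y. r < fst x \<and> fst x \<le> r'}" using cb(1) by simp
    next
      fix x assume x: "x \<in> {x \<in> beads n Y. r < fst x \<and> fst x \<le> r'}"
      have "snd x < n" using beads_string_less[OF Y, of "fst x" "snd x"] x by simp
      then have "x \<in> beads_in n a b Y" using x r by (cases x) (auto simp: beads_in_def)
      then obtain i where "i < m" "x = c i" using bs by auto
      moreover from this have "i \<in> set p" using p by (simp add: time_order_def)
      ultimately show "x \<in> set (map c ?q)" using x by simp
    qed
    have "hop_walk n (Y r) (map snd (map c ?q)) (Y r')"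
      by (rule hop_walk_beads[OF Y r(2) 1 2])
    then show ?thesis by (simp add: strings_at_def)
  qed
  moreover have "hop_walk n (Y r) (strings_at c p (\<lambda>t. r < t)) (left_lim Y b)" if r: "a \<le> r" "r < b" for r
  proof -
    have "\<forall>\<^sub>F s in at_left b. r < s \<and> s < b"
      unfolding eventually_at_left_field using r by (intro exI[of _ r]) auto
    then have "\<forall>\<^sub>F s in at_left b. Y s = left_lim Y b \<and> (\<forall>i\<in>{..<m}. (fst (c i) \<le> s) = (fst (c i) < b)) \<and> r < s \<and> s < b"
      using eventually_left_lim[OF Y, of b] eventually_times_left[of m "\<lambda>i. fst (c i)" b]
      by eventually_elim blast
    \<comment> \<open>A time past all beads of the window and close enough to \<open>b\<close> to
      show the left limit there.\<close>
    then obtain s where s: "Y s = left_lim Y b" "\<forall>i\<in>{..<m}. (fst (c i) \<le> s) = (fst (c i) < b)" "r < s" "s < b"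
      using eventually_happens'[OF trivial_limit_at_left_real] by blast
    have "strings_at c p (\<lambda>t. r < t) = strings_at c p (\<lambda>t. r < t \<and> t \<le> s)"
      using s(2) times by (intro strings_at_cong[OF p]) auto
    then show ?thesis using walk[of r s] r s by simp
  qed
  ultimately show "\<exists>p. time_order m (fst \<circ> c) p \<and>
      (\<forall>r r'. a \<le> r \<longrightarrow> r \<le> r' \<longrightarrow> r' < b \<longrightarrow> hop_walk n (Y r) (strings_at c p (\<lambda>t. r < t \<and> t \<le> r')) (Y r')) \<and>
      (\<forall>r. a \<le> r \<longrightarrow> r < b \<longrightarrow> hop_walk n (Y r) (strings_at c p (\<lambda>t. r < t)) (left_lim Y b))"
    using p by blast
qed

text \<open>From walk to path, the converse of \<open>config_walk\<close>: a walk from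
  \<open>X a\<close> to \<open>X b\<close> at distinct times replaces whatever \<open>X\<close> does
  in the window. As the walk ends in \<open>X b\<close>, no bead arises at the seam
  \<open>b\<close>. The last clause identifies the new path at every time of the window, as cylinder
  events require.\<close>

lemma splice:
  assumes X: "X \<in> bead_paths n l" and ab: "a < b" and nojump: "left_lim X b = X b"
    and p: "time_order m (fst \<circ> c) p" and times: "\<And>i. i < m \<Longrightarrow> a < fst (c i) \<and> fst (c i) < b"
    and walk: "hop_walk n (X a) (map (snd \<circ> c) p) (X b)"
  shows "\<exists>Y \<in> bead_paths n l. (\<forall>s. s \<notin> {a<..<b} \<longrightarrow> Y s = X s) \<and> beads_in n a b Y = c ` {..<m} \<and>
    (\<forall>s. a \<le> s \<longrightarrow> s < b \<longrightarrow> hop_walk n (X a) (strings_at c p (\<lambda>t. t \<le> s)) (Y s))"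
proof -
  \<comment> \<open>For the spliced path, \<open>Z (\<lambda>t. t \<le> s)\<close> is the value at
    \<open>s\<close> and \<open>Z (\<lambda>t. t < s)\<close> is the left limit.\<close>
  define Z where "Z P = hop_run n (X a) (strings_at c p P)" for P
  define Y where "Y s = (if a < s \<and> s < b then Z (\<lambda>t. t \<le> s) else X s)" for s
  have walkZ: "hop_walk n (X a) (strings_at c p P) (Z P)" if "\<And>x y. P y \<Longrightarrow> x < y \<Longrightarrow> P x" for P
  proof -
    have "hop_walk n (X a) (strings_at c p (\<lambda>_. True)) (X b)"
      using walk strings_at_True[OF p, of "\<lambda>_. True" c] by simp
    moreover have "strings_at c p (\<lambda>_. True) = strings_at c p P @ strings_at c p (\<lambda>x. True \<and> \<not> P x)"
      by (rule strings_at_append[OF p that]) auto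
    ultimately obtain G where G: "hop_walk n (X a) (strings_at c p P) G" by (auto simp: hop_walk_append)
    then show ?thesis using hop_walk_run[OF G] by (simp add: Z_def)
  qed
  have Yin: "Y s = Z (\<lambda>t. t \<le> s)" if "a \<le> s" "s < b" for s
  proof (cases "s = a")
    case True
    have "strings_at c p (\<lambda>t. t \<le> a) = strings_at c p (\<lambda>t. False)" using times by (intro strings_at_cong[OF p]) (simp add: not_le)
    then show ?thesis using True by (simp add: Y_def Z_def strings_at_def hop_run_def)
  qed (use that in \<open>simp add: Y_def\<close>)
  have Yout: "Y s = X s" if "s \<notin> {a<..<b}" for s using that by (auto simp: Y_def)
  have EL1: "\<forall>\<^sub>F s in at_left \<tau>. Y s = Z (\<lambda>t. t < \<tau>)" if \<tau>: "a < \<tau>" "\<tau> \<le> b" for \<tau>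
  proof -
    have "\<forall>\<^sub>F s in at_left \<tau>. a < s \<and> s < \<tau>"
      unfolding eventually_at_left_field using \<tau> by (intro exI[of _ a]) auto
    then show ?thesis using eventually_times_left[of m "\<lambda>i. fst (c i)" \<tau>]
    proof eventually_elim
      case (elim s)
      have "strings_at c p (\<lambda>t. t \<le> s) = strings_at c p (\<lambda>t. t < \<tau>)" using elim by (intro strings_at_cong[OF p]) auto
      then show ?case using Yin[of s] elim \<tau> by (simp add: Z_def)
    qed
  qed
  have EL2: "\<forall>\<^sub>F s in at_left \<tau>. Y s = left_lim X \<tau>" if \<tau>: "\<tau> \<le> a \<or> b < \<tau>" for \<tau>
  proof -
    have "\<forall>\<^sub>F s in at_left \<tau>. s \<notin> {a<..<b}"
    proof (cases "\<tau> \<le> a")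
      case True
      then show ?thesis unfolding eventually_at_left_field by (intro exI[of _ "\<tau> - 1"]) auto
    next
      case False
      then show ?thesis unfolding eventually_at_left_field using \<tau> by (intro exI[of _ b]) auto
    qed
    then show ?thesis using eventually_left_lim[OF X, of \<tau>]
    proof eventually_elim
      case (elim s)
      then show ?case using Yout by metis
    qed
  qed
  have L1: "left_lim Y \<tau> = Z (\<lambda>t. t < \<tau>)" if "a < \<tau>" "\<tau> \<le> b" for \<tau>
    using EL1[OF that] by (rule left_lim_eqI)
  have L2: "left_lim Y \<tau> = left_lim X \<tau>" if "\<tau> \<le> a \<or> b < \<tau>" for \<tau>
    using EL2[OF that] by (rule left_lim_eqI)
  have R: "\<forall>\<^sub>F s in at_right \<tau>. Y s = Y \<tau>" for \<tau>
  proof (cases "a \<le> \<tau> \<and> \<tau> < b")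
    case True
    have "\<forall>\<^sub>F s in at_right \<tau>. \<tau> < s \<and> s < b"
      unfolding eventually_at_right_field using True by (intro exI[of _ b]) auto
    then show ?thesis using eventually_times_right[of m "\<lambda>i. fst (c i)" \<tau>]
    proof eventually_elim
      case (elim s)
      have "strings_at c p (\<lambda>t. t \<le> s) = strings_at c p (\<lambda>t. t \<le> \<tau>)" using elim by (intro strings_at_cong[OF p]) auto
      then show ?case using Yin[of s] Yin[of \<tau>] elim True by (simp add: Z_def)
    qed
  next
    case False
    have "\<forall>\<^sub>F s in at_right \<tau>. s \<notin> {a<..<b}"
    proof (cases "b \<le> \<tau>")
      case True
      then show ?thesis unfolding eventually_at_right_field by (intro exI[of _ "\<tau> + 1"]) auto
    next
      case False
      then show ?thesis unfolding eventually_at_right_field using \<open>\<not> (a \<le> \<tau> \<and> \<tau> < b)\<close> by (intro exI[of _ a]) auto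
    qed
    then show ?thesis using bead_paths_D(2)[OF X, of \<tau>]
    proof eventually_elim
      case (elim s)
      have "\<tau> \<notin> {a<..<b}" using False by auto
      then show ?case using elim Yout by metis
    qed
  qed
  have Lb: "left_lim Y b = Y b"
  proof -
    have "Z (\<lambda>t. t < b) = X b"
      using hop_walk_run[OF walk] strings_at_True[OF p, of "\<lambda>t. t < b" c] times by (simp add: Z_def)
    then show ?thesis using L1[of b] ab Yout[of b] by simp
  qed
  have step: "hop n (Z (\<lambda>t. t < \<tau>)) (snd (c i)) (Z (\<lambda>t. t \<le> \<tau>))" if i: "i < m" "fst (c i) = \<tau>" for i \<tau>
  proof -
    have inj: "inj_on (fst \<circ> c) {..<m}" by (rule time_order_inj[OF p])
    let ?q = "filter (\<lambda>j. fst (c j) \<le> \<tau> \<and> \<not> fst (c j) < \<tau>) p"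
    have pm: "set p = {..<m}" "distinct p" using p by (auto simp: time_order_def)
    have setq: "set ?q = {i}"
    proof (intro equalityI subsetI)
      fix j assume "j \<in> set ?q"
      then have "j < m" "fst (c j) = fst (c i)" using pm i by auto
      then show "j \<in> {i}" using inj_onD[OF inj, of j i] i by simp
    next
      fix j assume "j \<in> {i}"
      then show "j \<in> set ?q" using pm i by simp
    qed
    have "distinct ?q" using pm by simp
    from distinct_card[OF this] have "length ?q = Suc 0" unfolding setq by simp
    then obtain y where "?q = [y]" by (auto simp: length_Suc_conv)
    with setq have "?q = [i]" by (metis list.simps(15) empty_set singleton_inject)
    then have q: "strings_at c p (\<lambda>t. t \<le> \<tau> \<and> \<not> t < \<tau>) = [snd (c i)]" by (simp add: strings_at_def)
    have "strings_at c p (\<lambda>t. t \<le> \<tau>) = strings_at c p (\<lambda>t. t < \<tau>) @ [snd (c i)]"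
      unfolding q[symmetric] by (rule strings_at_append[OF p]) auto
    moreover have "hop_walk n (X a) (strings_at c p (\<lambda>t. t \<le> \<tau>)) (Z (\<lambda>t. t \<le> \<tau>))" by (rule walkZ) auto
    ultimately obtain G where G: "hop_walk n (X a) (strings_at c p (\<lambda>t. t < \<tau>)) G" "hop n G (snd (c i)) (Z (\<lambda>t. t \<le> \<tau>))"
      by (auto simp: hop_walk_append)
    then show ?thesis using hop_walk_run[OF G(1)] by (simp add: Z_def)
  qed
  have no_step: "left_lim Y \<tau> = Y \<tau>" if \<tau>: "a < \<tau>" "\<tau> < b" "\<And>i. i < m \<Longrightarrow> fst (c i) \<noteq> \<tau>" for \<tau>
  proof -
    have "strings_at c p (\<lambda>t. t < \<tau>) = strings_at c p (\<lambda>t. t \<le> \<tau>)"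
      using \<tau>(3) by (intro strings_at_cong[OF p]) (auto simp: less_le)
    then show ?thesis using L1[of \<tau>] Yin[of \<tau>] \<tau> by (simp add: Z_def)
  qed
  have step': "hop n (left_lim Y (fst (c i))) (snd (c i)) (Y (fst (c i)))" if "i < m" for i
    using step[OF that refl] L1[of "fst (c i)"] Yin[of "fst (c i)"] times[OF that] by simp
  have Yocc: "Y t \<in> occupied_sets n l" for t
  proof (cases "a < t \<and> t < b")
    case True
    have "hop_walk n (X a) (strings_at c p (\<lambda>x. x \<le> t)) (Z (\<lambda>x. x \<le> t))" by (rule walkZ) auto
    then have "Z (\<lambda>x. x \<le> t) \<in> occupied_sets n l" using hop_walk_occupied bead_paths_D(1)[OF X] by blast
    then show ?thesis using True by (simp add: Y_def)
  next
    case False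
    then have "Y t = X t" by (auto simp: Y_def)
    then show ?thesis using bead_paths_D(1)[OF X] by simp
  qed
  have jump: "(\<exists>i<m. t = fst (c i)) \<or> (left_lim Y t = left_lim X t \<and> Y t = X t)" if "left_lim Y t \<noteq> Y t" for t
  proof -
    consider "t \<le> a \<or> b < t" | "t = b" | "a < t" "t < b" by linarith
    then show ?thesis
    proof cases
      case 1
      then have "Y t = X t" by (intro Yout) auto
      then show ?thesis using L2[OF 1] by simp
    next
      case 2
      then show ?thesis using Lb that by simp
    next
      case 3
      then show ?thesis using no_step[of t] that by blast
    qed
  qed
  have Ybp: "Y \<in> bead_paths n l"
    unfolding bead_paths_def
  proof (intro CollectI conjI allI impI Yocc R)
    fix t
    consider "t \<le> a \<or> b < t" | "a < t" "t \<le> b" by linarith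
    then show "\<exists>E. \<forall>\<^sub>F s in at_left t. Y s = E" using EL1[of t] EL2[of t] by cases blast+
  next
    fix A B
    have "{t \<in> {A..B}. left_lim Y t \<noteq> Y t} \<subseteq> (\<lambda>i. fst (c i)) ` {..<m} \<union> {t \<in> {A..B}. left_lim X t \<noteq> X t}"
    proof
      fix t assume "t \<in> {t \<in> {A..B}. left_lim Y t \<noteq> Y t}"
      then show "t \<in> (\<lambda>i. fst (c i)) ` {..<m} \<union> {t \<in> {A..B}. left_lim X t \<noteq> X t}" using jump[of t] by auto
    qed
    then show "finite {t \<in> {A..B}. left_lim Y t \<noteq> Y t}"
      by (rule finite_subset) (use bead_paths_D(3)[OF X] in simp)
  next
    fix t assume t: "left_lim Y t \<noteq> Y t"
    from jump[OF t] show "\<exists>h. hop n (left_lim Y t) h (Y t)"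
    proof
      assume "\<exists>i<m. t = fst (c i)"
      then show ?thesis using step' by blast
    next
      assume "left_lim Y t = left_lim X t \<and> Y t = X t"
      then show ?thesis using bead_paths_D(4)[OF X, of t] t by simp
    qed
  qed
  have Ybeads: "beads_in n a b Y = c ` {..<m}"
  proof (intro equalityI subsetI)
    fix x assume x: "x \<in> beads_in n a b Y"
    obtain t h where th: "x = (t, h)" by (cases x)
    have h: "hop n (left_lim Y t) h (Y t)" "a < t" "t < b" using x th by (auto simp: beads_in_def beads_def)
    then obtain i where i: "i < m" "fst (c i) = t" using no_step[of t] hop_neq by metis
    have "h = snd (c i)" using hop_string_unique[OF h(1)] step'[OF i(1)] i(2) by simp
    then have "x = c i" using th i(2) by (simp add: prod_eq_iff)
    then show "x \<in> c ` {..<m}" using i by blast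
  next
    fix x assume "x \<in> c ` {..<m}"
    then obtain i where i: "i < m" "x = c i" by auto
    have "left_lim Y (fst (c i)) \<in> occupied_sets n l"
      using Ybp by (rule bead_paths_D(5))
    then have "snd (c i) < n" using hop_occupied(2)[OF step'[OF i(1)]] by blast
    then show "x \<in> beads_in n a b Y" using step'[OF i(1)] times[OF i(1)] i(2)
      by (cases "c i") (simp add: beads_in_def beads_def)
  qed
  have Ywalk: "hop_walk n (X a) (strings_at c p (\<lambda>t. t \<le> s)) (Y s)" if "a \<le> s" "s < b" for s
    unfolding Yin[OF that] by (rule walkZ) auto
  show ?thesis
    using Yout Ybeads Ywalk by (intro bexI[of _ Y] Ybp conjI allI impI) simp_all
qed

text \<open>Each bead in the window advances the phase by one. This is what detects a surplus bead
  at the end of a window.\<close>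

lemma bead_path_phase:
  assumes X: "X \<in> bead_paths n l" and ab: "a < b"
  shows "phase n (left_lim X b) = (phase n (X a) + card (beads_in n a b X)) mod n"
proof -
  obtain c where c: "bij_betw c {0..<card (beads_in n a b X)} (beads_in n a b X)"
    using ex_bij_betw_nat_finite[OF finite_beads_in[OF X]] by blast
  let ?m = "card (beads_in n a b X)"
  have "beads_in n a b X = c ` {..<?m}" "inj_on c {..<?m}"
    using c by (simp_all add: bij_betw_def lessThan_atLeast0)
  from config_walk[OF X this ab] obtain p where p: "time_order ?m (fst \<circ> c) p"
      "\<And>r. a \<le> r \<Longrightarrow> r < b \<Longrightarrow> hop_walk n (X r) (strings_at c p (\<lambda>t. r < t)) (left_lim X b)"
    and t: "\<forall>i<?m. a < fst (c i) \<and> fst (c i) < b" by blast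
  have "strings_at c p (\<lambda>t. a < t) = map (snd \<circ> c) p" using t by (intro strings_at_True[OF p(1)]) simp
  then have "length (strings_at c p (\<lambda>t. a < t)) = ?m" using time_order_length[OF p(1)] by simp
  then show ?thesis using hop_walk_phase[OF p(2)[of a] bead_paths_D(1)[OF X]] ab by simp
qed

text \<open>The conditioning prescribes \<open>Y b\<close> and the number of beads in the open
  interval, but not the left limit at \<open>b\<close>. A bead of \<open>Y\<close> at
  \<open>b\<close> would come on top of the counted ones and shift the phase once more, against
  equal counts and equal boundary states.\<close>

lemma configs_end:
  assumes X: "X \<in> bead_paths n l" and Y: "Y \<in> bead_paths n l" and ab: "a < b" and n: "2 \<le> n"
    and nojump: "left_lim X b = X b"
    and m: "card (beads_in n a b Y) = card (beads_in n a b X)"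
    and out: "\<And>s. s \<notin> {a<..<b} \<Longrightarrow> Y s = X s"
  shows "left_lim Y b = X b"
proof (rule ccontr)
  assume "left_lim Y b \<noteq> X b"
  then have "left_lim Y b \<noteq> Y b" using out[of b] by simp
  then obtain h where h: "hop n (left_lim Y b) h (Y b)" using bead_paths_D(4)[OF Y] by blast
  have "finite (left_lim Y b)"
    using bead_paths_D(5)[OF Y, of b] by (auto simp: occupied_sets_def intro: finite_subset)
  then have "phase n (Y b) = Suc (phase n (left_lim Y b)) mod n" by (rule hop_phase[OF h])
  moreover have "phase n (left_lim Y b) = phase n (Y b)"
    using bead_path_phase[OF X ab] bead_path_phase[OF Y ab] m nojump out[of a] out[of b] by simp
  ultimately show False using Suc_mod_self_neq[OF n, of "phase n (Y b)"] by simp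
qed

text \<open>The existential over paths is traded for a walk condition on the time-ordered strings,
  which separates the times from the strings.\<close>

lemma configs_UNIV_eq:
  assumes X: "X \<in> bead_paths n l" and ab: "a < b" and n: "2 \<le> n" and nojump: "left_lim X b = X b"
    and m: "m = card (beads_in n a b X)"
  shows "configs n l a b X m UNIV = {c \<in> space (tuple_measure n m). (\<forall>i<m. a < fst (c i) \<and> fst (c i) < b) \<and>
    (\<exists>p. time_order m (fst \<circ> c) p \<and> hop_walk n (X a) (map (snd \<circ> c) p) (X b))}" (is "?L = ?R")
proof (intro equalityI subsetI)
  fix c assume c: "c \<in> ?L"
  then obtain Y where Y: "Y \<in> bead_paths n l" "\<And>s. s \<notin> {a<..<b} \<Longrightarrow> Y s = X s" "beads_in n a b Y = c ` {..<m}"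
    and inj: "inj_on c {..<m}" by (auto simp: configs_def)
  have t: "\<forall>i<m. a < fst (c i) \<and> fst (c i) < b" by (rule config_walk(1)[OF Y(1,3) inj ab])
  from config_walk(2)[OF Y(1,3) inj ab] obtain p where p: "time_order m (fst \<circ> c) p"
      "\<And>r. a \<le> r \<Longrightarrow> r < b \<Longrightarrow> hop_walk n (Y r) (strings_at c p (\<lambda>t. r < t)) (left_lim Y b)" by blast
  have "left_lim Y b = X b"
    using configs_end[OF X Y(1) ab n nojump _ Y(2)] Y(3) inj m by (simp add: card_image)
  moreover have "strings_at c p (\<lambda>t. a < t) = map (snd \<circ> c) p" using t by (intro strings_at_True[OF p(1)]) simp
  ultimately have "hop_walk n (X a) (map (snd \<circ> c) p) (X b)" using p(2)[of a] ab Y(2)[of a] by simp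
  then show "c \<in> ?R" using c t p(1) by (auto simp: configs_def)
next
  fix c assume c: "c \<in> ?R"
  then obtain p where p: "time_order m (fst \<circ> c) p" "hop_walk n (X a) (map (snd \<circ> c) p) (X b)"
    and t: "\<And>i. i < m \<Longrightarrow> a < fst (c i) \<and> fst (c i) < b" by blast
  from splice[OF X ab nojump p(1) t p(2)]
  obtain Y where Y: "Y \<in> bead_paths n l" "\<forall>s. s \<notin> {a<..<b} \<longrightarrow> Y s = X s" "beads_in n a b Y = c ` {..<m}"
    by blast
  have "inj_on c {..<m}" using time_order_inj[OF p(1)] by (rule inj_on_imageI2)
  then show "c \<in> ?L" using c Y by (auto simp: configs_def)
qed

text \<open>The cuts assign a bead at time \<open>s\<close> to the first piece and one at time
  \<open>t\<close> to the second, as right-continuity demands.\<close>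

lemma configs_cyl_eq:
  assumes X: "X \<in> bead_paths n l" and ab: "a < b" and n: "2 \<le> n" and nojump: "left_lim X b = X b"
    and m: "m = card (beads_in n a b X)" and st: "a \<le> s" "s \<le> t" "t < b"
  shows "configs n l a b X m {Y \<in> bead_paths n l. Y s = G \<and> Y t = H}
    = {c \<in> space (tuple_measure n m). (\<forall>i<m. a < fst (c i) \<and> fst (c i) < b) \<and>
    (\<exists>p. time_order m (fst \<circ> c) p \<and> hop_walk n (X a) (strings_at c p (\<lambda>x. x \<le> s)) G
      \<and> hop_walk n G (strings_at c p (\<lambda>x. s < x \<and> x \<le> t)) H \<and> hop_walk n H (strings_at c p (\<lambda>x. t < x)) (X b))}" (is "?L = ?R")
proof (intro equalityI subsetI)
  fix c assume c: "c \<in> ?L"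
  then obtain Y where Y: "Y \<in> bead_paths n l" "\<And>s. s \<notin> {a<..<b} \<Longrightarrow> Y s = X s" "beads_in n a b Y = c ` {..<m}"
    and YG: "Y s = G" "Y t = H" and inj: "inj_on c {..<m}" by (auto simp: configs_def)
  have times: "\<forall>i<m. a < fst (c i) \<and> fst (c i) < b" by (rule config_walk(1)[OF Y(1,3) inj ab])
  from config_walk(2)[OF Y(1,3) inj ab] obtain p where p: "time_order m (fst \<circ> c) p"
      "\<And>r r'. a \<le> r \<Longrightarrow> r \<le> r' \<Longrightarrow> r' < b \<Longrightarrow> hop_walk n (Y r) (strings_at c p (\<lambda>t. r < t \<and> t \<le> r')) (Y r')"
      "\<And>r. a \<le> r \<Longrightarrow> r < b \<Longrightarrow> hop_walk n (Y r) (strings_at c p (\<lambda>t. r < t)) (left_lim Y b)" by blast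
  have e: "left_lim Y b = X b"
    using configs_end[OF X Y(1) ab n nojump _ Y(2)] Y(3) inj m by (simp add: card_image)
  have "strings_at c p (\<lambda>x. a < x \<and> x \<le> s) = strings_at c p (\<lambda>x. x \<le> s)"
    using times by (intro strings_at_cong[OF p(1)]) simp
  then have w1: "hop_walk n (X a) (strings_at c p (\<lambda>x. x \<le> s)) G"
    using p(2)[of a s] st Y(2)[of a] YG by simp
  have w2: "hop_walk n G (strings_at c p (\<lambda>x. s < x \<and> x \<le> t)) H" using p(2)[of s t] st YG by simp
  have w3: "hop_walk n H (strings_at c p (\<lambda>x. t < x)) (X b)" using p(3)[of t] st YG e by simp
  show "c \<in> ?R" using c times p(1) w1 w2 w3 by (auto simp: configs_def)
next
  fix c assume c: "c \<in> ?R"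
  then obtain p where p: "time_order m (fst \<circ> c) p" "hop_walk n (X a) (strings_at c p (\<lambda>x. x \<le> s)) G"
      "hop_walk n G (strings_at c p (\<lambda>x. s < x \<and> x \<le> t)) H" "hop_walk n H (strings_at c p (\<lambda>x. t < x)) (X b)"
    and times: "\<And>i. i < m \<Longrightarrow> a < fst (c i) \<and> fst (c i) < b" by blast
  have "strings_at c p (\<lambda>x. x \<le> t) = strings_at c p (\<lambda>x. x \<le> s) @ strings_at c p (\<lambda>x. x \<le> t \<and> \<not> x \<le> s)"
    using st by (intro strings_at_append[OF p(1)]) auto
  also have "strings_at c p (\<lambda>x. x \<le> t \<and> \<not> x \<le> s) = strings_at c p (\<lambda>x. s < x \<and> x \<le> t)"
    by (intro strings_at_cong[OF p(1)]) auto
  finally have st1: "strings_at c p (\<lambda>x. x \<le> t) = strings_at c p (\<lambda>x. x \<le> s) @ strings_at c p (\<lambda>x. s < x \<and> x \<le> t)" .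
  then have wt: "hop_walk n (X a) (strings_at c p (\<lambda>x. x \<le> t)) H" using p(2,3) by (auto simp: hop_walk_append)
  have "strings_at c p (\<lambda>x. True) = strings_at c p (\<lambda>x. x \<le> t) @ strings_at c p (\<lambda>x. True \<and> \<not> x \<le> t)"
    by (intro strings_at_append[OF p(1)]) auto
  also have "strings_at c p (\<lambda>x. True \<and> \<not> x \<le> t) = strings_at c p (\<lambda>x. t < x)"
    by (intro strings_at_cong[OF p(1)]) auto
  finally have "map (snd \<circ> c) p = strings_at c p (\<lambda>x. x \<le> t) @ strings_at c p (\<lambda>x. t < x)"
    using strings_at_True[OF p(1), of "\<lambda>_. True" c] by simp
  then have w: "hop_walk n (X a) (map (snd \<circ> c) p) (X b)" using wt p(4) by (auto simp: hop_walk_append)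
  from splice[OF X ab nojump p(1) times w]
  obtain Y where Y: "Y \<in> bead_paths n l" "\<forall>s. s \<notin> {a<..<b} \<longrightarrow> Y s = X s" "beads_in n a b Y = c ` {..<m}"
    "\<forall>s. a \<le> s \<longrightarrow> s < b \<longrightarrow> hop_walk n (X a) (strings_at c p (\<lambda>t. t \<le> s)) (Y s)"
    by blast
  have "Y s = G" using hop_walk_det[OF Y(4)[rule_format, of s] p(2)] st by simp
  moreover have "Y t = H" using hop_walk_det[OF Y(4)[rule_format, of t] wt] st by simp
  moreover have "inj_on c {..<m}" using time_order_inj[OF p(1)] by (rule inj_on_imageI2)
  ultimately show "c \<in> ?L" using c Y by (auto simp: configs_def)
qed

section \<open>Volumes of sets of tuples\<close>

abbreviation lebesgue_tuples :: "nat \<Rightarrow> (nat \<Rightarrow> real) measure" where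
  "lebesgue_tuples m \<equiv> PiM {..<m} (\<lambda>_. lborel)"

interpretation lborel_product: product_sigma_finite "\<lambda>_::nat. lborel :: real measure"
  by standard

text \<open>The restriction makes the value an extensional function, as the points of
  \<open>lebesgue_tuples m\<close> are.\<close>

definition bead_times :: "nat \<Rightarrow> (nat \<Rightarrow> real \<times> nat) \<Rightarrow> nat \<Rightarrow> real" where
  "bead_times m c = (\<lambda>i\<in>{..<m}. fst (c i))"

lemma tuple_component_measurable:
  "i < m \<Longrightarrow> (\<lambda>c. c i) \<in> measurable (tuple_measure n m) (lborel \<Otimes>\<^sub>M count_space {..<n})"
  unfolding tuple_measure_def by (rule measurable_component_singleton) simp

lemma bead_times_measurable: "bead_times m \<in> measurable (tuple_measure n m) (lebesgue_tuples m)"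
  unfolding bead_times_def
proof (rule measurable_restrict)
  fix i assume "i \<in> {..<m}"
  then have "(\<lambda>c. c i) \<in> measurable (tuple_measure n m) (lborel \<Otimes>\<^sub>M count_space {..<n})"
    by (intro tuple_component_measurable) simp
  then show "(\<lambda>c. fst (c i)) \<in> measurable (tuple_measure n m) lborel"
    by (rule measurable_fst')
qed

lemma strings_measurable:
  "{c \<in> space (tuple_measure n m). \<forall>i<m. snd (c i) = \<eta> i} \<in> sets (tuple_measure n m)"
proof -
  have "{c \<in> space (tuple_measure n m). snd (c i) = \<eta> i} \<in> sets (tuple_measure n m)" if "i < m" for i
  proof -
    have "(\<lambda>c. snd (c i)) \<in> measurable (tuple_measure n m) (count_space {..<n})"
      using tuple_component_measurable[OF that] by (rule measurable_snd')
    then have "(\<lambda>c. snd (c i)) -` ({\<eta> i} \<inter> {..<n}) \<inter> space (tuple_measure n m) \<in> sets (tuple_measure n m)"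
      by (rule measurable_sets) auto
    moreover have "(\<lambda>c. snd (c i)) -` ({\<eta> i} \<inter> {..<n}) \<inter> space (tuple_measure n m)
        = {c \<in> space (tuple_measure n m). snd (c i) = \<eta> i}"
    proof -
      have "snd (c i) < n" if "c \<in> space (tuple_measure n m)" for c
        using measurable_space[OF tuple_component_measurable[OF \<open>i < m\<close>] that]
        by (simp add: space_pair_measure mem_Times_iff)
      then show ?thesis by auto
    qed
    ultimately show ?thesis by simp
  qed
  note component = this
  have "{c \<in> space (tuple_measure n m). \<forall>i\<in>{..<m}. snd (c i) = \<eta> i} \<in> sets (tuple_measure n m)"
  proof (rule sets.sets_Collect_finite_All)
    fix i assume "i \<in> {..<m}"
    then have "i < m" by simp
    then show "{c \<in> space (tuple_measure n m). snd (c i) = \<eta> i} \<in> sets (tuple_measure n m)" by (rule component)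
  qed (rule finite_lessThan)
  moreover have "{c \<in> space (tuple_measure n m). \<forall>i\<in>{..<m}. snd (c i) = \<eta> i}
      = {c \<in> space (tuple_measure n m). \<forall>i<m. snd (c i) = \<eta> i}" by auto
  ultimately show ?thesis by (simp only:)
qed

text \<open>Strings carry counting measure, so fixing all of them leaves a copy of Lebesgue measure
  on the times. The pushforward \<open>\<nu>\<close> of the slice is identified by its values on
  boxes.\<close>

lemma emeasure_string_slice:
  assumes \<eta>: "\<And>i. i < m \<Longrightarrow> \<eta> i < n" and B: "B \<in> sets (lebesgue_tuples m)"
  shows "emeasure (tuple_measure n m) {c \<in> space (tuple_measure n m). bead_times m c \<in> B \<and> (\<forall>i<m. snd (c i) = \<eta> i)}
    = emeasure (lebesgue_tuples m) B"
proof -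
  interpret cs: sigma_finite_measure "count_space {..<n}"
    by (rule sigma_finite_measure_count_space_finite) simp
  interpret pr: pair_sigma_finite "lborel :: real measure" "count_space {..<n}" ..
  interpret tp: product_sigma_finite "\<lambda>_::nat. (lborel :: real measure) \<Otimes>\<^sub>M count_space {..<n}"
    by standard
  let ?T = "tuple_measure n m"
  define N where "N = {c \<in> space ?T. \<forall>i<m. snd (c i) = \<eta> i}"
  have N: "N \<in> sets ?T" unfolding N_def by (rule strings_measurable)
  define \<nu> where "\<nu> = distr (density ?T (indicator N)) (lebesgue_tuples m) (bead_times m)"
  have emn: "emeasure \<nu> A = emeasure ?T (N \<inter> (bead_times m -` A \<inter> space ?T))" if A: "A \<in> sets (lebesgue_tuples m)" for A
  proof -
    have pre: "bead_times m -` A \<inter> space ?T \<in> sets ?T" by (rule measurable_sets[OF bead_times_measurable A])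
    have "emeasure \<nu> A = emeasure (density ?T (indicator N)) (bead_times m -` A \<inter> space ?T)"
      unfolding \<nu>_def using bead_times_measurable A by (subst emeasure_distr) simp_all
    also have "\<dots> = (\<integral>\<^sup>+ c. indicator N c * indicator (bead_times m -` A \<inter> space ?T) c \<partial>?T)"
      using N pre by (intro emeasure_density) auto
    also have "\<dots> = (\<integral>\<^sup>+ c. indicator (N \<inter> (bead_times m -` A \<inter> space ?T)) c \<partial>?T)"
      by (simp add: indicator_inter_arith)
    also have "\<dots> = emeasure ?T (N \<inter> (bead_times m -` A \<inter> space ?T))"
      using N pre by (intro nn_integral_indicator) auto
    finally show ?thesis .
  qed
  have "\<nu> = lebesgue_tuples m"
  proof (rule lborel_product.PiM_eqI)
    show "sets \<nu> = sets (lebesgue_tuples m)" by (simp add: \<nu>_def)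
    fix A :: "nat \<Rightarrow> real set" assume A: "\<And>i. i \<in> {..<m} \<Longrightarrow> A i \<in> sets lborel"
    have box: "N \<inter> (bead_times m -` (PiE {..<m} A) \<inter> space ?T) = PiE {..<m} (\<lambda>i. A i \<times> {\<eta> i})"
    proof (intro equalityI subsetI)
      fix c assume c: "c \<in> N \<inter> (bead_times m -` (PiE {..<m} A) \<inter> space ?T)"
      show "c \<in> PiE {..<m} (\<lambda>i. A i \<times> {\<eta> i})"
      proof (rule PiE_I)
        fix i assume i: "i \<in> {..<m}"
        have "bead_times m c i \<in> A i" using c i by (metis IntD1 IntD2 PiE_mem vimageD)
        then have "fst (c i) \<in> A i" using i by (simp add: bead_times_def)
        moreover have "snd (c i) = \<eta> i" using c i by (simp add: N_def)
        ultimately show "c i \<in> A i \<times> {\<eta> i}" by (cases "c i") simp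
      next
        fix i assume "i \<notin> {..<m}"
        moreover have "c \<in> PiE {..<m} (\<lambda>_. space (lborel \<Otimes>\<^sub>M count_space {..<n}))"
          using c by (simp add: tuple_measure_def space_PiM)
        ultimately show "c i = undefined" by (rule PiE_arb[rotated])
      qed
    next
      fix c assume c: "c \<in> PiE {..<m} (\<lambda>i. A i \<times> {\<eta> i})"
      have ci: "fst (c i) \<in> A i" "snd (c i) = \<eta> i" if "i < m" for i
        using PiE_mem[OF c, of i] that by auto
      have "c \<in> space ?T" unfolding tuple_measure_def space_PiM
      proof (rule PiE_I)
        fix i assume "i \<in> {..<m}"
        then show "c i \<in> space (lborel \<Otimes>\<^sub>M count_space {..<n})"
          using ci[of i] \<eta>[of i] by (simp add: space_pair_measure mem_Times_iff)
      qed (use PiE_arb[OF c] in blast)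
      moreover have "bead_times m c \<in> PiE {..<m} A" using ci(1) by (simp add: bead_times_def)
      ultimately show "c \<in> N \<inter> (bead_times m -` (PiE {..<m} A) \<inter> space ?T)" using ci(2) by (simp add: N_def)
    qed
    have "emeasure \<nu> (PiE {..<m} A) = emeasure ?T (PiE {..<m} (\<lambda>i. A i \<times> {\<eta> i}))"
      using A by (subst emn) (simp_all add: box sets_PiM_I_finite)
    also have "\<dots> = (\<Prod>i<m. emeasure (lborel \<Otimes>\<^sub>M count_space {..<n}) (A i \<times> {\<eta> i}))"
      unfolding tuple_measure_def using A \<eta> by (intro tp.emeasure_PiM) auto
    also have "\<dots> = (\<Prod>i<m. emeasure lborel (A i))"
      using A \<eta> by (intro prod.cong refl) (simp add: cs.emeasure_pair_measure_Times)
    finally show "emeasure \<nu> (PiE {..<m} A) = (\<Prod>i\<in>{..<m}. emeasure lborel (A i))" .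
  qed simp
  then have "emeasure (lebesgue_tuples m) B = emeasure ?T (N \<inter> (bead_times m -` B \<inter> space ?T))"
    using emn[OF B] by simp
  also have "N \<inter> (bead_times m -` B \<inter> space ?T) = {c \<in> space ?T. bead_times m c \<in> B \<and> (\<forall>i<m. snd (c i) = \<eta> i)}"
    by (auto simp: N_def)
  finally show ?thesis ..
qed

lemma component_measurable:
  assumes "i < m"
  shows "(\<lambda>u. u i) \<in> borel_measurable (lebesgue_tuples m)"
proof -
  have "(\<lambda>u. u i) \<in> measurable (lebesgue_tuples m) (lborel :: real measure)"
    by (rule measurable_component_singleton) (use assms in simp)
  then show ?thesis by simp
qed

lemma time_order_measurable:
  assumes "distinct p" "set p = {..<m}"
  shows "{u \<in> space (lebesgue_tuples m). time_order m u p} \<in> sets (lebesgue_tuples m)"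
proof -
  have lp: "length p = m" using assms by (metis card_lessThan distinct_card)
  have pm: "p ! i < m" if "i < m" for i
    using nth_mem[of i p] that unfolding lp assms(2) by simp
  have meas: "{u \<in> space (lebesgue_tuples m). \<forall>i\<in>{..<m}. \<forall>j\<in>{..<m}. i < j \<longrightarrow> u (p ! i) < u (p ! j)} \<in> sets (lebesgue_tuples m)"
  proof (rule sets.sets_Collect_finite_All[OF _ finite_lessThan], rule sets.sets_Collect_finite_All[OF _ finite_lessThan])
    fix i j assume ij: "i \<in> {..<m}" "j \<in> {..<m}"
    have "(\<lambda>u. u (p ! i)) \<in> borel_measurable (lebesgue_tuples m)" "(\<lambda>u. u (p ! j)) \<in> borel_measurable (lebesgue_tuples m)"
      using pm ij by (simp_all add: component_measurable)
    then have "{u \<in> space (lebesgue_tuples m). u (p ! i) < u (p ! j)} \<in> sets (lebesgue_tuples m)"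
      by (rule borel_measurable_less)
    then show "{u \<in> space (lebesgue_tuples m). i < j \<longrightarrow> u (p ! i) < u (p ! j)} \<in> sets (lebesgue_tuples m)"
      by (cases "i < j") auto
  qed
  have "time_order m u p \<longleftrightarrow> (\<forall>i\<in>{..<m}. \<forall>j\<in>{..<m}. i < j \<longrightarrow> u (p ! i) < u (p ! j))" for u
  proof -
    have "time_order m u p \<longleftrightarrow> (\<forall>i j. i < j \<longrightarrow> j < m \<longrightarrow> u (p ! i) < u (p ! j))"
      using assms lp by (simp add: time_order_def sorted_wrt_iff_nth_less)
    also have "\<dots> \<longleftrightarrow> (\<forall>i\<in>{..<m}. \<forall>j\<in>{..<m}. i < j \<longrightarrow> u (p ! i) < u (p ! j))"
    proof (intro iffI ballI allI impI)
      fix i j assume *: "\<forall>i\<in>{..<m}. \<forall>j\<in>{..<m}. i < j \<longrightarrow> u (p ! i) < u (p ! j)" "i < j" "j < m"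
      from *(2,3) have i: "i \<in> {..<m}" and j: "j \<in> {..<m}" by simp_all
      show "u (p ! i) < u (p ! j)" by (rule *(1)[rule_format, OF i j *(2)])
    qed simp
    finally show ?thesis .
  qed
  then have "{u \<in> space (lebesgue_tuples m). time_order m u p} = {u \<in> space (lebesgue_tuples m). \<forall>i\<in>{..<m}. \<forall>j\<in>{..<m}. i < j \<longrightarrow> u (p ! i) < u (p ! j)}"
    by (rule Collect_cong[OF conj_cong[OF refl]])
  with meas show ?thesis by (simp only:)
qed

lemma time_order_unique:
  assumes "time_order m u p" "time_order m u q"
  shows "p = q"
proof -
  have inj: "inj_on u (set p \<union> set q)" using time_order_inj[OF assms(1)] assms by (simp add: time_order_def)
  have "map u p = map u q"
    by (rule strict_sorted_equal) (use assms in \<open>auto simp: time_order_def sorted_wrt_map\<close>)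
  then show ?thesis using inj by (simp add: inj_on_map_eq_map)
qed

text \<open>Fubini with the coordinate \<open>i\<close> innermost: each fibre is contained in the
  single point \<open>x j\<close>.\<close>

lemma null_coincidence:
  assumes "i < m" "j < m" "i \<noteq> j"
  shows "{u \<in> space (lebesgue_tuples m). u i = u j} \<in> null_sets (lebesgue_tuples m)"
proof -
  let ?A = "{u \<in> space (lebesgue_tuples m). u i = u j}"
  define I where "I = {..<m} - {i}"
  have I: "finite I" "i \<notin> I" "insert i I = {..<m}" "j \<in> I" using assms by (auto simp: I_def)
  have "(\<lambda>u. u i) \<in> borel_measurable (lebesgue_tuples m)" "(\<lambda>u. u j) \<in> borel_measurable (lebesgue_tuples m)"
    using assms by (simp_all add: component_measurable)
  then have A: "?A \<in> sets (lebesgue_tuples m)" by (rule borel_measurable_eq)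
  have "emeasure (lebesgue_tuples m) ?A = (\<integral>\<^sup>+ u. indicator ?A u \<partial>PiM (insert i I) (\<lambda>_. lborel))"
    using A I(3) by simp
  also have "\<dots> = (\<integral>\<^sup>+ x. (\<integral>\<^sup>+ y. indicator ?A (x(i := y)) \<partial>lborel) \<partial>PiM I (\<lambda>_. lborel))"
    using A I by (intro lborel_product.product_nn_integral_insert) simp_all
  also have "\<dots> = (\<integral>\<^sup>+ x. 0 \<partial>PiM I (\<lambda>_. lborel :: real measure))"
  proof (rule nn_integral_cong)
    fix x :: "nat \<Rightarrow> real"
    have "(\<integral>\<^sup>+ y. indicator ?A (x(i := y)) \<partial>lborel) \<le> (\<integral>\<^sup>+ y. indicator {x j} y \<partial>lborel)"
      using assms by (intro nn_integral_mono) (auto simp: indicator_def)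
    also have "\<dots> = 0" by simp
    finally show "(\<integral>\<^sup>+ y. indicator ?A (x(i := y)) \<partial>lborel) = 0" by simp
  qed
  finally show ?thesis using A by (simp add: null_sets_def)
qed

text \<open>Translates strings listed in order of time into strings attached to indices:
  \<open>i\<close> receives the entry of \<open>hs\<close> at the position of \<open>i\<close> in
  \<open>p\<close>.\<close>

lemma ex_strings_along:
  assumes "distinct p" "set p = {..<m}" "length hs = m" "set hs \<subseteq> {..<n}"
  shows "\<exists>\<eta>. (\<forall>i<m. \<eta> i < n) \<and> (\<forall>f. map f p = hs \<longleftrightarrow> (\<forall>i<m. f i = \<eta> i))"
proof -
  have lp: "length p = m" using assms by (metis card_lessThan distinct_card)
  define \<eta> where "\<eta> i = hs ! (inv_into {..<m} ((!) p) i)" for i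
  have inj: "inj_on ((!) p) {..<m}" using assms(1) lp by (simp add: inj_on_nth)
  have "map \<eta> p = hs"
    using assms lp inj by (intro nth_equalityI) (simp_all add: \<eta>_def inv_into_f_f)
  then have "map f p = hs \<longleftrightarrow> (\<forall>i<m. f i = \<eta> i)" for f
    using assms(2) by (metis lessThan_iff map_eq_conv)
  moreover have "\<eta> i < n" if "i < m" for i
  proof -
    have "\<eta> i \<in> set (map \<eta> p)" using that assms(2) by simp
    then show ?thesis using \<open>map \<eta> p = hs\<close> assms(4) by auto
  qed
  ultimately show ?thesis by blast
qed

text \<open>Times and strings decouple. For each order \<open>p\<close> and each list
  \<open>hs\<close> satisfying \<open>V\<close>, the tuples form a slice whose volume is that of
  \<open>D p\<close>, whatever \<open>hs\<close> is; the sets \<open>D p\<close> fill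
  \<open>B\<close> up to coinciding times, a null set. This is why the walk is uniform and
  independent of the uniform times.\<close>

lemma emeasure_ordered_tuples:
  fixes V :: "nat list \<Rightarrow> bool" and m n :: nat
  assumes B: "B \<in> sets (lebesgue_tuples m)"
  defines "K \<equiv> {c \<in> space (tuple_measure n m). bead_times m c \<in> B \<and> (\<exists>p. time_order m (fst \<circ> c) p \<and> V (map (snd \<circ> c) p))}"
  shows "K \<in> sets (tuple_measure n m)"
    and "emeasure (tuple_measure n m) K
      = of_nat (card {hs. length hs = m \<and> set hs \<subseteq> {..<n} \<and> V hs}) * emeasure (lebesgue_tuples m) B"
proof -
  let ?T = "tuple_measure n m"
  define Ps where "Ps = {p. distinct p \<and> set p = {..<m}}"
  define L where "L = {hs. length hs = m \<and> set hs \<subseteq> {..<n} \<and> V hs}"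
  have finPs: "finite Ps"
  proof (rule finite_subset)
    show "Ps \<subseteq> {p. set p \<subseteq> {..<m} \<and> length p = m}"
    proof
      fix p assume "p \<in> Ps"
      then have "distinct p" "set p = {..<m}" by (simp_all add: Ps_def)
      then show "p \<in> {p. set p \<subseteq> {..<m} \<and> length p = m}" using distinct_card[of p] by simp
    qed
    show "finite {p. set p \<subseteq> {..<m} \<and> length p = m}" by (rule finite_lists_length_eq) simp
  qed
  have finL: "finite L"
  proof (rule finite_subset)
    show "L \<subseteq> {hs. set hs \<subseteq> {..<n} \<and> length hs = m}" by (auto simp: L_def)
    show "finite {hs. set hs \<subseteq> {..<n} \<and> length hs = m}" by (rule finite_lists_length_eq) simp
  qed
  define D where "D p = B \<inter> {u \<in> space (lebesgue_tuples m). time_order m u p}" for p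
  have D: "D p \<in> sets (lebesgue_tuples m)" if "p \<in> Ps" for p
    unfolding D_def using that B by (intro sets.Int time_order_measurable) (auto simp: Ps_def)
  define S where "S q = {c \<in> space ?T. bead_times m c \<in> D (fst q) \<and> map (snd \<circ> c) (fst q) = snd q}" for q
  have slice: "S (p, hs) \<in> sets ?T \<and> emeasure ?T (S (p, hs)) = emeasure (lebesgue_tuples m) (D p)"
    if "p \<in> Ps" "hs \<in> L" for p hs
  proof -
    have "distinct p" "set p = {..<m}" "length hs = m" "set hs \<subseteq> {..<n}"
      using that by (simp_all add: Ps_def L_def)
    from ex_strings_along[OF this] obtain \<eta> where \<eta>0: "\<forall>i<m. \<eta> i < n" "\<forall>f. map f p = hs \<longleftrightarrow> (\<forall>i<m. f i = \<eta> i)"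
      by blast
    then have \<eta>: "\<And>i. i < m \<Longrightarrow> \<eta> i < n" by blast
    have mapeq: "map f p = hs \<longleftrightarrow> (\<forall>i<m. f i = \<eta> i)" for f using \<eta>0(2) by (rule spec)
    have eq: "S (p, hs) = {c \<in> space ?T. bead_times m c \<in> D p \<and> (\<forall>i<m. snd (c i) = \<eta> i)}"
      by (simp add: S_def mapeq)
    have "S (p, hs) = (bead_times m -` D p \<inter> space ?T) \<inter> {c \<in> space ?T. \<forall>i<m. snd (c i) = \<eta> i}"
      unfolding eq by blast
    moreover have "(bead_times m -` D p \<inter> space ?T) \<inter> {c \<in> space ?T. \<forall>i<m. snd (c i) = \<eta> i} \<in> sets ?T"
      by (rule sets.Int[OF measurable_sets[OF bead_times_measurable D[OF that(1)]] strings_measurable])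
    ultimately have "S (p, hs) \<in> sets ?T" by (simp only:)
    then show ?thesis unfolding eq using emeasure_string_slice[OF \<eta> D[OF that(1)]] by simp
  qed
  have to_eq: "time_order m (bead_times m c) p \<longleftrightarrow> time_order m (fst \<circ> c) p" for c p
  proof -
    have "sorted_wrt (\<lambda>i j. bead_times m c i < bead_times m c j) p \<longleftrightarrow> sorted_wrt (\<lambda>i j. (fst \<circ> c) i < (fst \<circ> c) j) p"
      if "set p = {..<m}"
      using that by (intro iffI; elim sorted_wrt_mono_rel[rotated]) (simp_all add: bead_times_def)
    then show ?thesis by (auto simp: time_order_def)
  qed
  have KS: "K = (\<Union>q\<in>Ps \<times> L. S q)"
  proof (intro equalityI subsetI)
    fix c assume "c \<in> K"
    then obtain p where c: "c \<in> space ?T" "bead_times m c \<in> B" "time_order m (fst \<circ> c) p" "V (map (snd \<circ> c) p)"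
      by (auto simp: K_def)
    have p: "p \<in> Ps" using c(3) by (simp add: Ps_def time_order_def)
    have "snd (c i) < n" if "i < m" for i
      using measurable_space[OF tuple_component_measurable[OF that] c(1)]
      by (simp add: space_pair_measure mem_Times_iff)
    then have hs: "map (snd \<circ> c) p \<in> L"
      using c(3,4) time_order_length[OF c(3)] by (auto simp: L_def time_order_def)
    have "bead_times m c \<in> space (lebesgue_tuples m)" using c(1) bead_times_measurable by (rule measurable_space[rotated])
    then have "bead_times m c \<in> D p" using c to_eq by (simp add: D_def)
    then have "c \<in> S (p, map (snd \<circ> c) p)" using c(1) by (simp add: S_def)
    then show "c \<in> (\<Union>q\<in>Ps \<times> L. S q)" using p hs by blast
  next
    fix c assume "c \<in> (\<Union>q\<in>Ps \<times> L. S q)"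
    then obtain p hs where "p \<in> Ps" "hs \<in> L" and c: "c \<in> S (p, hs)" by auto
    then show "c \<in> K" using to_eq by (auto simp: K_def S_def D_def L_def)
  qed
  show "K \<in> sets ?T" unfolding KS using slice finPs finL by (intro sets.finite_UN) auto
  have disj: "disjoint_family_on S (Ps \<times> L)"
    unfolding disjoint_family_on_def
  proof (intro ballI impI, rule ccontr)
    fix q q' assume q: "q \<in> Ps \<times> L" "q' \<in> Ps \<times> L" "q \<noteq> q'" "S q \<inter> S q' \<noteq> {}"
    then obtain c where "c \<in> S q" "c \<in> S q'" by blast
    then have "fst q = fst q'" "snd q = snd q'"
      using time_order_unique[of m "bead_times m c" "fst q" "fst q'"] by (auto simp: S_def D_def)
    then show False using q(3) by (simp add: prod_eq_iff)
  qed
  have "emeasure ?T K = (\<Sum>q\<in>Ps \<times> L. emeasure ?T (S q))"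
    unfolding KS using slice disj finPs finL by (intro sum_emeasure[symmetric]) auto
  also have "\<dots> = (\<Sum>p\<in>Ps. \<Sum>hs\<in>L. emeasure (lebesgue_tuples m) (D p))"
    unfolding sum.cartesian_product
  proof (rule sum.cong[OF refl])
    fix q assume "q \<in> Ps \<times> L"
    then show "emeasure ?T (S q) = (case q of (p, hs) \<Rightarrow> emeasure (lebesgue_tuples m) (D p))"
      using slice[of "fst q" "snd q"] by (simp add: case_prod_unfold mem_Times_iff)
  qed
  also have "\<dots> = of_nat (card L) * (\<Sum>p\<in>Ps. emeasure (lebesgue_tuples m) (D p))"
    by (simp add: sum_distrib_left)
  also have "(\<Sum>p\<in>Ps. emeasure (lebesgue_tuples m) (D p)) = emeasure (lebesgue_tuples m) (\<Union>p\<in>Ps. D p)"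
  proof (rule sum_emeasure)
    show "D ` Ps \<subseteq> sets (lebesgue_tuples m)" using D by auto
    show "disjoint_family_on D Ps"
      unfolding disjoint_family_on_def D_def using time_order_unique by blast
  qed (rule finPs)
  also have "\<dots> = emeasure (lebesgue_tuples m) B"
  proof (rule emeasure_eq_AE)
    have "AE u in lebesgue_tuples m. \<forall>i\<in>{..<m}. \<forall>j\<in>{..<m} - {i}. u i \<noteq> u j"
    proof (intro AE_finite_allI finite_lessThan finite_Diff)
      fix i j assume "i \<in> {..<m}" "j \<in> {..<m} - {i}"
      then show "AE u in lebesgue_tuples m. u i \<noteq> u j"
        using null_coincidence[of i m j] by (intro AE_I') auto
    qed
    then show "AE u in lebesgue_tuples m. u \<in> (\<Union>p\<in>Ps. D p) \<longleftrightarrow> u \<in> B"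
      using AE_space
    proof eventually_elim
      case (elim u)
      have "inj_on u {..<m}" by (rule inj_onI) (use elim in blast)
      then obtain p where "time_order m u p" using ex_time_order by blast
      moreover from this have "p \<in> Ps" by (simp add: time_order_def Ps_def)
      ultimately show ?case using elim(2) unfolding D_def by blast
    qed
    show "(\<Union>p\<in>Ps. D p) \<in> sets (lebesgue_tuples m)" using D finPs by (intro sets.finite_UN) auto
  qed (rule B)
  finally show "emeasure ?T K = of_nat (card {hs. length hs = m \<and> set hs \<subseteq> {..<n} \<and> V hs}) * emeasure (lebesgue_tuples m) B"
    by (simp add: L_def)
qed

text \<open>\<open>S\<close>, \<open>T\<close> and the rest are the indices of the beads up to
  \<open>s\<close>, from \<open>s\<close> to \<open>t\<close>, and after \<open>t\<close>. The
  half-open intervals make the boxes for different pairs \<open>(S, T)\<close> disjoint.\<close>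

lemma emeasure_interval_box:
  assumes ab: "a < b" and st: "a \<le> s" "s \<le> t" "t < b" and ST: "S \<subseteq> {..<m}" "T \<subseteq> {..<m} - S"
  defines "A \<equiv> \<lambda>i. if i \<in> S then {a<..s} else if i \<in> T then {s<..t} else {t<..<b}"
  shows "PiE {..<m} A \<in> sets (lebesgue_tuples m)"
    and "emeasure (lebesgue_tuples m) (PiE {..<m} A)
      = ennreal ((s - a) ^ card S * (t - s) ^ card T * (b - t) ^ (m - card S - card T))"
proof -
  have A: "A i \<in> sets lborel" for i by (simp add: A_def)
  show "PiE {..<m} A \<in> sets (lebesgue_tuples m)" using A by (intro sets_PiM_I_finite) auto
  have fin: "finite S" "finite T" using ST by (auto intro: finite_subset)
  let ?v = "\<lambda>i. if i \<in> S then s - a else if i \<in> T then t - s else b - t"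
  have "emeasure (lebesgue_tuples m) (PiE {..<m} A) = (\<Prod>i<m. emeasure lborel (A i))"
    using A by (intro lborel_product.emeasure_PiM) auto
  also have "\<dots> = (\<Prod>i<m. ennreal (?v i))"
    using st by (intro prod.cong refl) (auto simp: A_def)
  also have "\<dots> = ennreal (\<Prod>i<m. ?v i)" using st by (intro prod_ennreal) auto
  also have "(\<Prod>i<m. ?v i) = (s - a) ^ card S * (t - s) ^ card T * (b - t) ^ (m - card S - card T)"
  proof -
    have 1: "(\<Prod>i<m. ?v i) = (\<Prod>i\<in>{..<m} - S. ?v i) * (\<Prod>i\<in>S. ?v i)"
      by (rule prod.subset_diff[OF ST(1) finite_lessThan])
    have 2: "(\<Prod>i\<in>{..<m} - S. ?v i) = (\<Prod>i\<in>{..<m} - S - T. ?v i) * (\<Prod>i\<in>T. ?v i)"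
      by (rule prod.subset_diff[OF ST(2)]) simp
    have 3: "(\<Prod>i\<in>S. ?v i) = (s - a) ^ card S" by simp
    have "(\<Prod>i\<in>T. ?v i) = (\<Prod>i\<in>T. t - s)" using ST by (intro prod.cong) auto
    then have 4: "(\<Prod>i\<in>T. ?v i) = (t - s) ^ card T" by simp
    have "(\<Prod>i\<in>{..<m} - S - T. ?v i) = (\<Prod>i\<in>{..<m} - S - T. b - t)" by (intro prod.cong) auto
    moreover have "card ({..<m} - S - T) = m - card S - card T"
      using ST fin by (simp add: card_Diff_subset)
    ultimately have 5: "(\<Prod>i\<in>{..<m} - S - T. ?v i) = (b - t) ^ (m - card S - card T)" by simp
    show ?thesis unfolding 1 2 3 4 5 by (simp only: mult_ac)
  qed
  finally show "emeasure (lebesgue_tuples m) (PiE {..<m} A)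
      = ennreal ((s - a) ^ card S * (t - s) ^ card T * (b - t) ^ (m - card S - card T))" .
qed

section \<open>Asymptotics of bridges\<close>

text \<open>The generating function of a binomial law, used at roots of unity to detect residues and
  at \<open>\<rho>\<close> to sum geometric errors.\<close>

lemma binomial_sum_power:
  fixes x p q :: "'a::comm_ring_1"
  shows "(\<Sum>i\<le>M. of_nat (M choose i) * p ^ i * q ^ (M - i) * x ^ i) = (q + p * x) ^ M"
proof -
  have "(q + p * x) ^ M = (p * x + q) ^ M" by (simp add: add.commute)
  also have "\<dots> = (\<Sum>i\<le>M. of_nat (M choose i) * (p * x) ^ i * q ^ (M - i))"
    by (rule binomial_ring)
  also have "\<dots> = (\<Sum>i\<le>M. of_nat (M choose i) * p ^ i * q ^ (M - i) * x ^ i)"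
    by (intro sum.cong refl) (simp add: power_mult_distrib mult_ac)
  finally show ?thesis ..
qed

lemma binomial_sum_power_compl:
  fixes x p q :: "'a::comm_ring_1"
  shows "(\<Sum>i\<le>M. of_nat (M choose i) * p ^ i * q ^ (M - i) * x ^ (M - i)) = (p + q * x) ^ M"
proof -
  have "(p + q * x) ^ M = (\<Sum>i\<le>M. of_nat (M choose i) * p ^ i * (q * x) ^ (M - i))"
    by (rule binomial_ring)
  also have "\<dots> = (\<Sum>i\<le>M. of_nat (M choose i) * p ^ i * q ^ (M - i) * x ^ (M - i))"
    by (intro sum.cong refl) (simp add: power_mult_distrib mult_ac)
  finally show ?thesis ..
qed

lemma roots_of_unity_filter:
  fixes i r n :: nat
  assumes "n > 0"
  shows "(\<Sum>k<n. cis (2 * pi * real k / real n) ^ i * cnj (cis (2 * pi * real k / real n)) ^ r)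
    = (if i mod n = r mod n then of_nat n else 0)"
proof -
  \<comment> \<open>Exponents are reduced modulo \<open>n\<close> so that unequal residues give an
    angle covered by \<open>sin_strings_nonzero\<close>.\<close>
  define w where "w = cis (2 * (pi * real (i mod n) / real n - pi * real (r mod n) / real n))"
  have red: "cis (2 * pi * real k / real n) ^ j = cis (2 * pi * real k / real n) ^ (j mod n)" for k j
  proof -
    have 1: "cis (2 * pi * real k / real n) ^ n = 1"
    proof -
      have "cis (2 * pi * real k / real n) ^ n = cis (2 * pi * of_int (int k))"
        using assms by (simp add: Complex.DeMoivre)
      then show ?thesis by (metis cis_multiple_2pi Ints_of_int)
    qed
    have "cis (2 * pi * real k / real n) ^ j = cis (2 * pi * real k / real n) ^ (n * (j div n) + j mod n)" by simp
    also have "\<dots> = cis (2 * pi * real k / real n) ^ (j mod n)" by (simp only: power_add power_mult 1) simp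
    finally show ?thesis .
  qed
  have term_eq: "cis (2 * pi * real k / real n) ^ i * cnj (cis (2 * pi * real k / real n)) ^ r = w ^ k" for k
  proof -
    have "cis (2 * pi * real k / real n) ^ i * cnj (cis (2 * pi * real k / real n)) ^ r
        = cis (2 * pi * real k / real n) ^ (i mod n) * cnj (cis (2 * pi * real k / real n) ^ (r mod n))"
      by (metis red complex_cnj_power)
    also have "\<dots> = w ^ k"
      unfolding w_def by (simp add: Complex.DeMoivre cis_cnj cis_mult algebra_simps)
    finally show ?thesis .
  qed
  show ?thesis
  proof (cases "i mod n = r mod n")
    case True
    then show ?thesis unfolding term_eq by (simp add: w_def)
  next
    case False
    have "sin (pi * real (i mod n) / real n - pi * real (r mod n) / real n) \<noteq> 0"
      using assms False by (intro sin_strings_nonzero) auto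
    then have "w \<noteq> 1"
      using cis_double_diff[of "pi * real (i mod n) / real n - pi * real (r mod n) / real n" 0]
      by (auto simp: w_def)
    moreover have "w ^ n = 1"
    proof -
      have "w ^ n = cis (2 * pi * of_int (int (i mod n) - int (r mod n)))"
        using assms by (simp add: w_def Complex.DeMoivre right_diff_distrib mult.assoc)
      then show ?thesis by (metis cis_multiple_2pi Ints_of_int)
    qed
    ultimately show ?thesis unfolding term_eq using False by (simp add: geometric_sum)
  qed
qed

lemma power_tendsto_0:
  fixes z :: "nat \<Rightarrow> 'a::real_normed_algebra_1"
  assumes z: "z \<longlonglongrightarrow> z0" and z0: "norm z0 < 1" and M: "filterlim M at_top sequentially"
  shows "(\<lambda>N. z N ^ M N) \<longlonglongrightarrow> 0"
proof -
  obtain c where c: "norm z0 < c" "c < 1" using z0 dense by blast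
  have c0: "0 \<le> c" using c norm_ge_zero[of z0] by linarith
  have "(\<lambda>N. norm (z N)) \<longlonglongrightarrow> norm z0" using z by (rule tendsto_norm)
  then have "\<forall>\<^sub>F N in sequentially. norm (z N) < c" using c(1) by (rule order_tendstoD(2))
  then have ev: "\<forall>\<^sub>F N in sequentially. norm (z N ^ M N) \<le> c ^ M N"
  proof eventually_elim
    case (elim N)
    have "norm (z N ^ M N) \<le> norm (z N) ^ M N" by (rule norm_power_ineq)
    also have "\<dots> \<le> c ^ M N" using elim by (intro power_mono) auto
    finally show ?case .
  qed
  have "(\<lambda>k. c ^ k) \<longlonglongrightarrow> 0" using c c0 by (intro LIMSEQ_power_zero) auto
  then have "(\<lambda>N. c ^ M N) \<longlonglongrightarrow> 0" using M by (rule filterlim_compose)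
  then show ?thesis by (rule Lim_null_comparison[OF ev])
qed

text \<open>By \<open>roots_of_unity_filter\<close> the sum is a combination of the powers
  \<open>(1 - p + p * w k) ^ M\<close>. The trivial character gives 1. The other bases tend to
  \<open>(1 + w k) / 2\<close>, whose modulus is \<open>\<bar>cos a\<bar> < 1\<close> with
  \<open>a = pi * k / n\<close>, so their powers die out.\<close>

lemma binomial_residue_tendsto:
  fixes p :: "nat \<Rightarrow> real" and M :: "nat \<Rightarrow> nat"
  assumes n: "n \<ge> 1" and p: "p \<longlonglongrightarrow> 1 / 2" and M: "filterlim M at_top sequentially"
  shows "(\<lambda>N. \<Sum>i\<le>M N. if i mod n = r mod n then real (M N choose i) * p N ^ i * (1 - p N) ^ (M N - i) else 0)
    \<longlonglongrightarrow> 1 / real n"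
proof -
  define w where "w k = cis (2 * pi * real k / real n)" for k
  define S where "S N = (\<Sum>i\<le>M N. if i mod n = r mod n then real (M N choose i) * p N ^ i * (1 - p N) ^ (M N - i) else 0)" for N
  have expand: "of_nat n * complex_of_real (S N)
      = (\<Sum>k<n. cnj (w k) ^ r * (complex_of_real (1 - p N) + complex_of_real (p N) * w k) ^ M N)" for N
  proof -
    have "of_nat n * complex_of_real (S N)
        = (\<Sum>i\<le>M N. (of_nat (M N choose i) * complex_of_real (p N) ^ i * complex_of_real (1 - p N) ^ (M N - i)) * (if i mod n = r mod n then of_nat n else 0))"
      unfolding S_def of_real_sum sum_distrib_left by (intro sum.cong refl) simp
    also have "\<dots> = (\<Sum>i\<le>M N. \<Sum>k<n. of_nat (M N choose i) * complex_of_real (p N) ^ i * complex_of_real (1 - p N) ^ (M N - i) * (w k ^ i * cnj (w k) ^ r))"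
      using n by (simp add: roots_of_unity_filter[symmetric] w_def sum_distrib_left)
    also have "\<dots> = (\<Sum>k<n. \<Sum>i\<le>M N. cnj (w k) ^ r * (of_nat (M N choose i) * complex_of_real (p N) ^ i * complex_of_real (1 - p N) ^ (M N - i) * w k ^ i))"
      by (subst sum.swap) (intro sum.cong refl, simp only: mult_ac)
    also have "\<dots> = (\<Sum>k<n. cnj (w k) ^ r * (complex_of_real (1 - p N) + complex_of_real (p N) * w k) ^ M N)"
      by (simp only: sum_distrib_left[symmetric] binomial_sum_power)
    finally show ?thesis .
  qed
  have lim_k: "(\<lambda>N. cnj (w k) ^ r * (complex_of_real (1 - p N) + complex_of_real (p N) * w k) ^ M N) \<longlonglongrightarrow> (if k = 0 then 1 else 0)"
    if k: "k < n" for k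
  proof (cases "k = 0")
    case True
    have "complex_of_real (1 - p N) + complex_of_real (p N) * w k = 1" for N using True by (simp add: w_def)
    then show ?thesis using True by (simp add: w_def)
  next
    case False
    have base: "(\<lambda>N. complex_of_real (1 - p N) + complex_of_real (p N) * w k) \<longlonglongrightarrow> complex_of_real (1 - 1/2) + complex_of_real (1/2) * w k"
      by (intro tendsto_intros p)
    have "norm (complex_of_real (1 - 1/2) + complex_of_real (1/2) * w k) < 1"
    proof -
      define a where "a = pi * real k / real n"
      have a: "0 < a" "a < pi" using k False by (auto simp: a_def field_simps)
      have "w k = cis (2 * a)" by (simp add: w_def a_def mult.assoc)
      then have "complex_of_real (1 - 1/2) + complex_of_real (1/2) * w k = cis a * complex_of_real (cos a)"
        using cos_double_cos[of a] sin_double[of a] by (simp add: complex_eq_iff power2_eq_square field_simps)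
      then have "norm (complex_of_real (1 - 1/2) + complex_of_real (1/2) * w k) = \<bar>cos a\<bar>" by (simp add: norm_mult)
      moreover have "\<bar>cos a\<bar> < 1"
        using cos_monotone_0_pi[of 0 a] cos_monotone_0_pi[of a pi] a by (auto simp: abs_less_iff)
      ultimately show ?thesis by simp
    qed
    then have "(\<lambda>N. (complex_of_real (1 - p N) + complex_of_real (p N) * w k) ^ M N) \<longlonglongrightarrow> 0"
      by (rule power_tendsto_0[OF base _ M])
    then show ?thesis using False tendsto_mult_right_zero by auto
  qed
  have "(\<lambda>N. of_nat n * complex_of_real (S N)) \<longlonglongrightarrow> (\<Sum>k<n. if k = 0 then 1 else 0)"
    unfolding expand using lim_k by (intro tendsto_sum) simp
  moreover have "(\<Sum>k<n. if k = 0 then 1 else 0) = (1::complex)" using n by simp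
  ultimately have "(\<lambda>N. complex_of_real (real n * S N)) \<longlonglongrightarrow> complex_of_real 1" by simp
  then have "(\<lambda>N. real n * S N) \<longlonglongrightarrow> 1" by (simp only: tendsto_of_real_iff)
  then have "(\<lambda>N. real n * S N / real n) \<longlonglongrightarrow> 1 / real n" using n by (intro tendsto_divide tendsto_const) auto
  then show ?thesis using n by (simp add: S_def)
qed

text \<open>The chance of at least two successes is at most the expected number of ordered pairs of
  successes; here binomial coefficients are compared termwise after shifting the index by two. It
  yields the quadratic error of the two-time law.\<close>

lemma binomial_tail_2:
  fixes q :: real
  assumes q: "0 \<le> q" "q \<le> 1"
  shows "(\<Sum>j\<in>{2..m}. real (m choose j) * q ^ j * (1 - q) ^ (m - j)) \<le> (real m * q)\<^sup>2"
proof (cases "m < 2")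
  case True
  then show ?thesis by simp
next
  case False
  then obtain k where m: "m = k + 2" by (metis add.commute le_Suc_ex not_less)
  have "(\<Sum>j\<in>{2..m}. real (m choose j) * q ^ j * (1 - q) ^ (m - j))
      = (\<Sum>i\<le>k. real ((k + 2) choose (i + 2)) * q ^ (i + 2) * (1 - q) ^ (k - i))"
  proof -
    have "(\<Sum>j\<in>{0 + 2..k + 2}. real ((k + 2) choose j) * q ^ j * (1 - q) ^ (k + 2 - j))
        = (\<Sum>i\<in>{0..k}. real ((k + 2) choose (i + 2)) * q ^ (i + 2) * (1 - q) ^ (k + 2 - (i + 2)))"
      by (rule sum.shift_bounds_cl_nat_ivl)
    then show ?thesis by (simp only: m atMost_atLeast0 add_0 add_diff_cancel_right)
  qed
  also have "\<dots> \<le> (\<Sum>i\<le>k. (real m)\<^sup>2 * q\<^sup>2 * (real (k choose i) * q ^ i * (1 - q) ^ (k - i)))"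
  proof (rule sum_mono)
    fix i
    have "Suc (Suc i) * ((k + 2) choose (i + 2)) = (k + 2) * ((k + 1) choose (i + 1))"
      using Suc_times_binomial_eq[of "k + 1" "i + 1"] by (simp add: mult.commute)
    moreover have "Suc i * ((k + 1) choose (i + 1)) = (k + 1) * (k choose i)"
      using Suc_times_binomial_eq[of k i] by (simp add: mult.commute)
    ultimately have "(k + 2) choose (i + 2) \<le> (k + 2) * ((k + 1) choose (i + 1))"
      "(k + 1) choose (i + 1) \<le> (k + 1) * (k choose i)"
      by (metis le_add1 mult_Suc)+
    then have "(k + 2) choose (i + 2) \<le> (k + 2) * ((k + 1) * (k choose i))"
      by (meson le_trans mult_le_mono2)
    also have "\<dots> \<le> m\<^sup>2 * (k choose i)" by (simp add: m power2_eq_square algebra_simps)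
    finally have "real ((k + 2) choose (i + 2)) \<le> (real m)\<^sup>2 * real (k choose i)"
      by (metis of_nat_le_iff of_nat_mult of_nat_power)
    then have "real ((k + 2) choose (i + 2)) * (q ^ (i + 2) * (1 - q) ^ (k - i))
        \<le> (real m)\<^sup>2 * real (k choose i) * (q ^ (i + 2) * (1 - q) ^ (k - i))"
      using q by (intro mult_right_mono) auto
    then show "real ((k + 2) choose (i + 2)) * q ^ (i + 2) * (1 - q) ^ (k - i)
        \<le> (real m)\<^sup>2 * q\<^sup>2 * (real (k choose i) * q ^ i * (1 - q) ^ (k - i))"
      by (simp add: power_add power2_eq_square mult_ac)
  qed
  also have "\<dots> = (real m)\<^sup>2 * q\<^sup>2 * (\<Sum>i\<le>k. real (k choose i) * q ^ i * (1 - q) ^ (k - i))"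
    by (simp only: sum_distrib_left)
  also have "(\<Sum>i\<le>k. real (k choose i) * q ^ i * (1 - q) ^ (k - i)) = (q + (1 - q)) ^ k"
    by (rule binomial_ring[symmetric])
  finally show ?thesis by (simp add: power_mult_distrib)
qed

section \<open>Bridges of the chain with binomial splitting\<close>

context bead_ring
begin

text \<open>The part of a bridge outside the middle interval: of its \<open>M\<close> beads,
  \<open>i\<close> fall to the left, each with probability \<open>p\<close>.\<close>

definition two_sided :: "nat \<Rightarrow> real \<Rightarrow> nat set \<Rightarrow> nat set \<Rightarrow> nat set \<Rightarrow> nat set \<Rightarrow> real" where
  "two_sided M p E G H F = (\<Sum>i\<le>M. real (M choose i) * p ^ i * (1 - p) ^ (M - i) * (ker i E G * ker (M - i) H F))"

text \<open>The chance that a bridge from \<open>E\<close> to \<open>F\<close> with \<open>m\<close>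
  uniform bead times is at \<open>G\<close> and \<open>H\<close> at two given times.
  \<open>q\<close> is the relative length of the interval between these times, and \<open>p\<close>
  is the share of the left piece in the remainder. Two nested binomials replace the multinomial, so
  that the few beads of a short interval can be treated on their own.\<close>

definition bridge :: "nat \<Rightarrow> real \<Rightarrow> real \<Rightarrow> nat set \<Rightarrow> nat set \<Rightarrow> nat set \<Rightarrow> nat set \<Rightarrow> real" where
  "bridge m p q E G H F =
    (\<Sum>j\<le>m. real (m choose j) * q ^ j * (1 - q) ^ (m - j) * (ker j G H * two_sided (m - j) p E G H F)) / ker m E F"

lemma two_sided_bounds:
  assumes "0 \<le> p" "p \<le> 1" and occ: "E \<in> occ" "G \<in> occ" "H \<in> occ" "F \<in> occ"
  shows "0 \<le> two_sided M p E G H F" "two_sided M p E G H F \<le> 1"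
proof -
  show "0 \<le> two_sided M p E G H F"
    unfolding two_sided_def using assms ker_nonneg by (intro sum_nonneg mult_nonneg_nonneg zero_le_power) auto
  have "two_sided M p E G H F \<le> (\<Sum>i\<le>M. real (M choose i) * p ^ i * (1 - p) ^ (M - i))"
    unfolding two_sided_def
  proof (rule sum_mono)
    fix i
    have "ker i E G * ker (M - i) H F \<le> 1"
      using occ ker_nonneg ker_le_1 by (intro mult_le_one) auto
    then show "real (M choose i) * p ^ i * (1 - p) ^ (M - i) * (ker i E G * ker (M - i) H F)
        \<le> real (M choose i) * p ^ i * (1 - p) ^ (M - i)"
      using assms(1,2) by (intro mult_left_le) auto
  qed
  also have "\<dots> = (p + (1 - p)) ^ M" by (rule binomial_ring[symmetric])
  finally show "two_sided M p E G H F \<le> 1" by simp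
qed

text \<open>Both kernels are replaced by their limits on the residue of \<open>i\<close> that
  permits them; by \<open>compat\<close> it is the same residue for both. The errors decay like
  \<open>\<rho> ^ i\<close> and \<open>\<rho> ^ (M N - i)\<close> and are averaged away by the
  binomial law. What remains is the product of the two limits times the chance of the residue, which
  tends to \<open>1 / n\<close>.\<close>

lemma two_sided_tendsto:
  assumes occ: "E \<in> occ" "G \<in> occ" "H \<in> occ" "F \<in> occ"
    and p: "p \<longlonglongrightarrow> 1 / 2" "\<And>N. 0 \<le> p N" "\<And>N. p N \<le> 1" and M: "filterlim M at_top sequentially"
    and compat: "\<And>N. (phase n E + phase n H + M N) mod n = (phase n G + phase n F) mod n"
  shows "(\<lambda>N. two_sided (M N) (p N) E G H F) \<longlonglongrightarrow> real n * stat G * stat F"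
proof -
  obtain C \<rho> where C: "0 < C" and \<rho>: "0 < \<rho>" "\<rho> < 1"
    and mix: "\<And>i E G. E \<in> occ \<Longrightarrow> G \<in> occ \<Longrightarrow> phase n G = (phase n E + i) mod n \<Longrightarrow>
     \<bar>ker i E G - real n * stat G\<bar> \<le> C * \<rho> ^ i"
    using mixing by metis
  \<comment> \<open>The number of hops, modulo \<open>n\<close>, that leads from the phase of
    \<open>E\<close> to that of \<open>G\<close>; adding \<open>n\<close> keeps the subtraction
    exact.\<close>
  define r where "r = phase n G + n - phase n E"
  have pE: "phase n E < n" "phase n G < n" "phase n H < n" "phase n F < n" using occ occ_facts(6) by auto
  have Er: "(phase n E + r) mod n = phase n G" using pE by (simp add: r_def)
  have hit: "phase n G = (phase n E + i) mod n \<longleftrightarrow> i mod n = r mod n" for i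
  proof
    assume "phase n G = (phase n E + i) mod n"
    then have "(r mod n + phase n E) mod n = (i mod n + phase n E) mod n"
      using Er by (simp add: mod_simps add.commute)
    then have "r mod n = i mod n" using n2 by (intro mod_add_right_inj[of "r mod n" n "i mod n" "phase n E"]) auto
    then show "i mod n = r mod n" by simp
  next
    assume "i mod n = r mod n"
    then have "(phase n E + i) mod n = (phase n E + r) mod n" by (metis mod_add_right_eq)
    then show "phase n G = (phase n E + i) mod n" using Er by simp
  qed
  define c where "c i = (if i mod n = r mod n then 1 else 0 :: real)" for i
  have n1: "real n * stat x \<le> real n" if "x \<in> occ" for x
    using member_le_sum[of x occ stat] stat_sum stat_pos finite_occupied_sets that by (simp add: less_imp_le mult_left_le)
  have k1: "\<bar>ker i E G - real n * stat G * c i\<bar> \<le> C * \<rho> ^ i" for i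
  proof (cases "i mod n = r mod n")
    case True
    then show ?thesis using mix[OF occ(1,2)] hit by (simp add: c_def)
  next
    case False
    then have "ker i E G = 0" using hit[of i] ker_phase[OF occ(1), of i G] by auto
    then show ?thesis using False C \<rho> by (simp add: c_def)
  qed
  have k2: "\<bar>ker (M N - i) H F - real n * stat F * c i\<bar> \<le> C * \<rho> ^ (M N - i)" if i: "i \<le> M N" for N i
  proof -
    have eqv: "phase n F = (phase n H + (M N - i)) mod n \<longleftrightarrow> phase n G = (phase n E + i) mod n"
    proof -
      have sum: "(phase n E + i + (phase n H + (M N - i))) mod n = (phase n G + phase n F) mod n"
        using compat[of N] i by (simp add: add.assoc add.left_commute)
      show ?thesis
      proof
        assume "phase n F = (phase n H + (M N - i)) mod n"
        then have "((phase n E + i) mod n + phase n F) mod n = (phase n G + phase n F) mod n"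
          using sum by (simp add: mod_simps)
        then show "phase n G = (phase n E + i) mod n"
          using mod_add_right_inj[of "(phase n E + i) mod n" n "phase n G" "phase n F"] pE n2 by simp
      next
        assume "phase n G = (phase n E + i) mod n"
        then have "((phase n H + (M N - i)) mod n + phase n G) mod n = (phase n F + phase n G) mod n"
          using sum by (simp add: mod_simps add.commute)
        then show "phase n F = (phase n H + (M N - i)) mod n"
          using mod_add_right_inj[of "(phase n H + (M N - i)) mod n" n "phase n F" "phase n G"] pE n2 by simp
      qed
    qed
    show ?thesis
    proof (cases "i mod n = r mod n")
      case True
      then show ?thesis using mix[OF occ(3,4)] hit[of i] eqv by (simp add: c_def)
    next
      case False
      then have "ker (M N - i) H F = 0" using hit[of i] eqv ker_phase[OF occ(3), of "M N - i" F] by auto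
      then show ?thesis using False C \<rho> by (simp add: c_def)
    qed
  qed
  define b where "b N i = real (M N choose i) * p N ^ i * (1 - p N) ^ (M N - i)" for N i
  have b0: "0 \<le> b N i" for N i using p(2,3)[of N] by (simp add: b_def)
  define S where "S N = (\<Sum>i\<le>M N. b N i * c i)" for N
  have S: "S \<longlonglongrightarrow> 1 / real n"
  proof -
    have S_eq: "S N = (\<Sum>i\<le>M N. if i mod n = r mod n then real (M N choose i) * p N ^ i * (1 - p N) ^ (M N - i) else 0)" for N
      unfolding S_def by (intro sum.cong refl) (simp add: b_def c_def)
    show ?thesis unfolding S_eq using n2 by (intro binomial_residue_tendsto p(1) M) simp
  qed
  \<comment> \<open>Binomial generating functions at \<open>\<rho>\<close>; both bases tend to
    \<open>(1 + \<rho>) / 2 < 1\<close>.\<close>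
  define err where "err N = C * ((1 - p N) + p N * \<rho>) ^ M N + real n * C * (p N + (1 - p N) * \<rho>) ^ M N" for N
  have err: "err \<longlonglongrightarrow> 0"
  proof -
    have l1: "(\<lambda>N. (1 - p N) + p N * \<rho>) \<longlonglongrightarrow> (1 - 1/2) + 1/2 * \<rho>" by (intro tendsto_intros p(1))
    have l2: "(\<lambda>N. p N + (1 - p N) * \<rho>) \<longlonglongrightarrow> 1/2 + (1 - 1/2) * \<rho>" by (intro tendsto_intros p(1))
    have a1: "norm ((1 - 1/2) + 1/2 * \<rho>) < 1" "norm (1/2 + (1 - 1/2) * \<rho>) < 1" using \<rho> by simp_all
    have "(\<lambda>N. C * ((1 - p N) + p N * \<rho>) ^ M N + real n * C * (p N + (1 - p N) * \<rho>) ^ M N) \<longlonglongrightarrow> C * 0 + real n * C * 0"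
      by (intro tendsto_intros power_tendsto_0[OF l1 a1(1) M] power_tendsto_0[OF l2 a1(2) M])
    then show ?thesis by (simp add: err_def[abs_def])
  qed
  have close: "\<bar>two_sided (M N) (p N) E G H F - real n * stat G * (real n * stat F) * S N\<bar> \<le> err N" for N
  proof -
    have "two_sided (M N) (p N) E G H F - real n * stat G * (real n * stat F) * S N
        = (\<Sum>i\<le>M N. b N i * (ker i E G * ker (M N - i) H F - real n * stat G * c i * (real n * stat F * c i)))"
    proof -
      have "b N i * (ker i E G * ker (M N - i) H F - real n * stat G * c i * (real n * stat F * c i))
          = b N i * (ker i E G * ker (M N - i) H F) - real n * stat G * (real n * stat F) * (b N i * c i)" for i
      proof -
        have "c i * c i = c i" by (simp add: c_def)
        moreover have "real n * stat G * c i * (real n * stat F * c i) = real n * stat G * (real n * stat F) * (c i * c i)"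
          by (simp only: mult_ac)
        ultimately have "real n * stat G * c i * (real n * stat F * c i) = real n * stat G * (real n * stat F) * c i"
          by (simp only:)
        then show ?thesis by (simp only: right_diff_distrib mult_ac)
      qed
      then show ?thesis by (simp only: two_sided_def S_def b_def[symmetric] sum_subtractf sum_distrib_left)
    qed
    then have "\<bar>two_sided (M N) (p N) E G H F - real n * stat G * (real n * stat F) * S N\<bar>
        \<le> (\<Sum>i\<le>M N. \<bar>b N i * (ker i E G * ker (M N - i) H F - real n * stat G * c i * (real n * stat F * c i))\<bar>)"
      by (simp only: sum_abs)
    also have "\<dots> \<le> (\<Sum>i\<le>M N. C * (b N i * \<rho> ^ i) + real n * C * (b N i * \<rho> ^ (M N - i)))"
    proof (rule sum_mono)
      fix i assume "i \<in> {..M N}"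
      then have i: "i \<le> M N" by simp
      let ?a = "ker i E G" and ?a' = "real n * stat G * c i" and ?d = "ker (M N - i) H F" and ?d' = "real n * stat F * c i"
      have "?a * ?d - ?a' * ?d' = (?a - ?a') * ?d + ?a' * (?d - ?d')" by (simp add: algebra_simps)
      then have "\<bar>?a * ?d - ?a' * ?d'\<bar> \<le> \<bar>?a - ?a'\<bar> * \<bar>?d\<bar> + \<bar>?a'\<bar> * \<bar>?d - ?d'\<bar>"
        by (metis abs_mult abs_triangle_ineq)
      moreover have "\<bar>?a - ?a'\<bar> * \<bar>?d\<bar> \<le> C * \<rho> ^ i * 1"
        using k1[of i] ker_nonneg[OF occ(3,4), of "M N - i"] ker_le_1[OF occ(3,4), of "M N - i"] C \<rho>
        by (intro mult_mono) auto
      moreover have "\<bar>?a'\<bar> * \<bar>?d - ?d'\<bar> \<le> real n * (C * \<rho> ^ (M N - i))"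
      proof (intro mult_mono k2[OF i])
        show "\<bar>?a'\<bar> \<le> real n" using n1[OF occ(2)] stat_pos[OF occ(2)] by (simp add: c_def abs_mult)
      qed auto
      ultimately have "\<bar>?a * ?d - ?a' * ?d'\<bar> \<le> C * \<rho> ^ i + real n * (C * \<rho> ^ (M N - i))" by linarith
      then have "b N i * \<bar>?a * ?d - ?a' * ?d'\<bar> \<le> b N i * (C * \<rho> ^ i + real n * (C * \<rho> ^ (M N - i)))"
        using b0 by (rule mult_left_mono)
      then show "\<bar>b N i * (?a * ?d - ?a' * ?d')\<bar> \<le> C * (b N i * \<rho> ^ i) + real n * C * (b N i * \<rho> ^ (M N - i))"
      proof -
        have "b N i * (C * \<rho> ^ i + real n * (C * \<rho> ^ (M N - i))) = C * (b N i * \<rho> ^ i) + real n * C * (b N i * \<rho> ^ (M N - i))"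
          by (simp add: algebra_simps)
        with \<open>b N i * \<bar>?a * ?d - ?a' * ?d'\<bar> \<le> _\<close> show ?thesis by (simp only: abs_mult abs_of_nonneg[OF b0])
      qed
    qed
    also have "\<dots> = C * (\<Sum>i\<le>M N. b N i * \<rho> ^ i) + real n * C * (\<Sum>i\<le>M N. b N i * \<rho> ^ (M N - i))"
      by (simp only: sum.distrib sum_distrib_left)
    also have "\<dots> = err N"
      unfolding b_def err_def using binomial_sum_power[of "M N" "p N" "1 - p N" \<rho>]
        binomial_sum_power_compl[of "M N" "p N" "1 - p N" \<rho>] by simp
    finally show ?thesis .
  qed
  have "(\<lambda>N. two_sided (M N) (p N) E G H F - real n * stat G * (real n * stat F) * S N) \<longlonglongrightarrow> 0"
    by (rule Lim_null_comparison[OF _ err]) (use close in simp)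
  moreover have "(\<lambda>N. real n * stat G * (real n * stat F) * S N) \<longlonglongrightarrow> real n * stat G * (real n * stat F) * (1 / real n)"
    by (intro tendsto_intros S)
  ultimately have "(\<lambda>N. (two_sided (M N) (p N) E G H F - real n * stat G * (real n * stat F) * S N)
      + real n * stat G * (real n * stat F) * S N) \<longlonglongrightarrow> 0 + real n * stat G * (real n * stat F) * (1 / real n)"
    by (rule tendsto_add)
  then show ?thesis using n2 by (simp add: mult_ac)
qed

lemma ker_tendsto:
  assumes occ: "E \<in> occ" "F \<in> occ" and M: "filterlim M at_top sequentially"
    and compat: "\<And>N. phase n F = (phase n E + M N) mod n"
  shows "(\<lambda>N. ker (M N) E F) \<longlonglongrightarrow> real n * stat F"
proof -
  obtain C \<rho> where \<rho>: "0 < \<rho>" "\<rho> < 1"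
    and mix: "\<And>i E G. E \<in> occ \<Longrightarrow> G \<in> occ \<Longrightarrow> phase n G = (phase n E + i) mod n \<Longrightarrow>
     \<bar>ker i E G - real n * stat G\<bar> \<le> C * \<rho> ^ i"
    using mixing by metis
  have "(\<lambda>k. \<rho> ^ k) \<longlonglongrightarrow> 0" using \<rho> by (intro LIMSEQ_power_zero) auto
  then have "(\<lambda>N. \<rho> ^ M N) \<longlonglongrightarrow> 0" using M by (rule filterlim_compose)
  then have "(\<lambda>N. C * \<rho> ^ M N) \<longlonglongrightarrow> C * 0" by (intro tendsto_mult tendsto_const)
  then have "(\<lambda>N. C * \<rho> ^ M N) \<longlonglongrightarrow> 0" by simp
  then have "(\<lambda>N. ker (M N) E F - real n * stat F) \<longlonglongrightarrow> 0"
    by (rule Lim_null_comparison[rotated]) (use mix[OF occ compat] in simp)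
  then show ?thesis by (simp add: LIM_zero_iff)
qed

text \<open>With \<open>q = 0\<close> the middle interval is empty and only \<open>j = 0\<close>
  contributes, through \<open>0 ^ 0 = 1\<close>. The factor \<open>stat F\<close> cancels against
  the limit of the normalising \<open>ker\<close>, so the limit forgets both ends. The phase
  condition follows from \<open>ker (M N) E F \<noteq> 0\<close>.\<close>

lemma bridge_tendsto:
  assumes occ: "E \<in> occ" "G \<in> occ" "F \<in> occ"
    and p: "p \<longlonglongrightarrow> 1 / 2" "\<And>N. 0 \<le> p N" "\<And>N. p N \<le> 1" and M: "filterlim M at_top sequentially"
    and pos: "\<And>N. ker (M N) E F \<noteq> 0"
  shows "(\<lambda>N. bridge (M N) (p N) 0 E G G F) \<longlonglongrightarrow> stat G"
proof -
  have compat: "phase n F = (phase n E + M N) mod n" for N using ker_phase[OF occ(1) pos] .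
  have "(phase n E + phase n G + M N) mod n = (phase n G + phase n F) mod n" for N
    unfolding compat[of N] by (simp add: mod_simps add_ac)
  then have "(\<lambda>N. two_sided (M N) (p N) E G G F) \<longlonglongrightarrow> real n * stat G * stat F"
    using occ p M by (intro two_sided_tendsto) auto
  moreover have "(\<lambda>N. ker (M N) E F) \<longlonglongrightarrow> real n * stat F" by (rule ker_tendsto[OF occ(1,3) M compat])
  moreover have nF: "real n * stat F \<noteq> 0" using n2 stat_pos[OF occ(3)] by simp
  ultimately have "(\<lambda>N. two_sided (M N) (p N) E G G F / ker (M N) E F) \<longlonglongrightarrow> real n * stat G * stat F / (real n * stat F)"
    by (rule tendsto_divide)
  moreover have "bridge (M N) (p N) 0 E G G F = two_sided (M N) (p N) E G G F / ker (M N) E F" for N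
  proof -
    have "(\<Sum>j\<le>M N. real (M N choose j) * 0 ^ j * (1 - 0) ^ (M N - j) * (ker j G G * two_sided (M N - j) (p N) E G G F))
        = (\<Sum>j\<in>{0}. real (M N choose j) * 0 ^ j * (1 - 0) ^ (M N - j) * (ker j G G * two_sided (M N - j) (p N) E G G F))"
      by (intro sum.mono_neutral_right) auto
    then show ?thesis using occ by (simp add: bridge_def ker_0)
  qed
  ultimately show ?thesis using nF by simp
qed

text \<open>The term \<open>j = 0\<close> vanishes since \<open>G \<noteq> H\<close>, and
  \<open>j = 1\<close> supplies the main term. One \<open>\<mu>\<^sup>2\<close> of the bound comes
  from the terms with \<open>j \<ge> 2\<close>, the other from replacing the factor
  \<open>(1 - q) ^ (m - 1)\<close> by 1. The denominator is the limit of the normalising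
  \<open>ker\<close>.\<close>

lemma bridge_near:
  assumes occ: "E \<in> occ" "G \<in> occ" "H \<in> occ" "F \<in> occ" and GH: "G \<noteq> H"
    and p: "p \<longlonglongrightarrow> 1 / 2" "\<And>N. 0 \<le> p N" "\<And>N. p N \<le> 1" and M: "filterlim M at_top sequentially"
    and q: "\<And>N. 0 \<le> q N" "\<And>N. q N \<le> 1" "(\<lambda>N. real (M N) * q N) \<longlonglongrightarrow> \<mu>"
    and pos: "\<And>N. ker (M N) E F \<noteq> 0" and e: "e > 0"
  shows "\<forall>\<^sub>F N in sequentially. \<bar>bridge (M N) (p N) (q N) E G H F - \<mu> * ker 1 G H * stat G\<bar>
    \<le> 2 * \<mu>\<^sup>2 / (real n * stat F) + e"
proof -
  have compat: "phase n F = (phase n E + M N) mod n" for N using ker_phase[OF occ(1) pos] .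
  have nF: "real n * stat F > 0" using n2 stat_pos[OF occ(4)] by simp
  have kerF: "(\<lambda>N. ker (M N) E F) \<longlonglongrightarrow> real n * stat F" by (rule ker_tendsto[OF occ(1,4) M compat])
  have ker0: "ker (M N) E F > 0" for N using ker_nonneg[OF occ(1,4), of "M N"] pos[of N] by linarith
  define Q where "Q N = ker 1 G H * two_sided (M N - 1) (p N) E G H F / ker (M N) E F" for N
  have M1: "\<forall>\<^sub>F N in sequentially. M N \<ge> 1" using M by (simp add: filterlim_at_top)
  have M': "filterlim (\<lambda>N. M N - 1) at_top sequentially"
  proof -
    have "filterlim (\<lambda>k::nat. k - 1) at_top sequentially" by (rule filterlim_minus_const_nat_at_top)
    then show ?thesis using M by (rule filterlim_compose)
  qed
  have Q: "Q \<longlonglongrightarrow> ker 1 G H * stat G"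
  proof (cases "ker 1 G H = 0")
    case True
    then show ?thesis by (simp add: Q_def[abs_def])
  next
    case False
    have h: "phase n H = (phase n G + 1) mod n" using ker_phase[OF occ(2) False] .
    \<comment> \<open>\<open>M N - 1\<close> is truncated when \<open>M N = 0\<close>, where the
      phase identity \<open>c\<close> could fail, so a finite initial segment is dropped.\<close>
    obtain N0 where N0: "\<And>N. N \<ge> N0 \<Longrightarrow> M N \<ge> 1" using M1 by (auto simp: eventually_sequentially)
    have c: "(phase n E + phase n H + (M (N + N0) - 1)) mod n = (phase n G + phase n F) mod n" for N
    proof -
      have "(phase n E + phase n H + (M (N + N0) - 1)) mod n = (phase n E + (phase n G + 1) + (M (N + N0) - 1)) mod n"
      proof -
        have "(u + v mod n + k) mod n = (u + v + k) mod n" for u v k by (metis mod_add_left_eq mod_add_right_eq)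
        then show ?thesis unfolding h .
      qed
      also have "phase n E + (phase n G + 1) + (M (N + N0) - 1) = phase n G + (phase n E + M (N + N0))"
        using N0[of "N + N0"] by simp
      also have "\<dots> mod n = (phase n G + phase n F) mod n" unfolding compat[of "N + N0"] by (simp add: mod_simps)
      finally show ?thesis .
    qed
    have "(\<lambda>N. two_sided (M (N + N0) - 1) (p (N + N0)) E G H F) \<longlonglongrightarrow> real n * stat G * stat F"
    proof (rule two_sided_tendsto[OF occ _ p(2) p(3) _ c])
      show "(\<lambda>N. p (N + N0)) \<longlonglongrightarrow> 1 / 2" using p(1) by (rule LIMSEQ_ignore_initial_segment)
      show "filterlim (\<lambda>N. M (N + N0) - 1) at_top sequentially"
        using M' by (rule filterlim_compose[of "\<lambda>N. M N - 1" _ _ "\<lambda>N. N + N0"]) (rule filterlim_add_const_nat_at_top)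
    qed
    then have "(\<lambda>N. two_sided (M N - 1) (p N) E G H F) \<longlonglongrightarrow> real n * stat G * stat F"
      by (rule LIMSEQ_offset)
    then have "Q \<longlonglongrightarrow> ker 1 G H * (real n * stat G * stat F) / (real n * stat F)"
      unfolding Q_def using n2 stat_pos[OF occ(4)] by (intro tendsto_intros kerF) simp_all
    then show ?thesis using n2 stat_pos[OF occ(4)] by simp
  qed
  define x where "x N = real (M N) * q N" for N
  have x: "x \<longlonglongrightarrow> \<mu>" using q(3) by (simp add: x_def[abs_def])
  have est: "\<bar>bridge (M N) (p N) (q N) E G H F - x N * Q N\<bar> \<le> 2 * (x N)\<^sup>2 / ker (M N) E F" if N: "M N \<ge> 1" for N
  proof -
    define a where "a j = real (M N choose j) * q N ^ j * (1 - q N) ^ (M N - j) * (ker j G H * two_sided (M N - j) (p N) E G H F)" for j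
    have w: "0 \<le> ker j G H * two_sided k (p N) E G H F" "ker j G H * two_sided k (p N) E G H F \<le> 1" for j k
    proof -
      have ts: "0 \<le> two_sided k (p N) E G H F" "two_sided k (p N) E G H F \<le> 1"
        by (rule two_sided_bounds[OF p(2,3) occ])+
      show "0 \<le> ker j G H * two_sided k (p N) E G H F"
        using ts(1) ker_nonneg[OF occ(2,3), of j] by simp
      show "ker j G H * two_sided k (p N) E G H F \<le> 1"
        using ts ker_nonneg[OF occ(2,3), of j] ker_le_1[OF occ(2,3), of j] by (intro mult_le_one) auto
    qed
    have b0: "0 \<le> real (M N choose j) * q N ^ j * (1 - q N) ^ (M N - j)" for j using q(1,2)[of N] by simp
    have split: "(\<Sum>j\<le>M N. a j) = a 1 + (\<Sum>j\<in>{2..M N}. a j)"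
    proof -
      have "{..M N} = insert 0 (insert 1 {2..M N})" using N by auto
      moreover have "a 0 = 0" using GH occ by (simp add: a_def ker_0)
      ultimately show ?thesis by simp
    qed
    have t0: "0 \<le> (\<Sum>j\<in>{2..M N}. a j)" unfolding a_def by (rule sum_nonneg, rule mult_nonneg_nonneg[OF b0 w(1)])
    have "(\<Sum>j\<in>{2..M N}. a j) \<le> (\<Sum>j\<in>{2..M N}. real (M N choose j) * q N ^ j * (1 - q N) ^ (M N - j))"
    proof (rule sum_mono)
      fix j show "a j \<le> real (M N choose j) * q N ^ j * (1 - q N) ^ (M N - j)"
        unfolding a_def by (rule mult_left_le[OF w(2) b0])
    qed
    also have "\<dots> \<le> (x N)\<^sup>2" unfolding x_def using q(1,2)[of N] by (rule binomial_tail_2)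
    finally have t1: "(\<Sum>j\<in>{2..M N}. a j) \<le> (x N)\<^sup>2" .
    define v where "v = ker 1 G H * two_sided (M N - 1) (p N) E G H F"
    have v: "0 \<le> v" "v \<le> 1" using w[of 1 "M N - 1"] by (simp_all add: v_def)
    have x0: "0 \<le> x N" using q(1)[of N] by (simp add: x_def)
    have a1: "a 1 = x N * (1 - q N) ^ (M N - 1) * v" unfolding a_def x_def v_def by simp
    \<comment> \<open>Bernoulli's inequality keeps the factor within \<open>x N\<close> of
      1.\<close>
    have pw: "1 - x N \<le> (1 - q N) ^ (M N - 1)" "(1 - q N) ^ (M N - 1) \<le> 1"
    proof -
      have "1 + real (M N - 1) * (- q N) \<le> (1 + - q N) ^ (M N - 1)"
        using q(2)[of N] by (intro Bernoulli_inequality) simp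
      moreover have "real (M N - 1) * q N \<le> x N" unfolding x_def using q(1)[of N] by (intro mult_right_mono) auto
      ultimately show "1 - x N \<le> (1 - q N) ^ (M N - 1)" by simp
      show "(1 - q N) ^ (M N - 1) \<le> 1" using q(1,2)[of N] by (intro power_le_one) auto
    qed
    have "\<bar>a 1 - x N * v\<bar> \<le> (x N)\<^sup>2"
    proof -
      have "a 1 - x N * v = - (x N * v * (1 - (1 - q N) ^ (M N - 1)))" unfolding a1 by (simp add: algebra_simps)
      then have "\<bar>a 1 - x N * v\<bar> = x N * v * (1 - (1 - q N) ^ (M N - 1))"
        using x0 v pw by (simp add: abs_mult)
      also have "\<dots> \<le> x N * 1 * x N" using x0 v pw by (intro mult_mono) auto
      finally show ?thesis by (simp add: power2_eq_square)
    qed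
    then have "\<bar>(\<Sum>j\<le>M N. a j) - x N * v\<bar> \<le> 2 * (x N)\<^sup>2" using split t0 t1 by linarith
    then have "\<bar>(\<Sum>j\<le>M N. a j) - x N * v\<bar> / ker (M N) E F \<le> 2 * (x N)\<^sup>2 / ker (M N) E F"
      using ker0[of N] by (intro divide_right_mono) auto
    moreover have "bridge (M N) (p N) (q N) E G H F - x N * Q N = ((\<Sum>j\<le>M N. a j) - x N * v) / ker (M N) E F"
      by (simp add: bridge_def a_def Q_def v_def diff_divide_distrib)
    ultimately show ?thesis using ker0[of N] by simp
  qed
  have l1: "(\<lambda>N. 2 * (x N)\<^sup>2 / ker (M N) E F) \<longlonglongrightarrow> 2 * \<mu>\<^sup>2 / (real n * stat F)"
    using n2 stat_pos[OF occ(4)] by (intro tendsto_intros x kerF) simp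
  have l2: "(\<lambda>N. x N * Q N) \<longlonglongrightarrow> \<mu> * (ker 1 G H * stat G)" by (intro tendsto_intros x Q)
  have "\<forall>\<^sub>F N in sequentially. 2 * (x N)\<^sup>2 / ker (M N) E F < 2 * \<mu>\<^sup>2 / (real n * stat F) + e / 2"
    using l1 e by (intro order_tendstoD(2)[OF l1]) simp
  moreover have "\<forall>\<^sub>F N in sequentially. dist (x N * Q N) (\<mu> * (ker 1 G H * stat G)) < e / 2"
    using l2 e by (intro tendstoD) simp_all
  ultimately show ?thesis using M1
  proof eventually_elim
    case (elim N)
    then have "\<bar>x N * Q N - \<mu> * (ker 1 G H * stat G)\<bar> < e / 2" by (simp only: dist_real_def)
    moreover have "\<bar>bridge (M N) (p N) (q N) E G H F - x N * Q N\<bar> \<le> 2 * (x N)\<^sup>2 / ker (M N) E F"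
      using elim by (intro est)
    ultimately have "\<bar>bridge (M N) (p N) (q N) E G H F - \<mu> * (ker 1 G H * stat G)\<bar> \<le> 2 * \<mu>\<^sup>2 / (real n * stat F) + e"
      using elim(1) by linarith
    then show ?case by (simp only: mult.assoc)
  qed
qed

end

section \<open>Volumes of bead configurations\<close>

lemma sum_Pow_card:
  fixes g :: "nat \<Rightarrow> real"
  assumes "finite A"
  shows "(\<Sum>S\<in>Pow A. g (card S)) = (\<Sum>i\<le>card A. real (card A choose i) * g i)"
proof -
  have "(\<Sum>S\<in>Pow A. g (card S)) = (\<Sum>i\<in>{..card A}. \<Sum>S\<in>{S \<in> Pow A. card S = i}. g (card S))"
    using assms card_mono[OF assms] by (intro sum.group[symmetric]) auto
  also have "\<dots> = (\<Sum>i\<le>card A. real (card A choose i) * g i)"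
  proof (rule sum.cong[OF refl])
    fix i
    have "(\<Sum>S\<in>{S \<in> Pow A. card S = i}. g (card S)) = (\<Sum>S\<in>{S \<in> Pow A. card S = i}. g i)"
      by (rule sum.cong[OF refl]) simp
    also have "\<dots> = real (card {S. S \<subseteq> A \<and> card S = i}) * g i" by simp
    also have "card {S. S \<subseteq> A \<and> card S = i} = card A choose i" using assms by (rule n_subsets)
    finally show "(\<Sum>S\<in>{S \<in> Pow A. card S = i}. g (card S)) = real (card A choose i) * g i" .
  qed
  finally show ?thesis .
qed

text \<open>Turns conditions on bead times into positions in the ordered list of strings: once
  \<open>S\<close> and \<open>T\<close> are known, only their cardinalities enter the walk
  condition.\<close>

lemma strings_at_parts:
  assumes p: "time_order m (fst \<circ> c) p" and st: "s \<le> t"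
    and S: "S = {i. i < m \<and> fst (c i) \<le> s}" and T: "T = {i. i < m \<and> s < fst (c i) \<and> fst (c i) \<le> t}"
  shows "strings_at c p (\<lambda>x. x \<le> s) = take (card S) (map (snd \<circ> c) p)"
    "strings_at c p (\<lambda>x. s < x \<and> x \<le> t) = take (card T) (drop (card S) (map (snd \<circ> c) p))"
    "strings_at c p (\<lambda>x. t < x) = drop (card S + card T) (map (snd \<circ> c) p)"
proof -
  have pm: "distinct p" "set p = {..<m}" using p by (auto simp: time_order_def)
  have len: "length (strings_at c p P) = card {i. i < m \<and> P (fst (c i))}" for P
  proof -
    have "length (filter (\<lambda>i. P (fst (c i))) p) = card (set (filter (\<lambda>i. P (fst (c i))) p))"
      using pm(1) by (intro distinct_card[symmetric] distinct_filter)
    also have "set (filter (\<lambda>i. P (fst (c i))) p) = {i. i < m \<and> P (fst (c i))}" using pm(2) by auto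
    finally show ?thesis by (simp add: strings_at_def)
  qed
  have 1: "strings_at c p (\<lambda>x. x \<le> t) = strings_at c p (\<lambda>x. x \<le> s) @ strings_at c p (\<lambda>x. x \<le> t \<and> \<not> x \<le> s)"
    using st by (intro strings_at_append[OF p]) auto
  have 2: "strings_at c p (\<lambda>x. x \<le> t \<and> \<not> x \<le> s) = strings_at c p (\<lambda>x. s < x \<and> x \<le> t)"
    by (intro strings_at_cong[OF p]) auto
  have 3: "strings_at c p (\<lambda>x. True) = strings_at c p (\<lambda>x. x \<le> t) @ strings_at c p (\<lambda>x. True \<and> \<not> x \<le> t)"
    by (intro strings_at_append[OF p]) auto
  have 4: "strings_at c p (\<lambda>x. True \<and> \<not> x \<le> t) = strings_at c p (\<lambda>x. t < x)" by (intro strings_at_cong[OF p]) auto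
  have hs: "map (snd \<circ> c) p = strings_at c p (\<lambda>x. x \<le> s) @ strings_at c p (\<lambda>x. s < x \<and> x \<le> t) @ strings_at c p (\<lambda>x. t < x)"
    using strings_at_True[OF p, of "\<lambda>_. True" c] 1 2 3 4 by simp
  have l1: "length (strings_at c p (\<lambda>x. x \<le> s)) = card S" unfolding len S ..
  have l2: "length (strings_at c p (\<lambda>x. s < x \<and> x \<le> t)) = card T" unfolding len T ..
  show "strings_at c p (\<lambda>x. x \<le> s) = take (card S) (map (snd \<circ> c) p)" unfolding hs using l1 by simp
  show "strings_at c p (\<lambda>x. s < x \<and> x \<le> t) = take (card T) (drop (card S) (map (snd \<circ> c) p))" unfolding hs using l1 l2 by simp
  show "strings_at c p (\<lambda>x. t < x) = drop (card S + card T) (map (snd \<circ> c) p)" unfolding hs using l1 l2 by simp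
qed

lemma bead_times_in_box:
  "bead_times m c \<in> PiE {..<m} A \<longleftrightarrow> (\<forall>i<m. fst (c i) \<in> A i)"
proof
  assume *: "bead_times m c \<in> PiE {..<m} A"
  show "\<forall>i<m. fst (c i) \<in> A i"
  proof (intro allI impI)
    fix i assume "i < m"
    then show "fst (c i) \<in> A i" using PiE_mem[OF *, of i] by (simp add: bead_times_def)
  qed
next
  assume *: "\<forall>i<m. fst (c i) \<in> A i"
  show "bead_times m c \<in> PiE {..<m} A"
    by (rule PiE_I) (use * in \<open>simp_all add: bead_times_def\<close>)
qed

context bead_ring
begin

text \<open>The normalisation is legitimate because the beads of \<open>X\<close> themselves provide
  a walk of length \<open>m\<close> between the two ends.\<close>

lemma emeasure_configs_UNIV:
  assumes X: "X \<in> bead_paths n l" and ab: "a < b" and nojump: "left_lim X b = X b"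
    and m: "m = card (beads_in n a b X)"
  shows "configs n l a b X m UNIV \<in> sets (tuple_measure n m)"
    and "emeasure (tuple_measure n m) (configs n l a b X m UNIV) = ennreal (real (walks n m (X a) (X b)) * (b - a) ^ m)"
    and "walks n m (X a) (X b) > 0"
proof -
  have occ: "X a \<in> occ" using bead_paths_D(1)[OF X] .
  \<comment> \<open>The box with both index sets empty and \<open>s = t = a\<close>, written so that
    \<open>emeasure_interval_box\<close> applies literally.\<close>
  define A where "A i = (if i \<in> {} then {a<..a} else if i \<in> {} then {a<..a} else {a<..<b})" for i :: nat
  note box = emeasure_interval_box[OF ab order_refl order_refl ab empty_subsetI[of "{..<m}"] empty_subsetI, folded A_def]
  have eq: "configs n l a b X m UNIV = {c \<in> space (tuple_measure n m). bead_times m c \<in> PiE {..<m} A \<and>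
      (\<exists>p. time_order m (fst \<circ> c) p \<and> hop_walk n (X a) (map (snd \<circ> c) p) (X b))}"
    unfolding configs_UNIV_eq[OF X ab n2 nojump m] bead_times_in_box by (simp add: A_def)
  show "configs n l a b X m UNIV \<in> sets (tuple_measure n m)"
    unfolding eq by (rule emeasure_ordered_tuples(1)[OF box(1)])
  have walks: "{hs. length hs = m \<and> set hs \<subseteq> {..<n} \<and> hop_walk n (X a) hs (X b)} = {hs. length hs = m \<and> hop_walk n (X a) hs (X b)}"
    using hop_walk_occupied[OF _ occ] by blast
  have "emeasure (tuple_measure n m) (configs n l a b X m UNIV)
      = of_nat (walks n m (X a) (X b)) * ennreal ((b - a) ^ m)"
    unfolding eq emeasure_ordered_tuples(2)[OF box(1), where n = n and V = "\<lambda>hs. hop_walk n (X a) hs (X b)"]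
      walks box(2) by (simp add: walks_def)
  then show "emeasure (tuple_measure n m) (configs n l a b X m UNIV) = ennreal (real (walks n m (X a) (X b)) * (b - a) ^ m)"
    using ab by (simp add: ennreal_mult ennreal_of_nat_eq_real_of_nat)
  obtain c where c: "bij_betw c {0..<m} (beads_in n a b X)"
    using ex_bij_betw_nat_finite[OF finite_beads_in[OF X]] m by blast
  have bs: "beads_in n a b X = c ` {..<m}" "inj_on c {..<m}"
    using c by (simp_all add: bij_betw_def lessThan_atLeast0)
  from config_walk(2)[OF X bs ab] obtain p where p: "time_order m (fst \<circ> c) p"
      "\<And>r. a \<le> r \<Longrightarrow> r < b \<Longrightarrow> hop_walk n (X r) (strings_at c p (\<lambda>t. r < t)) (left_lim X b)" by blast
  have "strings_at c p (\<lambda>t. a < t) = map (snd \<circ> c) p"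
    using config_walk(1)[OF X bs ab] by (intro strings_at_True[OF p(1)]) simp
  then have "hop_walk n (X a) (map (snd \<circ> c) p) (X b)" using p(2)[of a] ab nojump by simp
  moreover have "length (map (snd \<circ> c) p) = m" using time_order_length[OF p(1)] by simp
  ultimately show "walks n m (X a) (X b) > 0" using walks_pos_iff[OF occ] by blast
qed

lemma card_three_walks:
  assumes "E \<in> occ" "G \<in> occ" "H \<in> occ" and "i + j \<le> m"
  shows "card {hs. length hs = m \<and> set hs \<subseteq> {..<n} \<and>
      (hop_walk n E (take i hs) G \<and> hop_walk n G (take j (drop i hs)) H \<and> hop_walk n H (drop (i + j) hs) F)}
    = walks n i E G * (walks n j G H * walks n (m - i - j) H F)"
proof -
  have strings: "set hs \<subseteq> {..<n}"
    if "hop_walk n E (take i hs) G" "hop_walk n G (take j (drop i hs)) H" "hop_walk n H (drop (i + j) hs) F" for hs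
  proof -
    have "set (take i hs) \<subseteq> {..<n}" "set (take j (drop i hs)) \<subseteq> {..<n}" "set (drop (i + j) hs) \<subseteq> {..<n}"
      using that assms hop_walk_occupied by blast+
    moreover have "hs = take i hs @ take j (drop i hs) @ drop (i + j) hs"
      by (metis append_take_drop_id drop_drop add.commute)
    ultimately show ?thesis by (metis Un_subset_iff set_append)
  qed
  have "{hs. length hs = m \<and> set hs \<subseteq> {..<n} \<and>
      (hop_walk n E (take i hs) G \<and> hop_walk n G (take j (drop i hs)) H \<and> hop_walk n H (drop (i + j) hs) F)}
    = {hs. length hs = i + (m - i) \<and> hop_walk n E (take i hs) G \<and>
        (hop_walk n G (take j (drop i hs)) H \<and> hop_walk n H (drop j (drop i hs)) F)}"
    using strings assms(4) by (auto simp: add.commute)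
  then have "card {hs. length hs = m \<and> set hs \<subseteq> {..<n} \<and>
      (hop_walk n E (take i hs) G \<and> hop_walk n G (take j (drop i hs)) H \<and> hop_walk n H (drop (i + j) hs) F)}
    = walks n i E G * card {hs. length hs = m - i \<and> (hop_walk n G (take j hs) H \<and> hop_walk n H (drop j hs) F)}"
    using walks_card_split[OF assms(1,2), of i "m - i" "\<lambda>hs. hop_walk n G (take j hs) H \<and> hop_walk n H (drop j hs) F"] by simp
  also have "card {hs. length hs = m - i \<and> (hop_walk n G (take j hs) H \<and> hop_walk n H (drop j hs) F)}
      = card {hs. length hs = j + (m - i - j) \<and> hop_walk n G (take j hs) H \<and> hop_walk n H (drop j hs) F}"
    using assms(4) by simp
  also have "\<dots> = walks n j G H * walks n (m - i - j) H F"
    using walks_card_split[OF assms(2,3), of j "m - i - j" "\<lambda>hs. hop_walk n H hs F"] by (simp add: walks_def)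
  finally show ?thesis .
qed

text \<open>Configurations are sorted by which indices fall into the left and the middle interval.
  For each choice the times fill a box and the strings form three-piece walks, so the volumes
  multiply; choices with equal cardinalities contribute equally, which brings in the binomial
  coefficients.\<close>

lemma emeasure_configs_cyl:
  assumes X: "X \<in> bead_paths n l" and ab: "a < b" and nojump: "left_lim X b = X b"
    and m: "m = card (beads_in n a b X)" and st: "a \<le> s" "s \<le> t" "t < b" and GH: "G \<in> occ" "H \<in> occ"
  shows "configs n l a b X m {Y \<in> bead_paths n l. Y s = G \<and> Y t = H} \<in> sets (tuple_measure n m)"
    and "emeasure (tuple_measure n m) (configs n l a b X m {Y \<in> bead_paths n l. Y s = G \<and> Y t = H})
      = ennreal (\<Sum>j\<le>m. real (m choose j) * (\<Sum>i\<le>m - j. real ((m - j) choose i) *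
          ((s - a) ^ i * (t - s) ^ j * (b - t) ^ (m - i - j) *
            real (walks n i (X a) G * (walks n j G H * walks n (m - i - j) H (X b))))))"
proof -
  let ?M = "tuple_measure n m" and ?I = "{..<m}"
  let ?C = "configs n l a b X m {Y \<in> bead_paths n l. Y s = G \<and> Y t = H}"
  have occ: "X a \<in> occ" "X b \<in> occ" using bead_paths_D(1)[OF X] by blast+
  define A where "A S T i = (if i \<in> S then {a<..s} else if i \<in> T then {s<..t} else {t<..<b})" for S T :: "nat set" and i
  \<comment> \<open>The middle set \<open>T\<close> is chosen before \<open>S\<close>, to obtain the
    nesting of the sums in \<open>bridge\<close>.\<close>
  define J where "J = (SIGMA T:Pow ?I. Pow (?I - T))"
  define V where "V i j hs \<longleftrightarrow> hop_walk n (X a) (take i hs) G \<and> hop_walk n G (take j (drop i hs)) H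
      \<and> hop_walk n H (drop (i + j) hs) (X b)" for i j hs
  define K where "K q = {c \<in> space ?M. bead_times m c \<in> PiE ?I (A (snd q) (fst q)) \<and>
      (\<exists>p. time_order m (fst \<circ> c) p \<and> V (card (snd q)) (card (fst q)) (map (snd \<circ> c) p))}" for q
  have finJ: "finite J" unfolding J_def by (rule finite_SigmaI) auto
  have sub: "snd q \<subseteq> ?I" "fst q \<subseteq> ?I - snd q" if "q \<in> J" for q
    using that by (auto simp: J_def)
  have box: "PiE ?I (A (snd q) (fst q)) \<in> sets (lebesgue_tuples m)"
    "emeasure (lebesgue_tuples m) (PiE ?I (A (snd q) (fst q)))
      = ennreal ((s - a) ^ card (snd q) * (t - s) ^ card (fst q) * (b - t) ^ (m - card (snd q) - card (fst q)))" if "q \<in> J" for q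
    using emeasure_interval_box[OF ab st sub[OF that]] by (simp_all add: A_def[abs_def])
  have inA: "(fst (c i) \<in> A S T i) \<longleftrightarrow> (a < fst (c i) \<and> fst (c i) < b \<and> (i \<in> S \<longleftrightarrow> fst (c i) \<le> s)
      \<and> (i \<in> T \<longleftrightarrow> s < fst (c i) \<and> fst (c i) \<le> t))" if "S \<inter> T = {}" for c :: "nat \<Rightarrow> real \<times> nat" and S T i
    using that st by (auto simp: A_def)
  have disjST: "snd q \<inter> fst q = {}" if "q \<in> J" for q using sub[OF that] by blast
  have recover: "snd q = {i. i < m \<and> fst (c i) \<le> s} \<and> fst q = {i. i < m \<and> s < fst (c i) \<and> fst (c i) \<le> t}
      \<and> (\<forall>i<m. a < fst (c i) \<and> fst (c i) < b)"
    if q: "q \<in> J" and c: "bead_times m c \<in> PiE ?I (A (snd q) (fst q))" for q c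
  proof -
    have h: "\<forall>i<m. a < fst (c i) \<and> fst (c i) < b \<and> (i \<in> snd q \<longleftrightarrow> fst (c i) \<le> s)
      \<and> (i \<in> fst q \<longleftrightarrow> s < fst (c i) \<and> fst (c i) \<le> t)"
      using c inA[OF disjST[OF q], of c] unfolding bead_times_in_box by simp
    have "\<forall>i\<in>snd q. i < m" "\<forall>i\<in>fst q. i < m" using sub[OF q] by auto
    then show ?thesis using h by blast
  qed
  have CK: "?C = (\<Union>q\<in>J. K q)"
  proof (intro equalityI subsetI)
    fix c assume "c \<in> ?C"
    then obtain p where c: "c \<in> space ?M" "\<forall>i<m. a < fst (c i) \<and> fst (c i) < b" and p: "time_order m (fst \<circ> c) p"
      and w: "hop_walk n (X a) (strings_at c p (\<lambda>x. x \<le> s)) G" "hop_walk n G (strings_at c p (\<lambda>x. s < x \<and> x \<le> t)) H"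
        "hop_walk n H (strings_at c p (\<lambda>x. t < x)) (X b)"
      unfolding configs_cyl_eq[OF X ab n2 nojump m st] by blast
    define S where "S = {i. i < m \<and> fst (c i) \<le> s}"
    define T where "T = {i. i < m \<and> s < fst (c i) \<and> fst (c i) \<le> t}"
    have q: "(T, S) \<in> J" by (auto simp: J_def S_def T_def)
    have "V (card S) (card T) (map (snd \<circ> c) p)"
      unfolding V_def using w unfolding strings_at_parts[OF p st(2) S_def T_def] by blast
    moreover have "bead_times m c \<in> PiE ?I (A S T)"
    proof -
      have "S \<inter> T = {}" by (auto simp: S_def T_def)
      from inA[OF this, of c] show ?thesis unfolding bead_times_in_box using c(2) by (simp add: S_def T_def)
    qed
    ultimately have "c \<in> K (T, S)" using c(1) p by (auto simp: K_def)
    then show "c \<in> (\<Union>q\<in>J. K q)" using q by blast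
  next
    fix c assume "c \<in> (\<Union>q\<in>J. K q)"
    then obtain q p where q: "q \<in> J" and c: "c \<in> space ?M" "bead_times m c \<in> PiE ?I (A (snd q) (fst q))"
      and p: "time_order m (fst \<circ> c) p" and v: "V (card (snd q)) (card (fst q)) (map (snd \<circ> c) p)"
      unfolding K_def by blast
    note r = recover[OF q c(2)]
    note parts = strings_at_parts[OF p st(2) conjunct1[OF r] conjunct1[OF conjunct2[OF r]]]
    show "c \<in> ?C"
      unfolding configs_cyl_eq[OF X ab n2 nojump m st]
      using c(1) r p v unfolding V_def parts[symmetric] by blast
  qed
  have K: "K q \<in> sets ?M" "emeasure ?M (K q) = of_nat (walks n (card (snd q)) (X a) G *
      (walks n (card (fst q)) G H * walks n (m - card (snd q) - card (fst q)) H (X b))) *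
      ennreal ((s - a) ^ card (snd q) * (t - s) ^ card (fst q) * (b - t) ^ (m - card (snd q) - card (fst q)))" if q: "q \<in> J" for q
  proof -
    have "card (snd q) + card (fst q) = card (snd q \<union> fst q)"
      using disjST[OF q] sub[OF q] by (intro card_Un_disjoint[symmetric]) (auto intro: finite_subset)
    also have "\<dots> \<le> card ?I" using sub[OF q] by (intro card_mono) auto
    finally have le: "card (snd q) + card (fst q) \<le> m" by simp
    show "K q \<in> sets ?M" unfolding K_def by (rule emeasure_ordered_tuples(1)[OF box(1)[OF q]])
    show "emeasure ?M (K q) = of_nat (walks n (card (snd q)) (X a) G *
      (walks n (card (fst q)) G H * walks n (m - card (snd q) - card (fst q)) H (X b))) *
      ennreal ((s - a) ^ card (snd q) * (t - s) ^ card (fst q) * (b - t) ^ (m - card (snd q) - card (fst q)))"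
      unfolding K_def emeasure_ordered_tuples(2)[OF box(1)[OF q], where n = n and V = "V (card (snd q)) (card (fst q))"] box(2)[OF q]
      unfolding V_def card_three_walks[OF occ(1) GH le] ..
  qed
  show "?C \<in> sets ?M" unfolding CK using K(1) finJ by (intro sets.finite_UN) auto
  have disj: "disjoint_family_on K J"
    unfolding disjoint_family_on_def
  proof (intro ballI impI, rule ccontr)
    fix q q' assume q: "q \<in> J" "q' \<in> J" "q \<noteq> q'" "K q \<inter> K q' \<noteq> {}"
    then obtain c where "bead_times m c \<in> PiE ?I (A (snd q) (fst q))" "bead_times m c \<in> PiE ?I (A (snd q') (fst q'))"
      unfolding K_def by blast
    from recover[OF q(1) this(1)] recover[OF q(2) this(2)] have "snd q = snd q'" "fst q = fst q'" by simp_all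
    then show False using q(3) by (simp add: prod_eq_iff)
  qed
  define f where "f j i = (s - a) ^ i * (t - s) ^ j * (b - t) ^ (m - i - j) *
            real (walks n i (X a) G * (walks n j G H * walks n (m - i - j) H (X b)))" for i j
  have f0: "f j i \<ge> 0" for i j using st by (simp add: f_def)
  have "emeasure ?M ?C = (\<Sum>q\<in>J. emeasure ?M (K q))"
    unfolding CK using K(1) disj finJ by (intro sum_emeasure[symmetric]) auto
  also have "\<dots> = (\<Sum>q\<in>J. ennreal (f (card (fst q)) (card (snd q))))"
  proof (rule sum.cong[OF refl])
    fix q assume "q \<in> J"
    then show "emeasure ?M (K q) = ennreal (f (card (fst q)) (card (snd q)))"
      using st unfolding K(2)[OF \<open>q \<in> J\<close>] f_def by (simp only: ennreal_of_nat_eq_real_of_nat) (simp add: ennreal_mult' mult.commute)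
  qed
  also have "\<dots> = ennreal (\<Sum>q\<in>J. f (card (fst q)) (card (snd q)))"
    by (rule sum_ennreal) (rule f0)
  also have "(\<Sum>q\<in>J. f (card (fst q)) (card (snd q))) = (\<Sum>T\<in>Pow ?I. \<Sum>S\<in>Pow (?I - T). f (card T) (card S))"
    unfolding J_def by (subst sum.Sigma) (auto simp: case_prod_unfold)
  also have "\<dots> = (\<Sum>T\<in>Pow ?I. \<Sum>i\<le>m - card T. real ((m - card T) choose i) * f (card T) i)"
  proof (rule sum.cong[OF refl])
    fix T assume "T \<in> Pow ?I"
    then have "card (?I - T) = m - card T" by (simp add: card_Diff_subset finite_subset)
    then show "(\<Sum>S\<in>Pow (?I - T). f (card T) (card S)) = (\<Sum>i\<le>m - card T. real ((m - card T) choose i) * f (card T) i)"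
      using sum_Pow_card[of "?I - T" "f (card T)"] by simp
  qed
  also have "\<dots> = (\<Sum>j\<le>m. real (m choose j) * (\<Sum>i\<le>m - j. real ((m - j) choose i) * f j i))"
    using sum_Pow_card[of ?I "\<lambda>j. \<Sum>i\<le>m - j. real ((m - j) choose i) * f j i"] by simp
  finally show "emeasure ?M ?C = ennreal (\<Sum>j\<le>m. real (m choose j) * (\<Sum>i\<le>m - j. real ((m - j) choose i) *
          ((s - a) ^ i * (t - s) ^ j * (b - t) ^ (m - i - j) *
            real (walks n i (X a) G * (walks n j G H * walks n (m - i - j) H (X b))))))"
    by (simp only: f_def)
qed

text \<open>All powers of \<open>lam\<close> and all intermediate weights cancel: the bridges of the
  Doob transform are the uniform bridges of the hop graph.\<close>

lemma ker_telescope: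
  assumes "E \<in> occ" "G \<in> occ" "H \<in> occ" "F \<in> occ" "i + j + k = m"
  shows "ker j G H * (ker i E G * ker k H F) / ker m E F
    = real (walks n i E G * (walks n j G H * walks n k H F)) / real (walks n m E F)"
  using assms(5)[symmetric] occ_facts(5)[OF assms(1)] occ_facts(5)[OF assms(2)] occ_facts(5)[OF assms(3)] occ_facts(5)[OF assms(4)] lam_pos
  by (simp add: ker_def power_add field_simps)

lemma uniform_beads_cyl:
  assumes X: "X \<in> bead_paths n l" and ab: "a < b" and nojump: "left_lim X b = X b"
    and m: "m = card (beads_in n a b X)" and st: "a < s" "s \<le> t" "t < b" and GH: "G \<in> occ" "H \<in> occ"
  shows "measure (uniform_beads n l a b X m) (configs n l a b X m {Y \<in> bead_paths n l. Y s = G \<and> Y t = H})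
    = bridge m ((s - a) / ((s - a) + (b - t))) ((t - s) / (b - a)) (X a) G H (X b)"
    and "ker m (X a) (X b) \<noteq> 0"
proof -
  let ?M = "tuple_measure n m" and ?U = "configs n l a b X m UNIV"
  let ?C = "configs n l a b X m {Y \<in> bead_paths n l. Y s = G \<and> Y t = H}"
  have occ: "X a \<in> occ" "X b \<in> occ" using bead_paths_D(1)[OF X] by blast+
  note U = emeasure_configs_UNIV[OF X ab nojump m]
  note C = emeasure_configs_cyl[OF X ab nojump m less_imp_le[OF st(1)] st(2,3) GH]
  show kpos: "ker m (X a) (X b) \<noteq> 0"
    using U(3) occ_facts(5)[OF occ(1)] occ_facts(5)[OF occ(2)] lam_pos by (simp add: ker_def)
  \<comment> \<open>The length outside the interval from \<open>s\<close> to \<open>t\<close>. Since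
    \<open>1 - q = r / D\<close>, the powers of \<open>r\<close> introduced by \<open>p\<close>
    cancel.\<close>
  define r where "r = (s - a) + (b - t)"
  define D where "D = b - a"
  define p where "p = (s - a) / r"
  define q where "q = (t - s) / D"
  have r: "r > 0" "D > 0" using st by (auto simp: r_def D_def)
  have p1: "1 - p = (b - t) / r" "1 - q = r / D" using r by (auto simp: p_def q_def r_def D_def field_simps)
  have CU: "?C \<subseteq> ?U" by (auto simp: configs_def)
  define w where "w = real (walks n m (X a) (X b))"
  have w: "w > 0" using U(3) by (simp add: w_def)
  define N where "N = (\<Sum>j\<le>m. real (m choose j) * (\<Sum>i\<le>m - j. real ((m - j) choose i) *
          ((s - a) ^ i * (t - s) ^ j * (b - t) ^ (m - i - j) *
            real (walks n i (X a) G * (walks n j G H * walks n (m - i - j) H (X b))))))"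
  have N0: "N \<ge> 0" unfolding N_def using st by (intro sum_nonneg mult_nonneg_nonneg) auto
  have "emeasure (uniform_beads n l a b X m) ?C = emeasure ?M (?U \<inter> ?C) / emeasure ?M ?U"
    unfolding uniform_beads_def using U(1) C(1) by (rule emeasure_uniform_measure)
  also have "?U \<inter> ?C = ?C" using CU by blast
  also have "emeasure ?M ?C / emeasure ?M ?U = ennreal (N / (w * D ^ m))"
    unfolding U(2) C(2) N_def[symmetric] w_def[symmetric] D_def[symmetric] using w r N0 by (intro divide_ennreal) simp_all
  finally have "measure (uniform_beads n l a b X m) ?C = N / (w * D ^ m)"
    using w r N0 by (simp add: measure_def)
  also have "\<dots> = bridge m p q (X a) G H (X b)"
  proof -
    have term_eq: "real (m choose j) * (real ((m - j) choose i) *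
          ((s - a) ^ i * (t - s) ^ j * (b - t) ^ (m - i - j) *
            real (walks n i (X a) G * (walks n j G H * walks n (m - i - j) H (X b))))) / (w * D ^ m)
        = real (m choose j) * q ^ j * (1 - q) ^ (m - j) * (ker j G H * (real ((m - j) choose i) * p ^ i * (1 - p) ^ (m - j - i) *
            (ker i (X a) G * ker (m - j - i) H (X b)))) / ker m (X a) (X b)"
      if ij: "j \<le> m" "i \<le> m - j" for i j
    proof -
      have mij: "m - i - j = m - j - i" by simp
      have sum: "i + j + (m - j - i) = m" using ij by simp
      have scale: "q ^ j * (1 - q) ^ (m - j) * (p ^ i * (1 - p) ^ (m - j - i)) = (s - a) ^ i * (t - s) ^ j * (b - t) ^ (m - j - i) / D ^ m"
      proof -
        have e1: "r ^ (m - j) = r ^ i * r ^ (m - j - i)" using ij by (simp flip: power_add)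
        have e2: "D ^ m = D ^ j * D ^ (m - j)" using ij by (simp flip: power_add)
        show ?thesis unfolding p1 unfolding p_def q_def power_divide e1 e2 using r by (simp add: field_simps)
      qed
      have tele: "ker j G H * (ker i (X a) G * ker (m - j - i) H (X b)) / ker m (X a) (X b)
          = real (walks n i (X a) G * (walks n j G H * walks n (m - j - i) H (X b))) / w"
        unfolding w_def by (rule ker_telescope[OF occ(1) GH occ(2) sum])
      have "real (m choose j) * q ^ j * (1 - q) ^ (m - j) * (ker j G H * (real ((m - j) choose i) * p ^ i * (1 - p) ^ (m - j - i) *
            (ker i (X a) G * ker (m - j - i) H (X b)))) / ker m (X a) (X b)
          = real (m choose j) * real ((m - j) choose i) * (q ^ j * (1 - q) ^ (m - j) * (p ^ i * (1 - p) ^ (m - j - i)))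
            * (ker j G H * (ker i (X a) G * ker (m - j - i) H (X b)) / ker m (X a) (X b))"
        by (simp only: times_divide_eq_right mult_ac)
      also have "\<dots> = real (m choose j) * real ((m - j) choose i) * ((s - a) ^ i * (t - s) ^ j * (b - t) ^ (m - j - i) / D ^ m)
            * (real (walks n i (X a) G * (walks n j G H * walks n (m - j - i) H (X b))) / w)"
        by (simp only: scale tele)
      finally show ?thesis unfolding mij by (simp add: mult_ac)
    qed
    have "N / (w * D ^ m) = (\<Sum>j\<le>m. \<Sum>i\<le>m - j. real (m choose j) * (real ((m - j) choose i) *
          ((s - a) ^ i * (t - s) ^ j * (b - t) ^ (m - i - j) *
            real (walks n i (X a) G * (walks n j G H * walks n (m - i - j) H (X b))))) / (w * D ^ m))"
      unfolding N_def by (simp only: sum_divide_distrib sum_distrib_left)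
    also have "\<dots> = (\<Sum>j\<le>m. \<Sum>i\<le>m - j. real (m choose j) * q ^ j * (1 - q) ^ (m - j) * (ker j G H * (real ((m - j) choose i) * p ^ i * (1 - p) ^ (m - j - i) *
            (ker i (X a) G * ker (m - j - i) H (X b)))) / ker m (X a) (X b))"
      by (intro sum.cong refl term_eq) auto
    also have "\<dots> = bridge m p q (X a) G H (X b)"
      unfolding bridge_def two_sided_def by (simp only: sum_divide_distrib sum_distrib_left)
    finally show ?thesis .
  qed
  finally show "measure (uniform_beads n l a b X m) ?C
      = bridge m ((s - a) / ((s - a) + (b - t))) ((t - s) / (b - a)) (X a) G H (X b)"
    by (simp only: p_def q_def r_def D_def)
qed

end

section \<open>Measurability of the number of beads\<close>

lemma space_bead_space: "space (bead_space n l) = bead_paths n l"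
  unfolding bead_space_def by (rule space_measure_of) auto

lemma sets_bead_space:
  "sets (bead_space n l) = sigma_sets (bead_paths n l) {{X \<in> bead_paths n l. X t = E} | t E. True}"
  unfolding bead_space_def by (rule sets_measure_of) auto

lemma cyl_sets: "{X \<in> bead_paths n l. X t = E} \<in> sets (bead_space n l)"
  unfolding sets_bead_space by (rule sigma_sets.Basic) blast

lemma agree_sets: "{X \<in> bead_paths n l. X s = X t} \<in> sets (bead_space n l)"
proof -
  have "{X \<in> bead_paths n l. X s = X t}
      = (\<Union>E\<in>occupied_sets n l. {X \<in> bead_paths n l. X s = E} \<inter> {X \<in> bead_paths n l. X t = E})"
    using bead_paths_D(1) by auto
  also have "\<dots> \<in> sets (bead_space n l)"
    by (rule sets.finite_UN[OF finite_occupied_sets]) (rule sets.Int[OF cyl_sets cyl_sets])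
  finally show ?thesis .
qed

lemma disagree_sets: "{X \<in> bead_paths n l. X s \<noteq> X t} \<in> sets (bead_space n l)"
proof -
  have "{X \<in> bead_paths n l. X s \<noteq> X t} = space (bead_space n l) - {X \<in> bead_paths n l. X s = X t}"
    by (auto simp: space_bead_space)
  also have "\<dots> \<in> sets (bead_space n l)" by (rule sets.compl_sets[OF agree_sets])
  finally show ?thesis .
qed

lemma filterlim_approach_left: "filterlim (\<lambda>k. b - inverse (real (Suc k))) (at_left b) sequentially"
proof -
  have "(\<lambda>k. b - inverse (real (Suc k))) \<longlonglongrightarrow> b - 0"
    by (intro tendsto_intros LIMSEQ_inverse_real_of_nat)
  then show ?thesis unfolding filterlim_at by simp
qed

text \<open>Left limits exist on \<open>bead_paths\<close>, so a single sequence approaching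
  \<open>b\<close> decides them, and the event reduces to countably many comparisons of the path at
  fixed times.\<close>

lemma jump_sets: "{X \<in> bead_paths n l. left_lim X b \<noteq> X b} \<in> sets (bead_space n l)"
proof -
  have iff: "left_lim X b = X b \<longleftrightarrow> (\<exists>N. \<forall>k\<in>{N..}. X (b - inverse (real (Suc k))) = X b)"
    if X: "X \<in> bead_paths n l" for X
  proof -
    have "\<forall>\<^sub>F k in sequentially. X (b - inverse (real (Suc k))) = left_lim X b"
      using filterlim_approach_left eventually_left_lim[OF X] by (rule eventually_compose_filterlim[rotated])
    then obtain N where N: "\<And>k. k \<ge> N \<Longrightarrow> X (b - inverse (real (Suc k))) = left_lim X b"
      by (auto simp: eventually_sequentially)
    show ?thesis
    proof
      assume "left_lim X b = X b"
      then show "\<exists>N. \<forall>k\<in>{N..}. X (b - inverse (real (Suc k))) = X b" using N by (intro exI[of _ N]) simp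
    next
      assume "\<exists>N. \<forall>k\<in>{N..}. X (b - inverse (real (Suc k))) = X b"
      then obtain N' where "\<forall>k\<in>{N'..}. X (b - inverse (real (Suc k))) = X b" by blast
      then have "X (b - inverse (real (Suc (max N N')))) = X b" by simp
      then show "left_lim X b = X b" using N[of "max N N'"] by simp
    qed
  qed
  have "{X \<in> bead_paths n l. left_lim X b \<noteq> X b}
      = space (bead_space n l) - (\<Union>N. \<Inter>k\<in>{N..}. {X \<in> bead_paths n l. X (b - inverse (real (Suc k))) = X b})"
  proof (intro equalityI subsetI)
    fix X assume "X \<in> {X \<in> bead_paths n l. left_lim X b \<noteq> X b}"
    then show "X \<in> space (bead_space n l) - (\<Union>N. \<Inter>k\<in>{N..}. {X \<in> bead_paths n l. X (b - inverse (real (Suc k))) = X b})"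
      using iff[of X] by (simp add: space_bead_space)
  next
    fix X assume "X \<in> space (bead_space n l) - (\<Union>N. \<Inter>k\<in>{N..}. {X \<in> bead_paths n l. X (b - inverse (real (Suc k))) = X b})"
    then have "X \<in> bead_paths n l" "\<not> (\<exists>N. \<forall>k\<in>{N..}. X (b - inverse (real (Suc k))) = X b)"
      unfolding space_bead_space by blast+
    then show "X \<in> {X \<in> bead_paths n l. left_lim X b \<noteq> X b}" using iff[of X] by blast
  qed
  also have "\<dots> \<in> sets (bead_space n l)"
  proof (rule sets.compl_sets, rule sets.countable_UN, rule image_subsetI)
    fix N :: nat
    show "(\<Inter>k\<in>{N..}. {X \<in> bead_paths n l. X (b - inverse (real (Suc k))) = X b}) \<in> sets (bead_space n l)"
      by (rule sets.countable_INT') (auto simp: agree_sets)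
  qed
  finally show ?thesis .
qed

lemma beads_in_mono: "b \<le> b' \<Longrightarrow> beads_in n a b X \<subseteq> beads_in n a b' X"
  by (auto simp: beads_in_def)

text \<open>Rational times isolate the last bead: a change of state between \<open>q\<close> and
  \<open>q'\<close> betrays at least one bead there, with \<open>m\<close> beads before
  \<open>q\<close>. Recursively, counting beads needs only the path at countably many times.\<close>

lemma card_beads_Suc_iff:
  assumes X: "X \<in> bead_paths n l"
  shows "Suc m \<le> card (beads_in n a b X) \<longleftrightarrow>
    (\<exists>q q' :: rat. a < of_rat q \<and> of_rat q < (of_rat q' :: real) \<and> of_rat q' < b \<and> X (of_rat q) \<noteq> X (of_rat q')
      \<and> m \<le> card (beads_in n a (of_rat q) X))" (is "?L \<longleftrightarrow> ?R")
proof
  assume ?R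
  then obtain q q' :: real where q: "a < q" "q < q'" "q' < b" "X q \<noteq> X q'" "m \<le> card (beads_in n a q X)" by blast
  have "\<exists>t. q < t \<and> t \<le> q' \<and> left_lim X t \<noteq> X t"
    using bead_path_const[OF X less_imp_le[OF q(2)]] q(4) by metis
  then obtain t h where t: "q < t" "t \<le> q'" and th: "(t, h) \<in> beads n X"
    using beads_iff_jump[OF X] by metis
  have "h < n" using beads_string_less[OF X th] .
  then have "insert (t, h) (beads_in n a q X) \<subseteq> beads_in n a b X"
    using th t q beads_in_mono[of q b n a X] by (auto simp: beads_in_def)
  then have "card (insert (t, h) (beads_in n a q X)) \<le> card (beads_in n a b X)"
    by (rule card_mono[OF finite_beads_in[OF X]])
  moreover have "(t, h) \<notin> beads_in n a q X" using t by (simp add: beads_in_def)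
  ultimately show ?L using q(5) finite_beads_in[OF X, of a q] by simp
next
  assume L: ?L
  let ?B = "beads_in n a b X"
  have fin: "finite ?B" by (rule finite_beads_in[OF X])
  have ne: "fst ` ?B \<noteq> {}" using L by auto
  \<comment> \<open>The last bead. The rational times will be so close to it that the path shows its
    left limit and its value there, and all other beads lie earlier.\<close>
  define t where "t = Max (fst ` ?B)"
  have "t \<in> fst ` ?B" unfolding t_def using fin ne by (intro Max_in) auto
  then obtain h where th: "(t, h) \<in> ?B" by auto
  have le: "fst x \<le> t" if "x \<in> ?B" for x unfolding t_def using fin that by (intro Max_ge) auto
  define B' where "B' = ?B - {(t, h)}"
  have B': "finite B'" "m \<le> card B'" using fin L th by (auto simp: B'_def)
  have t: "a < t" "t < b" "hop n (left_lim X t) h (X t)" using th by (auto simp: beads_in_def beads_def)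
  have lt: "fst x < t" if x: "x \<in> B'" for x
  proof (rule ccontr)
    assume "\<not> fst x < t"
    then have "fst x = t" using le[of x] x by (simp add: B'_def)
    then have "hop n (left_lim X t) (snd x) (X t)" using x by (auto simp: B'_def beads_in_def beads_def)
    then have "snd x = h" using t(3) by (rule hop_string_unique)
    then have "x = (t, h)" using \<open>fst x = t\<close> by (simp add: prod_eq_iff)
    then show False using x by (simp add: B'_def)
  qed
  have "\<forall>\<^sub>F s in at_left t. \<forall>x\<in>B'. fst x < s"
  proof (intro eventually_ball_finite B'(1) ballI)
    fix x assume "x \<in> B'"
    then show "\<forall>\<^sub>F s in at_left t. fst x < s"
      unfolding eventually_at_left_field using lt[of x] by (intro exI[of _ "fst x"]) simp
  qed
  moreover have "\<forall>\<^sub>F s in at_left t. a < s"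
    unfolding eventually_at_left_field using t(1) by (intro exI[of _ a]) simp
  ultimately have "\<forall>\<^sub>F s in at_left t. X s = left_lim X t \<and> a < s \<and> (\<forall>x\<in>B'. fst x < s)"
    using eventually_left_lim[OF X, of t] by eventually_elim blast
  then obtain \<beta> where \<beta>: "\<beta> < t" "\<And>s. \<beta> < s \<Longrightarrow> s < t \<Longrightarrow> X s = left_lim X t \<and> a < s \<and> (\<forall>x\<in>B'. fst x < s)"
    unfolding eventually_at_left_field by blast
  obtain q :: rat where q: "\<beta> < of_rat q" "of_rat q < t" using of_rat_dense[OF \<beta>(1)] by blast
  have "\<forall>\<^sub>F s in at_right t. s < b"
    unfolding eventually_at_right_field using t(2) by (intro exI[of _ b]) simp
  then have "\<forall>\<^sub>F s in at_right t. X s = X t \<and> s < b"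
    using bead_paths_D(2)[OF X, of t] by eventually_elim blast
  then obtain \<gamma> where \<gamma>: "t < \<gamma>" "\<And>s. t < s \<Longrightarrow> s < \<gamma> \<Longrightarrow> X s = X t \<and> s < b"
    unfolding eventually_at_right_field by blast
  obtain q' :: rat where q': "t < of_rat q'" "of_rat q' < \<gamma>" using of_rat_dense[OF \<gamma>(1)] by blast
  have "X (of_rat q) \<noteq> X (of_rat q')" using \<beta>(2)[OF q] \<gamma>(2)[OF q'] hop_neq[OF t(3)] by metis
  moreover have "m \<le> card (beads_in n a (of_rat q) X)"
  proof -
    have "B' \<subseteq> beads_in n a (of_rat q) X"
    proof
      fix x assume x: "x \<in> B'"
      then have "fst x < of_rat q" using \<beta>(2)[OF q] by blast
      moreover have "x \<in> ?B" using x by (simp add: B'_def)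
      ultimately show "x \<in> beads_in n a (of_rat q) X" by (cases x) (simp add: beads_in_def)
    qed
    then show ?thesis using B'(2) card_mono[OF finite_beads_in[OF X]] by (meson le_trans)
  qed
  moreover have "a < of_rat q" "(of_rat q :: real) < of_rat q'" "of_rat q' < b"
    using \<beta>(2)[OF q] \<gamma>(2)[OF q'] q(2) q'(1) by linarith+
  ultimately show ?R by blast
qed

lemma card_beads_ge_sets: "{X \<in> bead_paths n l. m \<le> card (beads_in n a b X)} \<in> sets (bead_space n l)"
proof (induction m arbitrary: b)
  case 0
  have "{X \<in> bead_paths n l. 0 \<le> card (beads_in n a b X)} = space (bead_space n l)" by (simp add: space_bead_space)
  then show ?case by (simp only: sets.top)
next
  case (Suc m)
  define S where "S r = (if a < of_rat (fst r) \<and> of_rat (fst r) < (of_rat (snd r) :: real) \<and> of_rat (snd r) < b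
    then {X \<in> bead_paths n l. X (of_rat (fst r)) \<noteq> X (of_rat (snd r))} \<inter> {X \<in> bead_paths n l. m \<le> card (beads_in n a (of_rat (fst r)) X)}
    else {})" for r :: "rat \<times> rat"
  have "{X \<in> bead_paths n l. Suc m \<le> card (beads_in n a b X)} = (\<Union>r. S r)"
  proof (intro equalityI subsetI)
    fix X assume "X \<in> {X \<in> bead_paths n l. Suc m \<le> card (beads_in n a b X)}"
    then have X: "X \<in> bead_paths n l" "Suc m \<le> card (beads_in n a b X)" by auto
    from X(2) obtain q q' :: rat where "a < of_rat q" "of_rat q < (of_rat q' :: real)" "of_rat q' < b" "X (of_rat q) \<noteq> X (of_rat q')"
      "m \<le> card (beads_in n a (of_rat q) X)" unfolding card_beads_Suc_iff[OF X(1)] by blast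
    then have "X \<in> S (q, q')" using X(1) by (simp add: S_def)
    then show "X \<in> (\<Union>r. S r)" by blast
  next
    fix X assume "X \<in> (\<Union>r. S r)"
    then obtain r where r: "X \<in> S r" by blast
    then have "a < of_rat (fst r) \<and> of_rat (fst r) < (of_rat (snd r) :: real) \<and> of_rat (snd r) < b \<and>
      X \<in> bead_paths n l \<and> X (of_rat (fst r)) \<noteq> X (of_rat (snd r)) \<and> m \<le> card (beads_in n a (of_rat (fst r)) X)"
      by (simp add: S_def split: if_splits)
    then show "X \<in> {X \<in> bead_paths n l. Suc m \<le> card (beads_in n a b X)}" using card_beads_Suc_iff[of X n l m a b] by blast
  qed
  also have "\<dots> \<in> sets (bead_space n l)"
  proof (rule sets.countable_UN, rule image_subsetI)
    fix r show "S r \<in> sets (bead_space n l)"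
      unfolding S_def using Suc.IH disagree_sets by (simp add: sets.Int)
  qed
  finally show ?case .
qed

lemma card_beads_sets: "{X \<in> bead_paths n l. card (beads_in n a b X) = m} \<in> sets (bead_space n l)"
proof -
  have "{X \<in> bead_paths n l. card (beads_in n a b X) = m}
      = {X \<in> bead_paths n l. m \<le> card (beads_in n a b X)} - {X \<in> bead_paths n l. Suc m \<le> card (beads_in n a b X)}"
    by auto
  also have "\<dots> \<in> sets (bead_space n l)" by (rule sets.Diff[OF card_beads_ge_sets card_beads_ge_sets])
  finally show ?thesis .
qed

text \<open>\<open>real_cond_exp\<close> has its usual properties only for a subalgebra, so the bead
  counts must be measurable before the Gibbs property can be integrated.\<close>

lemma outside_subalgebra:
  assumes "space P = bead_paths n l" "sets P = sets (bead_space n l)"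
  shows "subalgebra P (outside_algebra n l a b)"
proof -
  let ?G = "{{X \<in> bead_paths n l. X s = E} | s E. s \<notin> {a<..<b}} \<union>
      {{X \<in> bead_paths n l. card (beads_in n a b X) = m} | m. True}"
  have G: "?G \<subseteq> Pow (bead_paths n l)" by auto
  have "?G \<subseteq> sets (bead_space n l)" using cyl_sets card_beads_sets by auto
  then have "sigma_sets (space (bead_space n l)) ?G \<subseteq> sets (bead_space n l)" by (rule sets.sigma_sets_subset)
  then have "sets (outside_algebra n l a b) \<subseteq> sets (bead_space n l)"
    unfolding outside_algebra_def sets_measure_of[OF G] space_bead_space .
  moreover have "space (outside_algebra n l a b) = bead_paths n l"
    unfolding outside_algebra_def by (rule space_measure_of[OF G])
  ultimately show ?thesis using assms by (simp add: subalgebra_def)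
qed

section \<open>Gibbs measures\<close>

text \<open>The density is at most \<open>\<infinity>\<close>, and \<open>\<infinity>\<close> on a
  null set still integrates to 0, whatever the normalising volume is. A set \<open>B\<close> that is
  not measurable has measure 0 by convention, so the lemma covers sets of configurations whose
  measurability is not established.\<close>

lemma null_uniform_measure:
  assumes N: "N \<in> null_sets M" and B: "B \<subseteq> N"
  shows "measure (uniform_measure M A) B = 0"
proof -
  let ?f = "\<lambda>x. indicator A x / emeasure M A"
  have "(\<integral>\<^sup>+ x. ?f x * indicator N x \<partial>M) \<le> (\<integral>\<^sup>+ x. \<infinity> * indicator N x \<partial>M)"
    by (intro nn_integral_mono mult_right_mono) simp_all
  also have "\<dots> = 0" using N by (simp add: nn_integral_cmult_indicator null_setsD1 null_setsD2)
  finally have z: "(\<integral>\<^sup>+ x. ?f x * indicator N x \<partial>M) = 0" by simp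
  have N0: "emeasure (uniform_measure M A) N = 0"
    unfolding uniform_measure_def density_def emeasure_measure_of_conv using z by simp
  have "emeasure (uniform_measure M A) B = 0"
  proof (cases "B \<in> sets (uniform_measure M A)")
    case True
    have "N \<in> sets (uniform_measure M A)" using N by (simp add: null_setsD2)
    then have "emeasure (uniform_measure M A) B \<le> emeasure (uniform_measure M A) N" using B by (intro emeasure_mono)
    then show ?thesis using N0 by simp
  qed (rule emeasure_notin_sets)
  then show ?thesis by (simp add: measure_def)
qed

lemma null_fixed_time:
  "\<exists>N \<in> null_sets (tuple_measure n m). {c \<in> space (tuple_measure n m). \<exists>i<m. fst (c i) = b} \<subseteq> N"
proof -
  interpret cs: sigma_finite_measure "count_space {..<n}"
    by (rule sigma_finite_measure_count_space_finite) simp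
  interpret pr: pair_sigma_finite "lborel :: real measure" "count_space {..<n}" ..
  interpret tp: product_sigma_finite "\<lambda>_::nat. (lborel :: real measure) \<Otimes>\<^sub>M count_space {..<n}"
    by standard
  define B where "B i j = (if j = i then {b} else UNIV) \<times> {..<n}" for i j :: nat
  define N where "N i = PiE {..<m} (B i)" for i
  have B: "B i j \<in> sets (lborel \<Otimes>\<^sub>M count_space {..<n})" for i j
    unfolding B_def by (intro pair_measureI) auto
  have N: "N i \<in> null_sets (tuple_measure n m)" if i: "i \<in> {..<m}" for i
  proof -
    have "emeasure (tuple_measure n m) (N i) = (\<Prod>j<m. emeasure (lborel \<Otimes>\<^sub>M count_space {..<n}) (B i j))"
      unfolding tuple_measure_def N_def using B by (intro tp.emeasure_PiM) auto
    also have "\<dots> = 0"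
    proof (rule prod_zero)
      have Bi: "B i i = {b} \<times> {..<n}" by (simp add: B_def)
      have "emeasure (lborel \<Otimes>\<^sub>M count_space {..<n}) (B i i) = emeasure lborel {b} * emeasure (count_space {..<n}) {..<n}"
        unfolding Bi by (rule cs.emeasure_pair_measure_Times) auto
      then have "emeasure (lborel \<Otimes>\<^sub>M count_space {..<n}) (B i i) = 0" by simp
      then show "\<exists>j\<in>{..<m}. emeasure (lborel \<Otimes>\<^sub>M count_space {..<n}) (B i j) = 0" using i by blast
    qed simp
    finally have "emeasure (tuple_measure n m) (N i) = 0" .
    moreover have "N i \<in> sets (tuple_measure n m)"
      unfolding tuple_measure_def N_def using B by (intro sets_PiM_I_finite) auto
    ultimately show ?thesis by (simp add: null_sets_def)
  qed
  have "(\<Union>i\<in>{..<m}. N i) \<in> null_sets (tuple_measure n m)"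
    by (rule null_sets_UN') (use N in auto)
  moreover have "{c \<in> space (tuple_measure n m). \<exists>i<m. fst (c i) = b} \<subseteq> (\<Union>i\<in>{..<m}. N i)"
  proof
    fix c assume "c \<in> {c \<in> space (tuple_measure n m). \<exists>i<m. fst (c i) = b}"
    then obtain i where c: "c \<in> space (tuple_measure n m)" and i: "i < m" "fst (c i) = b" by blast
    have "c \<in> PiE {..<m} (\<lambda>_. space (lborel \<Otimes>\<^sub>M count_space {..<n}))"
      using c unfolding tuple_measure_def space_PiM .
    have "c \<in> N i" unfolding N_def
    proof (rule PiE_I)
      fix j assume "j \<in> {..<m}"
      then have "c j \<in> space (lborel \<Otimes>\<^sub>M count_space {..<n})"
        using measurable_space[OF tuple_component_measurable[of j m n] c] by simp
      then have "snd (c j) < n" by (simp add: space_pair_measure mem_Times_iff)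
      then show "c j \<in> B i j" using i by (simp add: B_def mem_Times_iff)
    next
      fix j assume "j \<notin> {..<m}"
      then show "c j = undefined" by (rule PiE_arb[OF \<open>c \<in> PiE {..<m} _\<close>])
    qed
    then show "c \<in> (\<Union>i\<in>{..<m}. N i)" using i by blast
  qed
  ultimately show ?thesis by blast
qed

text \<open>Pigeonhole: infinitely many failures would contain a subsequence of failures with one
  fixed value of \<open>f\<close>. It is meant for the boundary states, which change with the window
  but take finitely many values.\<close>

lemma eventually_finite_range:
  fixes f :: "nat \<Rightarrow> 'a"
  assumes "finite S" "\<And>N. f N \<in> S"
    and sub: "\<And>\<sigma> y. strict_mono (\<sigma> :: nat \<Rightarrow> nat) \<Longrightarrow> (\<And>k. f (\<sigma> k) = y) \<Longrightarrow> \<forall>\<^sub>F k in sequentially. Q (\<sigma> k)"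
  shows "\<forall>\<^sub>F N in sequentially. Q N"
proof (rule ccontr)
  assume "\<not> (\<forall>\<^sub>F N in sequentially. Q N)"
  then have "\<exists>\<^sub>F N in sequentially. \<not> Q N" by (simp add: frequently_def)
  then have inf: "infinite {N. \<not> Q N}" by (simp add: frequently_cofinite[symmetric] cofinite_eq_sequentially)
  have "finite (f ` {N. \<not> Q N})" using assms(1,2) by (intro finite_subset[OF _ assms(1)]) blast
  from pigeonhole_infinite[OF inf this] obtain N0 where "infinite {N \<in> {N. \<not> Q N}. f N = f N0}" by blast
  from infinite_enumerate[OF this] obtain \<sigma> :: "nat \<Rightarrow> nat" where \<sigma>: "strict_mono \<sigma>"
    "\<forall>k. \<sigma> k \<in> {N \<in> {N. \<not> Q N}. f N = f N0}" by blast
  have "\<forall>\<^sub>F k in sequentially. Q (\<sigma> k)" by (rule sub[OF \<sigma>(1)]) (use \<sigma>(2) in blast)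
  then have "\<forall>\<^sub>F k :: nat in sequentially. False" by eventually_elim (use \<sigma>(2) in blast)
  then show False by simp
qed

text \<open>The functions \<open>c N\<close> may fail to converge, but their excess
  \<open>d N\<close> over the tolerance \<open>K\<close> tends to 0. Dominated convergence with the
  bound \<open>1 + \<bar>v\<bar>\<close> carries this over to the expectations, which all equal
  \<open>e\<close>.\<close>

lemma (in prob_space) expectation_near:
  fixes c :: "nat \<Rightarrow> 'a \<Rightarrow> real"
  assumes meas: "\<And>N. c N \<in> borel_measurable M" and bnd: "\<And>N. AE x in M. 0 \<le> c N x \<and> c N x \<le> 1"
    and int: "\<And>N. (\<integral>x. c N x \<partial>M) = e" and K: "0 \<le> K"
    and near: "AE x in M. \<forall>k::nat. \<forall>\<^sub>F N in sequentially. \<bar>c N x - v\<bar> \<le> K + 1 / real (Suc k)"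
  shows "\<bar>e - v\<bar> \<le> K"
proof -
  define d where "d N x = max 0 (\<bar>c N x - v\<bar> - K)" for N x
  have dm: "d N \<in> borel_measurable M" for N unfolding d_def using meas by measurable
  have cint: "integrable M (c N)" for N
    by (rule integrable_const_bound[of _ 1]) (use bnd[of N] meas in auto)
  have dbnd: "AE x in M. norm (d N x) \<le> 1 + \<bar>v\<bar>" for N
    using bnd[of N]
  proof eventually_elim
    case (elim x)
    then have "\<bar>c N x - v\<bar> \<le> 1 + \<bar>v\<bar>" by linarith
    then show ?case using K by (simp add: d_def)
  qed
  have dlim: "AE x in M. (\<lambda>N. d N x) \<longlonglongrightarrow> 0"
    using near
  proof eventually_elim
    case (elim x)
    show ?case
    proof (rule tendstoI)
      fix r :: real assume "r > 0"
      then obtain k where k: "inverse (real (Suc k)) < r" using reals_Archimedean by blast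
      from elim have "\<forall>\<^sub>F N in sequentially. \<bar>c N x - v\<bar> \<le> K + 1 / real (Suc k)" by blast
      then show "\<forall>\<^sub>F N in sequentially. dist (d N x) 0 < r"
      proof eventually_elim
        case (elim N)
        then have "d N x \<le> inverse (real (Suc k))" by (simp add: d_def inverse_eq_divide)
        moreover have "0 \<le> d N x" by (simp add: d_def)
        ultimately show ?case using k by (simp add: dist_real_def)
      qed
    qed
  qed
  have "(\<lambda>N. \<integral>x. d N x \<partial>M) \<longlonglongrightarrow> (\<integral>x. 0 \<partial>M)"
    by (rule integral_dominated_convergence[where w = "\<lambda>_. 1 + \<bar>v\<bar>"]) (use dm dlim dbnd in auto)
  then have lim: "(\<lambda>N. (\<integral>x. d N x \<partial>M) + K) \<longlonglongrightarrow> 0 + K" by (intro tendsto_add tendsto_const) simp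
  have est: "\<bar>e - v\<bar> \<le> (\<integral>x. d N x \<partial>M) + K" for N
  proof -
    have dint: "integrable M (d N)" by (rule integrable_const_bound[OF dbnd dm])
    have "e - v = (\<integral>x. c N x - v \<partial>M)" using cint int[of N] by (simp add: prob_space)
    also have "\<bar>\<dots>\<bar> \<le> (\<integral>x. \<bar>c N x - v\<bar> \<partial>M)" by (rule integral_abs_bound)
    also have "\<dots> \<le> (\<integral>x. d N x + K \<partial>M)"
      using cint dint by (intro integral_mono) (auto simp: d_def)
    also have "\<dots> = (\<integral>x. d N x \<partial>M) + K" using dint by (simp add: prob_space)
    finally show ?thesis .
  qed
  show ?thesis using LIMSEQ_le_const[OF lim] est by (metis add_0)
qed

context bead_ring
begin

context
  fixes P :: "(real \<Rightarrow> nat set) measure"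
  assumes gibbs: "gibbs_measure n l P"
begin

lemma P_facts: "prob_space P" "space P = bead_paths n l" "sets P = sets (bead_space n l)"
  using gibbs by (simp_all add: gibbs_measure_def)

lemma cond_prob_configs:
  assumes "a < b" "A \<in> sets P"
  shows "AE X in P. real_cond_exp P (outside_algebra n l a b) (indicator A) X
    = measure (uniform_beads n l a b X (card (beads_in n a b X))) (configs n l a b X (card (beads_in n a b X)) A)"
  using gibbs assms unfolding gibbs_measure_def Let_def by blast

lemma cond_subalgebra: "finite_measure_subalgebra P (outside_algebra n l a b)"
proof -
  interpret prob_space P by (rule P_facts)
  show ?thesis by unfold_locales (rule outside_subalgebra[OF P_facts(2,3)])
qed

text \<open>Gibbs property on the interval from \<open>b - 1\<close> to \<open>b + 1\<close>:
  configurations with a bead at the prescribed time \<open>b\<close> lie in a null set, so the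
  conditional probability is 0 for every outside path. This provides windows without jumps at their
  ends.\<close>

lemma no_fixed_jump: "AE X in P. left_lim X b = X b"
proof -
  interpret prob_space P by (rule P_facts)
  interpret finite_measure_subalgebra P "outside_algebra n l (b - 1) (b + 1)" by (rule cond_subalgebra)
  let ?A = "{X \<in> bead_paths n l. left_lim X b \<noteq> X b}"
  have A: "?A \<in> sets P" unfolding P_facts(3) by (rule jump_sets)
  have zero: "measure (uniform_beads n l (b - 1) (b + 1) X m) (configs n l (b - 1) (b + 1) X m ?A) = 0" for X m
  proof -
    obtain N where N: "N \<in> null_sets (tuple_measure n m)" "{c \<in> space (tuple_measure n m). \<exists>i<m. fst (c i) = b} \<subseteq> N"
      using null_fixed_time[of n m b] by (rule bexE)
    have "configs n l (b - 1) (b + 1) X m ?A \<subseteq> N"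
    proof
      fix c assume "c \<in> configs n l (b - 1) (b + 1) X m ?A"
      then obtain Y where Y: "Y \<in> bead_paths n l" "left_lim Y b \<noteq> Y b" "beads_in n (b - 1) (b + 1) Y = c ` {..<m}"
        and c: "c \<in> space (tuple_measure n m)" unfolding configs_def by blast
      obtain h where h: "(b, h) \<in> beads n Y" using beads_iff_jump[OF Y(1), of b] Y(2) by blast
      then have "(b, h) \<in> beads_in n (b - 1) (b + 1) Y"
        using beads_string_less[OF Y(1) h] by (simp add: beads_in_def)
      then obtain i where "i < m" "c i = (b, h)" unfolding Y(3) by fastforce
      then have "\<exists>i<m. fst (c i) = b" by auto
      then show "c \<in> N" using N(2) c by blast
    qed
    then show ?thesis unfolding uniform_beads_def by (rule null_uniform_measure[OF N(1)])
  qed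
  have "AE X in P. real_cond_exp P (outside_algebra n l (b - 1) (b + 1)) (indicator ?A) X = 0"
    using cond_prob_configs[OF _ A, of "b - 1" "b + 1"] unfolding zero by simp
  then have "(\<integral>X. real_cond_exp P (outside_algebra n l (b - 1) (b + 1)) (indicator ?A) X \<partial>P) = (\<integral>X. 0 \<partial>P)"
    by (intro integral_cong_AE) auto
  moreover have "integrable P (indicator ?A :: _ \<Rightarrow> real)" using A by (simp add: emeasure_eq_measure)
  ultimately have "(\<integral>X. indicator ?A X \<partial>P) = (0::real)" using real_cond_exp_int(2) by simp
  then have "prob ?A = 0" using A by simp
  then have "AE X in P. X \<notin> ?A" using A by (intro AE_iff_measurable[THEN iffD2]) (auto simp: emeasure_eq_measure P_facts(2) intro: arg_cong[where f = prob])
  then show ?thesis using AE_space by eventually_elim (simp add: P_facts(2))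
qed

text \<open>The density counts beads in the closed window, the Gibbs property in the open one;
  without jumps at the ends the counts agree.\<close>

lemma card_beads_strings:
  assumes X: "X \<in> bead_paths n l" and ends: "left_lim X (- L) = X (- L)" "left_lim X L = X L"
  shows "(\<Sum>h<n. card (beads n X \<inter> ({- L..L} \<times> {h}))) = card (beads_in n (- L) L X)"
proof -
  have no: "(- L, h) \<notin> beads n X" "(L, h) \<notin> beads n X" for h
    using beads_iff_jump[OF X, of "- L"] beads_iff_jump[OF X, of L] ends by blast+
  have eq: "beads_in n (- L) L X = (\<Union>h\<in>{..<n}. beads n X \<inter> ({- L..L} \<times> {h}))"
  proof (intro equalityI subsetI)
    fix x assume "x \<in> beads_in n (- L) L X"
    then show "x \<in> (\<Union>h\<in>{..<n}. beads n X \<inter> ({- L..L} \<times> {h}))" by (cases x) (simp add: beads_in_def)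
  next
    fix x assume "x \<in> (\<Union>h\<in>{..<n}. beads n X \<inter> ({- L..L} \<times> {h}))"
    then obtain h where h: "h < n" "x \<in> beads n X" "x \<in> {- L..L} \<times> {h}" by blast
    then have "fst x \<noteq> - L" "fst x \<noteq> L" using no by (metis prod.collapse)+
    then show "x \<in> beads_in n (- L) L X" using h by (cases x) (simp add: beads_in_def)
  qed
  have fin: "finite (beads n X \<inter> ({- L..L} \<times> {h}))" if "h < n" for h
    by (rule finite_subset[OF _ finite_beads_in[OF X, of "- L" L]]) (use eq that in blast)
  show ?thesis unfolding eq using fin by (intro card_UN_disjoint[symmetric]) auto
qed

text \<open>Reduces a statement about probabilities to one about deterministic bridges. Hypothesis
  \<open>near\<close> concerns fixed end states and arbitrary admissible sequences, so it applies
  path by path along subsequences. Its clause on \<open>s = t\<close> lets one-time laws pass as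
  degenerate two-time laws.\<close>

lemma prob_near:
  assumes density: "has_bead_density n P (lam / real n)"
    and st: "s \<le> t" and GH: "G \<in> occ" "H \<in> occ" and K: "0 \<le> K"
    and near: "\<And>E F p q M e. E \<in> occ \<Longrightarrow> F \<in> occ \<Longrightarrow> p \<longlonglongrightarrow> 1 / 2 \<Longrightarrow> (\<And>N. 0 \<le> p N) \<Longrightarrow> (\<And>N. p N \<le> 1) \<Longrightarrow>
      filterlim M at_top sequentially \<Longrightarrow> (\<And>N. 0 \<le> q N) \<Longrightarrow> (\<And>N. q N \<le> 1) \<Longrightarrow> (\<And>N. s = t \<Longrightarrow> q N = 0) \<Longrightarrow>
      (\<lambda>N. real (M N) * q N) \<longlonglongrightarrow> lam * (t - s) \<Longrightarrow> (\<And>N. ker (M N) E F \<noteq> 0) \<Longrightarrow> e > 0 \<Longrightarrow>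
      \<forall>\<^sub>F N in sequentially. \<bar>bridge (M N) (p N) (q N) E G H F - v\<bar> \<le> K + e"
  shows "\<bar>measure P {X \<in> space P. X s = G \<and> X t = H} - v\<bar> \<le> K"
proof -
  interpret prob_space P by (rule P_facts)
  define A where "A = {Y \<in> bead_paths n l. Y s = G \<and> Y t = H}"
  have A: "A \<in> sets P"
  proof -
    have "A = {Y \<in> bead_paths n l. Y s = G} \<inter> {Y \<in> bead_paths n l. Y t = H}" by (auto simp: A_def)
    then show ?thesis unfolding P_facts(3) by (simp only:) (rule sets.Int[OF cyl_sets cyl_sets])
  qed
  \<comment> \<open>The offset keeps \<open>s\<close> and \<open>t\<close> inside every
    window.\<close>
  define L where "L N = real N + (\<bar>s\<bar> + \<bar>t\<bar> + 1)" for N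
  have L: "L N > 0" "- L N < s" "t < L N" "- L N < L N" for N by (auto simp: L_def)
  have Ltop: "filterlim L at_top sequentially"
    unfolding L_def by (rule filterlim_tendsto_add_at_top[OF tendsto_const filterlim_real_sequentially, of "\<bar>s\<bar> + \<bar>t\<bar> + 1", unfolded add.commute[of "\<bar>s\<bar> + \<bar>t\<bar> + 1"]])
  have invL: "(\<lambda>N. r / L N) \<longlonglongrightarrow> 0" for r
    by (rule tendsto_divide_0[OF tendsto_const filterlim_at_top_imp_at_infinity[OF Ltop]])
  define c where "c N = real_cond_exp P (outside_algebra n l (- L N) (L N)) (indicator A)" for N
  define m where "m X N = card (beads_in n (- L N) (L N) X)" for X N
  \<comment> \<open>Both pieces outside the interval from \<open>s\<close> to \<open>t\<close> have
    length \<open>L N\<close> up to a constant, hence the limit \<open>1 / 2\<close>.\<close>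
  define p where "p N = (s + L N) / ((s + L N) + (L N - t))" for N
  define q where "q N = (t - s) / (2 * L N)" for N
  have iA: "integrable P (indicator A :: _ \<Rightarrow> real)" using A by (simp add: emeasure_eq_measure)
  have c_meas: "c N \<in> borel_measurable P" and c_int: "(\<integral>X. c N X \<partial>P) = measure P A"
    and c_bnd: "AE X in P. 0 \<le> c N X \<and> c N X \<le> 1" for N
  proof -
    interpret finite_measure_subalgebra P "outside_algebra n l (- L N) (L N)" by (rule cond_subalgebra)
    show "c N \<in> borel_measurable P" unfolding c_def by simp
    show "(\<integral>X. c N X \<partial>P) = measure P A" unfolding c_def using real_cond_exp_int(2)[OF iA] A by simp
    have "AE X in P. c N X \<ge> 0" "AE X in P. c N X \<le> 1"
      unfolding c_def by (rule real_cond_exp_ge_c[OF iA] real_cond_exp_le_c[OF iA], simp)+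
    then show "AE X in P. 0 \<le> c N X \<and> c N X \<le> 1" by eventually_elim simp
  qed
  have E1: "AE X in P. \<forall>N. left_lim X (L N) = X (L N) \<and> left_lim X (- L N) = X (- L N)"
    unfolding AE_all_countable using no_fixed_jump by (intro allI AE_conjI)
  have E2: "AE X in P. \<forall>N. c N X = measure (uniform_beads n l (- L N) (L N) X (m X N)) (configs n l (- L N) (L N) X (m X N) A)"
    unfolding AE_all_countable c_def m_def by (intro allI cond_prob_configs L A)
  have E3: "AE X in P. \<forall>h\<in>{..<n}. ((\<lambda>L. real (card (beads n X \<inter> ({- L..L} \<times> {h}))) / (2 * L)) \<longlongrightarrow> lam / real n) at_top"
    using density unfolding has_bead_density_def by (intro AE_finite_allI) auto
  have p: "p \<longlonglongrightarrow> 1 / 2" "0 \<le> p N" "p N \<le> 1" for N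
  proof -
    show "0 \<le> p N" unfolding p_def using L[of N] by (intro divide_nonneg_nonneg) auto
    show "p N \<le> 1" unfolding p_def using L[of N] by (intro divide_le_eq_1_pos[THEN iffD2]) auto
    have "(\<lambda>N. (s / L N + 1) / ((s / L N + 1) + (1 - t / L N))) \<longlonglongrightarrow> (0 + 1) / ((0 + 1) + (1 - 0))"
      by (intro tendsto_intros invL) simp
    moreover have "(s / L N + 1) / ((s / L N + 1) + (1 - t / L N)) = p N" for N
    proof -
      have "s / L N + 1 = (s + L N) / L N" "1 - t / L N = (L N - t) / L N" using L(1)[of N] by (simp_all add: field_simps)
      then show ?thesis unfolding p_def using L(1)[of N] by (simp add: add_divide_distrib[symmetric])
    qed
    ultimately show "p \<longlonglongrightarrow> 1 / 2" by simp
  qed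
  have q: "0 \<le> q N" "q N \<le> 1" "s = t \<Longrightarrow> q N = 0" for N
  proof -
    show "0 \<le> q N" unfolding q_def using L[of N] st by simp
    have "t - s \<le> 2 * L N" using L(2,3)[of N] by linarith
    then show "q N \<le> 1" unfolding q_def using L(1)[of N] by simp
    show "s = t \<Longrightarrow> q N = 0" by (simp add: q_def)
  qed
  have main: "AE X in P. \<forall>k::nat. \<forall>\<^sub>F N in sequentially. \<bar>c N X - v\<bar> \<le> K + 1 / real (Suc k)"
    using E1 E2 E3 AE_space
  proof eventually_elim
    case (elim X)
    then have X: "X \<in> bead_paths n l" by (simp add: P_facts(2))
    have ends: "left_lim X (L N) = X (L N)" "left_lim X (- L N) = X (- L N)" for N using elim(1) by simp_all
    \<comment> \<open>Summing over the \<open>n\<close> strings turns the density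
      \<open>lam / n\<close> per string into \<open>lam\<close> beads per unit of time.\<close>
    have dens: "(\<lambda>N. real (m X N) / (2 * L N)) \<longlonglongrightarrow> lam"
    proof -
      have "(\<lambda>N. real (card (beads n X \<inter> ({- L N..L N} \<times> {h}))) / (2 * L N)) \<longlonglongrightarrow> lam / real n" if "h \<in> {..<n}" for h
        by (rule filterlim_compose[OF elim(3)[rule_format, OF that] Ltop])
      then have "(\<lambda>N. \<Sum>h<n. real (card (beads n X \<inter> ({- L N..L N} \<times> {h}))) / (2 * L N)) \<longlonglongrightarrow> (\<Sum>h<n. lam / real n)"
        by (rule tendsto_sum)
      moreover have "(\<Sum>h<n. real (card (beads n X \<inter> ({- L N..L N} \<times> {h}))) / (2 * L N)) = real (m X N) / (2 * L N)" for N
        unfolding m_def card_beads_strings[OF X ends(2,1), symmetric] by (simp add: sum_divide_distrib)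
      ultimately show ?thesis using n2 by simp
    qed
    have mq: "(\<lambda>N. real (m X N) * q N) \<longlonglongrightarrow> lam * (t - s)"
    proof -
      have "(\<lambda>N. real (m X N) / (2 * L N) * (t - s)) \<longlonglongrightarrow> lam * (t - s)" by (intro tendsto_intros dens)
      then show ?thesis by (simp add: q_def)
    qed
    have mtop: "filterlim (m X) at_top sequentially"
    proof -
      have "filterlim (\<lambda>N. 2 * L N) at_top sequentially"
        by (rule filterlim_tendsto_pos_mult_at_top[OF tendsto_const _ Ltop]) simp
      then have "filterlim (\<lambda>N. real (m X N) / (2 * L N) * (2 * L N)) at_top sequentially"
        by (rule filterlim_tendsto_pos_mult_at_top[OF dens lam_pos])
      moreover have "real (m X N) / (2 * L N) * (2 * L N) = real (m X N)" for N using L(1)[of N] by simp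
      ultimately have "filterlim (\<lambda>N. real (m X N)) at_top sequentially" by simp
      then show ?thesis by (simp only: filterlim_sequentially_iff_filterlim_real)
    qed
    have xocc: "X r \<in> occ" for r by (rule bead_paths_D(1)[OF X])
    have br: "c N X = bridge (m X N) (p N) (q N) (X (- L N)) G H (X (L N))" "ker (m X N) (X (- L N)) (X (L N)) \<noteq> 0" for N
    proof -
      have "m X N = card (beads_in n (- L N) (L N) X)" by (simp add: m_def)
      note u = uniform_beads_cyl[OF X L(4) ends(1) this L(2) st L(3) GH]
      have "c N X = measure (uniform_beads n l (- L N) (L N) X (m X N)) (configs n l (- L N) (L N) X (m X N) A)"
        using elim(2) by blast
      then show "c N X = bridge (m X N) (p N) (q N) (X (- L N)) G H (X (L N))"
        unfolding A_def u(1) by (simp add: p_def q_def)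
      show "ker (m X N) (X (- L N)) (X (L N)) \<noteq> 0" by (rule u(2))
    qed
    show ?case
    proof
      fix k :: nat
      show "\<forall>\<^sub>F N in sequentially. \<bar>c N X - v\<bar> \<le> K + 1 / real (Suc k)"
      \<comment> \<open>The end states vary with \<open>N\<close>; where they are constant along a
        subsequence, \<open>near\<close> applies.\<close>
      proof (rule eventually_finite_range[of "occ \<times> occ" "\<lambda>N. (X (- L N), X (L N))"])
        show "finite (occ \<times> occ)" using finite_occupied_sets by simp
        show "(X (- L N), X (L N)) \<in> occ \<times> occ" for N using xocc by simp
        fix \<sigma> :: "nat \<Rightarrow> nat" and y assume \<sigma>: "strict_mono \<sigma>" and y: "\<And>k. (X (- L (\<sigma> k)), X (L (\<sigma> k))) = y"
        obtain E F where EF: "y = (E, F)" by (cases y)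
        have ey: "X (- L (\<sigma> k)) = E" "X (L (\<sigma> k)) = F" for k using y[of k] EF by simp_all
        have \<sigma>top: "filterlim \<sigma> at_top sequentially" by (rule filterlim_subseq[OF \<sigma>])
        have "\<forall>\<^sub>F N in sequentially. \<bar>bridge (m X (\<sigma> N)) (p (\<sigma> N)) (q (\<sigma> N)) E G H F - v\<bar> \<le> K + 1 / real (Suc k)"
        proof (rule near)
          show "E \<in> occ" "F \<in> occ" using xocc ey by metis+
          show "(\<lambda>N. p (\<sigma> N)) \<longlonglongrightarrow> 1 / 2" by (rule filterlim_compose[OF p(1) \<sigma>top])
          show "filterlim (\<lambda>N. m X (\<sigma> N)) at_top sequentially" by (rule filterlim_compose[OF mtop \<sigma>top])
          show "(\<lambda>N. real (m X (\<sigma> N)) * q (\<sigma> N)) \<longlonglongrightarrow> lam * (t - s)" by (rule filterlim_compose[OF mq \<sigma>top])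
          show "ker (m X (\<sigma> N)) E F \<noteq> 0" for N using br(2)[of "\<sigma> N"] unfolding ey .
        qed (use p q in auto)
        then show "\<forall>\<^sub>F j in sequentially. \<bar>c (\<sigma> j) X - v\<bar> \<le> K + 1 / real (Suc k)"
          unfolding br(1) ey .
      qed
    qed
  qed
  have "\<bar>measure P A - v\<bar> \<le> K"
    by (rule expectation_near[OF c_meas c_bnd c_int K main])
  then show ?thesis by (simp add: A_def P_facts(2))
qed

text \<open>Taking both times equal empties the middle interval, so the tolerance \<open>K\<close>
  can be 0 and the law comes out exactly.\<close>

lemma prob_single:
  assumes density: "has_bead_density n P (lam / real n)" and G: "G \<in> occ"
  shows "measure P {X \<in> space P. X s = G} = stat G"
proof -
  have "\<bar>measure P {X \<in> space P. X s = G \<and> X s = G} - stat G\<bar> \<le> 0"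
  proof (rule prob_near[OF density order_refl G G order_refl])
    fix E F :: "nat set" and p q :: "nat \<Rightarrow> real" and M :: "nat \<Rightarrow> nat" and e :: real
    assume h: "E \<in> occ" "F \<in> occ" "p \<longlonglongrightarrow> 1 / 2" "\<And>N. 0 \<le> p N" "\<And>N. p N \<le> 1" "filterlim M at_top sequentially"
      "\<And>N. s = s \<Longrightarrow> q N = 0" "\<And>N. ker (M N) E F \<noteq> 0" "e > 0"
    have "(\<lambda>N. bridge (M N) (p N) 0 E G G F) \<longlonglongrightarrow> stat G"
      by (rule bridge_tendsto[OF h(1) G h(2,3,4,5,6,8)])
    then have "\<forall>\<^sub>F N in sequentially. dist (bridge (M N) (p N) 0 E G G F) (stat G) < e" using h(9) by (rule tendstoD)
    then show "\<forall>\<^sub>F N in sequentially. \<bar>bridge (M N) (p N) (q N) E G G F - stat G\<bar> \<le> 0 + e"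
      by eventually_elim (simp add: h(7) dist_real_def)
  qed
  then show ?thesis by simp
qed

text \<open>The error in \<open>bridge_near\<close> depends on the right end state \<open>F\<close>;
  the sum over all \<open>F\<close> is a constant valid for each of them, here with
  \<open>\<mu> = lam * (t - s)\<close>.\<close>

lemma prob_jump_near:
  assumes density: "has_bead_density n P (lam / real n)" and GH: "G \<in> occ" "H \<in> occ" "G \<noteq> H" and st: "s \<le> t"
  shows "\<bar>measure P {X \<in> space P. X s = G \<and> X t = H} - lam * (t - s) * ker 1 G H * stat G\<bar>
    \<le> (\<Sum>F\<in>occ. 2 * lam\<^sup>2 / (real n * stat F)) * (t - s)\<^sup>2"
proof (rule prob_near[OF density st GH(1,2)])
  have pos: "0 \<le> 2 * lam\<^sup>2 / (real n * stat F)" if "F \<in> occ" for F using stat_pos[OF that] by simp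
  then show "0 \<le> (\<Sum>F\<in>occ. 2 * lam\<^sup>2 / (real n * stat F)) * (t - s)\<^sup>2" by (intro mult_nonneg_nonneg sum_nonneg) auto
  fix E F :: "nat set" and p q :: "nat \<Rightarrow> real" and M :: "nat \<Rightarrow> nat" and e :: real
  assume h: "E \<in> occ" "F \<in> occ" "p \<longlonglongrightarrow> 1 / 2" "\<And>N. 0 \<le> p N" "\<And>N. p N \<le> 1" "filterlim M at_top sequentially"
    "\<And>N. 0 \<le> q N" "\<And>N. q N \<le> 1" "(\<lambda>N. real (M N) * q N) \<longlonglongrightarrow> lam * (t - s)" "\<And>N. ker (M N) E F \<noteq> 0" "e > 0"
  have "\<forall>\<^sub>F N in sequentially. \<bar>bridge (M N) (p N) (q N) E G H F - lam * (t - s) * ker 1 G H * stat G\<bar>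
    \<le> 2 * (lam * (t - s))\<^sup>2 / (real n * stat F) + e"
    by (rule bridge_near[OF h(1) GH(1,2) h(2) GH(3) h(3,4,5,6,7,8,9,10,11)])
  moreover have "2 * (lam * (t - s))\<^sup>2 / (real n * stat F) \<le> (\<Sum>F\<in>occ. 2 * lam\<^sup>2 / (real n * stat F)) * (t - s)\<^sup>2"
  proof -
    have "2 * lam\<^sup>2 / (real n * stat F) \<le> (\<Sum>F\<in>occ. 2 * lam\<^sup>2 / (real n * stat F))"
      using pos h(2) by (intro member_le_sum finite_occupied_sets) auto
    then have "2 * lam\<^sup>2 / (real n * stat F) * (t - s)\<^sup>2 \<le> (\<Sum>F\<in>occ. 2 * lam\<^sup>2 / (real n * stat F)) * (t - s)\<^sup>2"
      by (rule mult_right_mono) simp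
    then show ?thesis by (simp add: power_mult_distrib mult_ac)
  qed
  ultimately show "\<forall>\<^sub>F N in sequentially. \<bar>bridge (M N) (p N) (q N) E G H F - lam * (t - s) * ker 1 G H * stat G\<bar>
    \<le> (\<Sum>F\<in>occ. 2 * lam\<^sup>2 / (real n * stat F)) * (t - s)\<^sup>2 + e"
    by (elim eventually_mono) linarith
qed

text \<open>Divided by \<open>t * stat E\<close>, the quadratic error becomes linear in
  \<open>t\<close>. The rate is \<open>lam * ker 1 E E'\<close>, where the eigenvalue cancels: to
  leading order a clock of rate \<open>lam\<close> triggers one step of \<open>ker\<close>.\<close>

lemma transition_rate:
  assumes density: "has_bead_density n P (lam / real n)" and E: "E \<in> occ" and hop: "hop n E h E'"
  shows "((\<lambda>t. 1 / t * \<P>(X in P. X t = E' \<bar> X 0 = E)) \<longlongrightarrow> vdm n E' / vdm n E) (at_right 0)"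
proof -
  have E': "E' \<in> occ" "E \<noteq> E'" using hop_occupied(1)[OF hop E] hop_neq[OF hop] by auto
  define C where "C = (\<Sum>F\<in>occ. 2 * lam\<^sup>2 / (real n * stat F))"
  have rate: "lam * ker 1 E E' = vdm n E' / vdm n E"
  proof -
    have "E' \<in> hops n E" using hop by (auto simp: hops_def)
    then show ?thesis using lam_pos by (simp add: ker_def walks_1)
  qed
  have sE: "stat E > 0" by (rule stat_pos[OF E])
  have bound: "norm (1 / t * \<P>(X in P. X t = E' \<bar> X 0 = E) - vdm n E' / vdm n E) \<le> C / stat E * t" if t: "0 < t" for t
  proof -
    define m where "m = measure P {X \<in> space P. X 0 = E \<and> X t = E'}"
    have cp: "\<P>(X in P. X t = E' \<bar> X 0 = E) = m / stat E"
      unfolding cond_prob_def m_def prob_single[OF density E] by (simp add: conj_commute)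
    have "\<bar>m - lam * t * ker 1 E E' * stat E\<bar> \<le> C * t\<^sup>2"
      using prob_jump_near[OF density E E', of 0 t] t unfolding m_def C_def by simp
    then have "\<bar>m - lam * t * ker 1 E E' * stat E\<bar> / (t * stat E) \<le> C * t\<^sup>2 / (t * stat E)"
      using t sE by (intro divide_right_mono) auto
    moreover have "1 / t * (m / stat E) - lam * ker 1 E E' = (m - lam * t * ker 1 E E' * stat E) / (t * stat E)"
      using t sE by (simp add: field_simps)
    ultimately show ?thesis unfolding cp rate[symmetric] using t sE
      by (simp add: abs_mult power2_eq_square)
  qed
  have "((\<lambda>t. 1 / t * \<P>(X in P. X t = E' \<bar> X 0 = E) - vdm n E' / vdm n E) \<longlongrightarrow> 0) (at_right 0)"
  proof (rule Lim_null_comparison)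
    show "\<forall>\<^sub>F t in at_right 0. norm (1 / t * \<P>(X in P. X t = E' \<bar> X 0 = E) - vdm n E' / vdm n E) \<le> C / stat E * t"
      using eventually_at_right_less[of "0::real"] by eventually_elim (rule bound)
    have "((\<lambda>t. C / stat E * t) \<longlongrightarrow> C / stat E * 0) (at_right 0)" by (intro tendsto_intros)
    then show "((\<lambda>t. C / stat E * t) \<longlongrightarrow> 0) (at_right 0)" by simp
  qed
  then show ?thesis by (simp add: LIM_zero_iff)
qed

end

end

theorem theorem1p11:
  fixes n l :: nat and P :: "(real \<Rightarrow> nat set) measure"
  assumes "2 \<le> n" and "1 \<le> l" and "l \<le> n - 1"
    and "gibbs_measure n l P"
    and "has_bead_density n P
           (1 / real n * (sin (pi * real l / real n) / sin (pi / real n)))"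
  shows "(\<forall>E \<in> occupied_sets n l. \<forall>h E'. hop n E h E' \<longrightarrow>
            ((\<lambda>t. 1 / t * \<P>(X in P. X t = E' \<bar> X 0 = E)) \<longlongrightarrow> vdm n E' / vdm n E) (at_right 0))
       \<and> (\<forall>E \<in> occupied_sets n l. \<P>(X in P. X 0 = E) = (vdm n E)\<^sup>2 / real n ^ l)
       \<and> (\<forall>E \<in> occupied_sets n l. \<forall>t. \<P>(X in P. X t = E) = \<P>(X in P. X 0 = E))"
proof -
  interpret bead_ring n l by unfold_locales (rule assms)+
  have d: "has_bead_density n P (lam / real n)" using assms(5) by (simp add: lam_def mult.commute)
  show ?thesis
  proof (intro conjI ballI allI impI)
    fix E h E' assume "E \<in> occupied_sets n l" "hop n E h E'"
    then show "((\<lambda>t. 1 / t * \<P>(X in P. X t = E' \<bar> X 0 = E)) \<longlongrightarrow> vdm n E' / vdm n E) (at_right 0)"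
      by (rule transition_rate[OF assms(4) d])
  next
    fix E assume "E \<in> occupied_sets n l"
    then show "\<P>(X in P. X 0 = E) = (vdm n E)\<^sup>2 / real n ^ l"
      using prob_single[OF assms(4) d] by (simp add: stat_def)
  next
    fix E t assume "E \<in> occupied_sets n l"
    then show "\<P>(X in P. X t = E) = \<P>(X in P. X 0 = E)"
      using prob_single[OF assms(4) d] by simp
  qed
qed

end
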